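(* Let $r > 3$ be a prime and let $A_r$ be the quaternion algebra over $\mathbb{Q}$ ramified exactly at $r$ and $\infty$. Then $3$ is an outlier for $A_r$ if and only if $\left(\frac{-3}{r}\right) = \left(\frac{-11}{r}\right) = \left(\frac{-2}{r}\right) = 1$, where $\left(\frac{\cdot}{r}\right)$ is the Legendre symbol. The set of primes $r$ for which this holds is infinite and has (Dirichlet) density $\frac{1}{8}$.
   Context: An element of $A_r$ is an integer if its monic minimal polynomial over $\mathbb{Q}$ has coefficients in $\mathbb{Z}$. A positive integer $m$ is an outlier for $A_r$ if it is not the reduced norm of any integer of $A_r$ (every positive integer is a reduced norm of some element of $A_r$). *)

theory Defs
  imports
    "HOL-Algebra.QuotRing"
    "HOL-Algebra.Algebraic_Closure_Type"
    "HOL-Number_Theory.Number_Theory"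
    "HOL-Analysis.Analysis"
begin

section \<open>Quaternion algebras\<close>

text \<open>
  Over a field \<open>F\<close> of characteristic different from 2 the quaternion algebras are, up to
  isomorphism, exactly the algebras \<open>(a, b | F)\<close> with \<open>a, b \<noteq> 0\<close>: they have basis \<open>1, i, j, k\<close> with
  \<open>i\<^sup>2 = a\<close>, \<open>j\<^sup>2 = b\<close>, \<open>i j = k = - j i\<close>.  The tuple \<open>(x0, x1, x2, x3)\<close> stands for
  \<open>x0 + x1 i + x2 j + x3 k\<close>.  The field is a HOL-Algebra structure because the completion at
  \<open>p\<close> depends on a term.
\<close>

definition quat_alg ::
    "('f, 'm) ring_scheme \<Rightarrow> 'f \<Rightarrow> 'f \<Rightarrow> ('f, 'f \<times> 'f \<times> 'f \<times> 'f) module" where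
  "quat_alg F a b = \<lparr>
     carrier = carrier F \<times> carrier F \<times> carrier F \<times> carrier F,
     monoid.mult = (\<lambda>(x0, x1, x2, x3) (y0, y1, y2, y3).
       (x0 \<otimes>\<^bsub>F\<^esub> y0 \<oplus>\<^bsub>F\<^esub> a \<otimes>\<^bsub>F\<^esub> x1 \<otimes>\<^bsub>F\<^esub> y1
          \<oplus>\<^bsub>F\<^esub> b \<otimes>\<^bsub>F\<^esub> x2 \<otimes>\<^bsub>F\<^esub> y2 \<ominus>\<^bsub>F\<^esub> a \<otimes>\<^bsub>F\<^esub> b \<otimes>\<^bsub>F\<^esub> x3 \<otimes>\<^bsub>F\<^esub> y3,
        x0 \<otimes>\<^bsub>F\<^esub> y1 \<oplus>\<^bsub>F\<^esub> x1 \<otimes>\<^bsub>F\<^esub> y0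
          \<ominus>\<^bsub>F\<^esub> b \<otimes>\<^bsub>F\<^esub> x2 \<otimes>\<^bsub>F\<^esub> y3 \<oplus>\<^bsub>F\<^esub> b \<otimes>\<^bsub>F\<^esub> x3 \<otimes>\<^bsub>F\<^esub> y2,
        x0 \<otimes>\<^bsub>F\<^esub> y2 \<oplus>\<^bsub>F\<^esub> x2 \<otimes>\<^bsub>F\<^esub> y0
          \<oplus>\<^bsub>F\<^esub> a \<otimes>\<^bsub>F\<^esub> x1 \<otimes>\<^bsub>F\<^esub> y3 \<ominus>\<^bsub>F\<^esub> a \<otimes>\<^bsub>F\<^esub> x3 \<otimes>\<^bsub>F\<^esub> y1,
        x0 \<otimes>\<^bsub>F\<^esub> y3 \<oplus>\<^bsub>F\<^esub> x3 \<otimes>\<^bsub>F\<^esub> y0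
          \<oplus>\<^bsub>F\<^esub> x1 \<otimes>\<^bsub>F\<^esub> y2 \<ominus>\<^bsub>F\<^esub> x2 \<otimes>\<^bsub>F\<^esub> y1)),
     one = (\<one>\<^bsub>F\<^esub>, \<zero>\<^bsub>F\<^esub>, \<zero>\<^bsub>F\<^esub>, \<zero>\<^bsub>F\<^esub>),
     zero = (\<zero>\<^bsub>F\<^esub>, \<zero>\<^bsub>F\<^esub>, \<zero>\<^bsub>F\<^esub>, \<zero>\<^bsub>F\<^esub>),
     add = (\<lambda>(x0, x1, x2, x3) (y0, y1, y2, y3).
       (x0 \<oplus>\<^bsub>F\<^esub> y0, x1 \<oplus>\<^bsub>F\<^esub> y1, x2 \<oplus>\<^bsub>F\<^esub> y2, x3 \<oplus>\<^bsub>F\<^esub> y3)),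
     module.smult = (\<lambda>c (x0, x1, x2, x3).
       (c \<otimes>\<^bsub>F\<^esub> x0, c \<otimes>\<^bsub>F\<^esub> x1, c \<otimes>\<^bsub>F\<^esub> x2, c \<otimes>\<^bsub>F\<^esub> x3)) \<rparr>"

definition is_division_ring :: "('a, 'm) ring_scheme \<Rightarrow> bool" where
  "is_division_ring D \<longleftrightarrow> ring D \<and> Units D = carrier D - {\<zero>\<^bsub>D\<^esub>}"

abbreviation quat_alg_rat :: "rat \<Rightarrow> rat \<Rightarrow> (rat, rat \<times> rat \<times> rat \<times> rat) module" where
  "quat_alg_rat a b \<equiv> quat_alg ring_of_type_algebra a b"


section \<open>The field of p-adic numbers and ramification\<close>

definition padic_abs :: "nat \<Rightarrow> rat \<Rightarrow> real" where
  "padic_abs p q = (if q = 0 then 0 else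
     real p powi (int (multiplicity (int p) (snd (quotient_of q)))
                  - int (multiplicity (int p) (fst (quotient_of q)))))"

definition padic_Cauchy :: "nat \<Rightarrow> (nat \<Rightarrow> rat) set" where
  "padic_Cauchy p = {x. \<forall>e>0. \<exists>N. \<forall>m\<ge>N. \<forall>n\<ge>N. padic_abs p (x m - x n) < e}"

definition padic_null :: "nat \<Rightarrow> (nat \<Rightarrow> rat) set" where
  "padic_null p = {x. (\<lambda>n. padic_abs p (x n)) \<longlonglongrightarrow> 0}"

definition padic_Cauchy_ring :: "nat \<Rightarrow> (nat \<Rightarrow> rat) ring" where
  "padic_Cauchy_ring p = \<lparr>
     carrier = padic_Cauchy p,
     monoid.mult = (\<lambda>x y n. x n * y n),
     one = (\<lambda>n. 1),
     zero = (\<lambda>n. 0),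
     add = (\<lambda>x y n. x n + y n) \<rparr>"

text \<open>\<open>\<rat>\<^sub>p\<close>, the completion of \<open>\<rat>\<close>: Cauchy sequences modulo null sequences.\<close>

definition padic_field :: "nat \<Rightarrow> (nat \<Rightarrow> rat) set ring" where
  "padic_field p = padic_Cauchy_ring p Quot padic_null p"

definition padic_of_rat :: "nat \<Rightarrow> rat \<Rightarrow> (nat \<Rightarrow> rat) set" where
  "padic_of_rat p q = padic_null p +>\<^bsub>padic_Cauchy_ring p\<^esub> (\<lambda>n. q)"

text \<open>
  \<open>(a, b | \<rat>)\<close> is ramified at a place \<open>v\<close> if its base change to \<open>\<rat>\<^sub>v\<close>, which is
  \<open>(a, b | \<rat>\<^sub>v)\<close>, is a division algebra.
\<close>

definition ramified_at_prime :: "rat \<Rightarrow> rat \<Rightarrow> nat \<Rightarrow> bool" where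
  "ramified_at_prime a b p \<longleftrightarrow>
     is_division_ring (quat_alg (padic_field p) (padic_of_rat p a) (padic_of_rat p b))"

definition ramified_at_infinity :: "rat \<Rightarrow> rat \<Rightarrow> bool" where
  "ramified_at_infinity a b \<longleftrightarrow>
     is_division_ring (quat_alg (ring_of_type_algebra :: real ring) (of_rat a) (of_rat b))"

definition ramified_exactly_at_and_infinity :: "rat \<Rightarrow> rat \<Rightarrow> nat \<Rightarrow> bool" where
  "ramified_exactly_at_and_infinity a b r \<longleftrightarrow>
     a \<noteq> 0 \<and> b \<noteq> 0 \<and> ramified_at_infinity a b \<and>
     (\<forall>p. Factorial_Ring.prime p \<longrightarrow> (ramified_at_prime a b p \<longleftrightarrow> p = r))"


section \<open>Integers, reduced norms and outliers\<close>

definition quat_eval ::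
    "rat \<Rightarrow> rat \<Rightarrow> rat poly \<Rightarrow> rat \<times> rat \<times> rat \<times> rat \<Rightarrow> rat \<times> rat \<times> rat \<times> rat" where
  "quat_eval a b f x =
     (\<Oplus>\<^bsub>quat_alg_rat a b\<^esub>n\<in>{..Polynomial.degree f}.
        Polynomial.coeff f n \<odot>\<^bsub>quat_alg_rat a b\<^esub> (x [^]\<^bsub>quat_alg_rat a b\<^esub> n))"

definition is_quat_min_poly ::
    "rat \<Rightarrow> rat \<Rightarrow> rat poly \<Rightarrow> rat \<times> rat \<times> rat \<times> rat \<Rightarrow> bool" where
  "is_quat_min_poly a b f x \<longleftrightarrow>
     Polynomial.lead_coeff f = 1 \<and> quat_eval a b f x = \<zero>\<^bsub>quat_alg_rat a b\<^esub> \<and>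
     (\<forall>g. g \<noteq> 0 \<longrightarrow> quat_eval a b g x = \<zero>\<^bsub>quat_alg_rat a b\<^esub> \<longrightarrow>
        Polynomial.degree f \<le> Polynomial.degree g)"

definition is_quat_integer :: "rat \<Rightarrow> rat \<Rightarrow> rat \<times> rat \<times> rat \<times> rat \<Rightarrow> bool" where
  "is_quat_integer a b x \<longleftrightarrow>
     (\<exists>f. is_quat_min_poly a b f x \<and> (\<forall>n. Polynomial.coeff f n \<in> \<int>))"

fun quat_conj :: "rat \<times> rat \<times> rat \<times> rat \<Rightarrow> rat \<times> rat \<times> rat \<times> rat" where
  "quat_conj (x0, x1, x2, x3) = (x0, - x1, - x2, - x3)"

fun quat_nrd :: "rat \<Rightarrow> rat \<Rightarrow> rat \<times> rat \<times> rat \<times> rat \<Rightarrow> rat" where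
  "quat_nrd a b (x0, x1, x2, x3) = x0\<^sup>2 - a * x1\<^sup>2 - b * x2\<^sup>2 + a * b * x3\<^sup>2"

lemma rat_structure_simps:
  "carrier (ring_of_type_algebra :: rat ring) = UNIV"
  "x \<otimes>\<^bsub>ring_of_type_algebra\<^esub> y = x * (y :: rat)"
  "x \<oplus>\<^bsub>ring_of_type_algebra\<^esub> y = x + (y :: rat)"
  "x \<ominus>\<^bsub>ring_of_type_algebra\<^esub> y = x - (y :: rat)"
  "\<one>\<^bsub>ring_of_type_algebra\<^esub> = (1 :: rat)"
  "\<zero>\<^bsub>ring_of_type_algebra\<^esub> = (0 :: rat)"
proof -
  interpret R: cring "ring_of_type_algebra :: rat ring"
    by (rule cring_from_type_algebra)
  show "x \<ominus>\<^bsub>ring_of_type_algebra\<^esub> y = x - y"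
  proof -
    have "\<ominus>\<^bsub>ring_of_type_algebra\<^esub> y = - y"
      by (rule R.minus_equality) (simp_all add: ring_of_type_algebra_def)
    then show ?thesis
      by (simp add: a_minus_def ring_of_type_algebra_def)
  qed
qed (simp_all add: ring_of_type_algebra_def)

text \<open>The reduced norm is characterised by \<open>x x\<^sup>* = nrd x\<close>, where \<open>x\<^sup>*\<close> is the conjugate.\<close>

lemma quat_mult_conj:
  "x \<otimes>\<^bsub>quat_alg_rat a b\<^esub> quat_conj x = quat_nrd a b x \<odot>\<^bsub>quat_alg_rat a b\<^esub> \<one>\<^bsub>quat_alg_rat a b\<^esub>"
  by (cases x) (simp add: quat_alg_def rat_structure_simps power2_eq_square)

definition is_outlier :: "rat \<Rightarrow> rat \<Rightarrow> nat \<Rightarrow> bool" where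
  "is_outlier a b m \<longleftrightarrow> m > 0 \<and>
     \<not> (\<exists>x \<in> carrier (quat_alg_rat a b). is_quat_integer a b x \<and> quat_nrd a b x = of_nat m)"


section \<open>Dirichlet density\<close>

definition has_Dirichlet_density :: "nat set \<Rightarrow> real \<Rightarrow> bool" where
  "has_Dirichlet_density S d \<longleftrightarrow>
     ((\<lambda>s :: real. (\<Sum>\<^sub>\<infinity>p | Factorial_Ring.prime p \<and> p \<in> S. real p powr (- s))
                   / (\<Sum>\<^sub>\<infinity>p | Factorial_Ring.prime p. real p powr (- s)))
       \<longlongrightarrow> d) (at_right 1)"

end

theory Submission
  imports Defs "HOL-Computational_Algebra.Squarefree" "HOL-Library.Function_Algebras"
begin

text \<open>
  An integer of reduced norm 3 has trace \<open>t\<close> with \<open>t\<^sup>2 < 12\<close>, and twice its pure part has square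
  \<open>t\<^sup>2 - 12\<close>.  Hence 3 is an outlier iff none of the fields \<open>\<rat>(\<surd>-3)\<close>, \<open>\<rat>(\<surd>-11)\<close>, \<open>\<rat>(\<surd>-2)\<close> embeds into
  the algebra.  If \<open>-d\<close> is a nonzero square modulo \<open>r\<close>, then it is a square in \<open>\<rat>\<^sub>r\<close>, and an embedding of
  \<open>\<rat>(\<surd>-d)\<close> would give zero divisors in the completion at \<open>r\<close>.  Otherwise \<open>K = \<rat>(\<surd>-d)\<close> splits the algebra
  \<open>(a, b)\<close> at all places.  The integers of the three fields form Euclidean rings, so that Legendre's
  descent solves \<open>z\<^sup>2 = a x\<^sup>2 + b y\<^sup>2\<close> over \<open>K\<close> from the conditions at the odd primes alone, and a
  solution yields a pure rational quaternion of square \<open>-d\<close>.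

  For the density, the indicator of the three conditions is expanded into the eight products of the
  quadratic characters.  Only \<open>L(1, \<chi>) \<noteq> 0\<close> for real \<open>\<chi>\<close> is needed, for which Monsky's argument with the
  Lambert series \<open>\<Sum> \<chi>(n) t\<^sup>n / (1 - t\<^sup>n)\<close> suffices.
\<close>


section \<open>Legendre's descent in Euclidean domains\<close>

text \<open>The fields \<open>real\<close> and \<open>rat\<close> are Euclidean rings here, so that these rules apply to their division and
  make \<open>field_simps\<close> loop.\<close>
declare div_mult_self1 [simp del] div_mult_self2 [simp del] div_mult_self3 [simp del]
  div_mult_self4 [simp del] div_add_self1 [simp del] div_add_self2 [simp del]

text \<open>Why odd primes suffice: each of the three fields is complex and has a single prime above
  2 (ramified for -2, inert for -3 and -11, which are 5 modulo 8), so the product formula for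
  Hilbert symbols makes the condition at 2 follow from the others. The field removes the
  ramification at r because r does not split in it, and that at infinity because it is complex. The
  obstacle is the size of the descent step. Over the integers a root w of a modulo b can be taken
  with |w| at most |b|/2, and (w^2 - a)/b shrinks at once. Here w is reduced modulo a planar lattice
  whose squared covering radius is 3/4, 1/3 or 9/11 of the norm of b, so the step can fail while
  that norm is small: up to 16, 2 and 30. These cases are enumerated, and the exceptional pairs left
  over receive explicit zeros or are excluded. The ramified prime P (2, 3 or 11) is minus a square
  in the quadratic ring, so a rational integer divisible by P is not squarefree there; such a factor
  is absorbed into a square before the descent.\<close>

definition conic_isotropic :: "'a::comm_ring_1 \<Rightarrow> 'a \<Rightarrow> bool" where
  "conic_isotropic a b \<longleftrightarrow> (\<exists>x y z. (x, y, z) \<noteq> (0, 0, 0) \<and> z\<^sup>2 = a * x\<^sup>2 + b * y\<^sup>2)"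

lemma conic_isotropic_commute: "conic_isotropic a b \<longleftrightarrow> conic_isotropic b a"
  unfolding conic_isotropic_def by (metis (no_types, lifting) add.commute prod.inject)

lemma conic_isotropic_square: "conic_isotropic (a\<^sup>2) (b :: 'a :: comm_ring_1)"
  unfolding conic_isotropic_def by (rule exI[of _ 1], rule exI[of _ 0], rule exI[of _ a]) simp

section \<open>Comaximal elements and squares modulo an element\<close>

definition comaximal :: "'a::comm_ring_1 \<Rightarrow> 'a \<Rightarrow> bool" where
  "comaximal a b \<longleftrightarrow> (\<exists>u v. u * a + v * b = 1)"

lemma comaximal_commute: "comaximal a b \<longleftrightarrow> comaximal b a"
  unfolding comaximal_def by (metis add.commute)

lemma comaximal_mult_right:
  assumes "comaximal a b" "comaximal a c"
  shows "comaximal a (b * c)"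
proof -
  obtain u v p q where 1: "u * a + v * b = 1" "p * a + q * c = 1"
    using assms unfolding comaximal_def by blast
  have "(u * a * p + u * q * c + v * b * p) * a + (v * q) * (b * c) = (u * a + v * b) * (p * a + q * c)"
    by (simp add: algebra_simps)
  with 1 show ?thesis unfolding comaximal_def by (metis mult_1)
qed

lemma comaximal_dvd_right: "comaximal a b \<Longrightarrow> c dvd b \<Longrightarrow> comaximal a c"
  unfolding comaximal_def dvd_def by (metis mult.assoc mult.commute)

lemma comaximal_dvd_left: "comaximal b a \<Longrightarrow> c dvd b \<Longrightarrow> comaximal c a"
  using comaximal_commute comaximal_dvd_right by blast

lemma comaximal_dvd_multD:
  assumes "comaximal a b" "a dvd b * c"
  shows "a dvd c"
proof -
  obtain u v where "u * a + v * b = 1"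
    using assms(1) unfolding comaximal_def by blast
  then have "c = (u * a + v * b) * c" by simp
  also have "\<dots> = a * (u * c) + v * (b * c)" by (simp add: algebra_simps)
  finally show ?thesis
    using assms(2) by (metis dvd_add dvd_mult dvd_triv_left)
qed

lemma comaximal_imp_mult_dvd:
  assumes "comaximal a b" "a dvd c" "b dvd c"
  shows "a * b dvd c"
proof -
  obtain d where "c = b * d" using assms(3) by blast
  with assms comaximal_dvd_multD[of a b d] show ?thesis
    by (metis dvd_refl mult.commute mult_dvd_mono)
qed

definition square_mod :: "'a::comm_ring_1 \<Rightarrow> 'a \<Rightarrow> bool" where
  "square_mod a m \<longleftrightarrow> (\<exists>w. m dvd w\<^sup>2 - a)"

lemma square_mod_0: "m dvd a \<Longrightarrow> square_mod a m"
  unfolding square_mod_def by (rule exI[of _ 0]) simp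

lemma square_mod_cong:
  assumes "square_mod a m" "m dvd a - b"
  shows "square_mod b m"
proof -
  obtain w where "m dvd w\<^sup>2 - a" using assms unfolding square_mod_def by blast
  then have "m dvd (w\<^sup>2 - a) + (a - b)" using assms(2) by (rule dvd_add)
  then show ?thesis unfolding square_mod_def by (auto simp: algebra_simps)
qed

text \<open>Chinese remaindering: the Bezout relation combines the two roots into one.\<close>

lemma square_mod_mult:
  assumes "comaximal m n" "square_mod a m" "square_mod a n"
  shows "square_mod a (m * n)"
proof -
  obtain u v where uv: "u * m + v * n = 1" using assms(1) unfolding comaximal_def by blast
  obtain w z where w: "m dvd w\<^sup>2 - a" "n dvd z\<^sup>2 - a" using assms unfolding square_mod_def by blast
  define t where "t = v * n * w + u * m * z"
  have tw: "t = w + m * (u * (z - w))"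
  proof -
    have vn: "v * n = 1 - u * m" using uv by (simp add: algebra_simps)
    show ?thesis unfolding t_def vn by (simp add: algebra_simps)
  qed
  have "t\<^sup>2 - a = (w\<^sup>2 - a) + m * (u * (z - w) * (2 * w + m * (u * (z - w))))"
    unfolding tw by (simp add: algebra_simps power2_eq_square)
  with w have 1: "m dvd t\<^sup>2 - a" by (metis dvd_add dvd_triv_left)
  have tz: "t = z + n * (v * (w - z))"
  proof -
    have um: "u * m = 1 - v * n" using uv by (simp add: algebra_simps)
    show ?thesis unfolding t_def um by (simp add: algebra_simps)
  qed
  have "t\<^sup>2 - a = (z\<^sup>2 - a) + n * (v * (w - z) * (2 * z + n * (v * (w - z))))"
    unfolding tz by (simp add: algebra_simps power2_eq_square)
  with w have "n dvd t\<^sup>2 - a" by (metis dvd_add dvd_triv_left)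
  with 1 assms(1) show ?thesis unfolding square_mod_def using comaximal_imp_mult_dvd by blast
qed

lemma square_mod_cancel:
  assumes "comaximal m t" "square_mod (b * t\<^sup>2) m"
  shows "square_mod b m"
proof -
  obtain u v where uv: "u * m + v * t = 1" using assms(1) unfolding comaximal_def by blast
  obtain w where w: "m dvd w\<^sup>2 - b * t\<^sup>2" using assms unfolding square_mod_def by blast
  have vt: "v * t = 1 - u * m" using uv by (simp add: algebra_simps)
  have "(v * w)\<^sup>2 - b = v\<^sup>2 * (w\<^sup>2 - b * t\<^sup>2) + b * ((v * t)\<^sup>2 - 1)"
    by (simp add: algebra_simps power2_eq_square)
  also have "(v * t)\<^sup>2 - 1 = m * (u * (u * m - 2))"
    unfolding vt by (simp add: algebra_simps power2_eq_square)
  finally show ?thesis unfolding square_mod_def using w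
    by (metis dvd_add dvd_mult dvd_triv_left)
qed

lemma squarefree_dvd: "squarefree b \<Longrightarrow> a dvd b \<Longrightarrow> squarefree a"
  unfolding squarefree_def using dvd_trans by blast

text \<open>Legendre's local conditions, phrased with the moduli \<open>a / g\<close>, \<open>b / g\<close> and \<open>g = gcd a b\<close> instead of
  their prime divisors, which makes them meaningful without unique factorisation.\<close>

definition legendre_cond :: "'a::comm_ring_1 \<Rightarrow> 'a \<Rightarrow> bool" where
  "legendre_cond a b \<longleftrightarrow> (\<exists>g a' b'. a = g * a' \<and> b = g * b' \<and> comaximal a' b' \<and>
     square_mod a b' \<and> square_mod b a' \<and> square_mod (- a' * b') g)"

lemma legendre_cond_commute: "legendre_cond a b \<Longrightarrow> legendre_cond b a"
  unfolding legendre_cond_def by (metis comaximal_commute minus_mult_commute mult.commute)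

section \<open>Divisibility in norm-Euclidean domains\<close>

locale norm_euclidean =
  fixes nrm :: "'a::idom \<Rightarrow> nat"
  assumes nrm_mult: "nrm (a * b) = nrm a * nrm b"
    and nrm_eq_0_iff: "nrm a = 0 \<longleftrightarrow> a = 0"
    and nrm_division: "b \<noteq> 0 \<Longrightarrow> \<exists>q. nrm (a - b * q) < nrm b"
begin

lemma nrm_1: "nrm 1 = 1"
  using nrm_mult[of 1 1] nrm_eq_0_iff[of 1] by simp

lemma nrm_power2: "nrm (a\<^sup>2) = (nrm a)\<^sup>2"
  by (simp add: power2_eq_square nrm_mult)

lemma nrm_eq_1_iff: "nrm a = 1 \<longleftrightarrow> a dvd 1"
proof
  assume a: "nrm a = 1"
  then have "a \<noteq> 0" using nrm_eq_0_iff[of a] by linarith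
  then obtain q where "nrm (1 - a * q) < nrm a" using nrm_division[of a 1] by blast
  then have "nrm (1 - a * q) = 0" unfolding a by simp
  then have "1 = a * q" unfolding nrm_eq_0_iff by simp
  then show "a dvd 1" by (rule dvdI)
next
  assume "a dvd 1"
  then obtain b where b: "1 = a * b" by (rule dvdE)
  have "nrm a * nrm b = 1" unfolding nrm_mult[symmetric] b[symmetric] by (rule nrm_1)
  then show "nrm a = 1" by simp
qed

lemma bezout:
  fixes a b :: 'a
  shows "\<exists>g u v. g dvd a \<and> g dvd b \<and> g = u * a + v * b"
proof (induction "nrm b" arbitrary: a b rule: less_induct)
  case less
  show ?case
  proof (cases "b = 0")
    case True
    then show ?thesis by (intro exI[of _ a] exI[of _ 1] exI[of _ 0]) simp
  next
    case False
    then obtain q where "nrm (a - b * q) < nrm b" using nrm_division by blast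
    from less[OF this, of b] obtain g u v
      where g: "g dvd b" "g dvd a - b * q" "g = u * b + v * (a - b * q)" by blast
    then have "g dvd (a - b * q) + b * q" by (metis dvd_add dvd_mult2)
    moreover have "g = v * a + (u - v * q) * b" using g(3) by (simp add: algebra_simps)
    ultimately show ?thesis using g(1) by auto
  qed
qed

lemma comaximal_iff:
  fixes a b :: 'a
  shows "comaximal a b \<longleftrightarrow> (\<forall>h. h dvd a \<longrightarrow> h dvd b \<longrightarrow> h dvd 1)"
proof
  assume "comaximal a b"
  then show "\<forall>h. h dvd a \<longrightarrow> h dvd b \<longrightarrow> h dvd 1"
    unfolding comaximal_def by (metis dvd_add dvd_mult)
next
  assume h: "\<forall>h. h dvd a \<longrightarrow> h dvd b \<longrightarrow> h dvd 1"
  obtain g u v where g: "g dvd a" "g dvd b" "g = u * a + v * b" using bezout by blast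
  with h obtain k where "g * k = 1" by (metis dvdE)
  then have "(k * u) * a + (k * v) * b = 1" using g(3) by (simp add: algebra_simps)
  then show "comaximal a b" unfolding comaximal_def by blast
qed

lemma comaximalD:
  fixes a b :: 'a
  shows "comaximal a b \<Longrightarrow> h dvd a \<Longrightarrow> h dvd b \<Longrightarrow> h dvd 1"
  using comaximal_iff by blast

lemma gcd_cofactors:
  fixes a b :: 'a
  assumes "a \<noteq> 0"
  obtains g a' b' where "a = g * a'" "b = g * b'" "comaximal a' b'"
proof -
  obtain g u v where g: "g dvd a" "g dvd b" "g = u * a + v * b" using bezout by blast
  obtain a' b' where ab: "a = g * a'" "b = g * b'" using g(1,2) by (elim dvdE)
  with assms have "g \<noteq> 0" by auto
  have "g * (u * a' + v * b') = u * (g * a') + v * (g * b')" by (simp add: algebra_simps)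
  also have "\<dots> = g * 1" using g(3) ab by simp
  finally have "g * (u * a' + v * b') = g * 1" .
  with \<open>g \<noteq> 0\<close> have "comaximal a' b'" unfolding comaximal_def by (metis mult_left_cancel)
  with ab that show ?thesis by blast
qed

lemma squarefree_mult_comaximal:
  fixes a b :: 'a
  assumes "squarefree (a * b)"
  shows "comaximal a b"
  unfolding comaximal_iff
proof safe
  fix h assume "h dvd a" "h dvd b"
  then have "h\<^sup>2 dvd a * b" by (simp add: power2_eq_square mult_dvd_mono)
  with assms show "h dvd 1" by (auto simp: squarefree_def)
qed

text \<open>Prime factorisation is avoided by splitting off \<open>h\<close> from \<open>g\<close>
  and \<open>w\<close> with comaximal cofactors \<open>k\<close> and \<open>m\<close>. Then
  \<open>k\<close> divides \<open>h\<close>, but squarefreeness of \<open>g = h * k\<close> makes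
  \<open>h\<close> and \<open>k\<close> comaximal, so \<open>k\<close> is a unit.\<close>

lemma squarefree_dvd_square:
  fixes g w :: 'a
  assumes "squarefree g" "g dvd w\<^sup>2"
  shows "g dvd w"
proof (cases "g = 0")
  case True
  then show ?thesis using assms by simp
next
  case False
  then obtain h k m where h: "g = h * k" "w = h * m" "comaximal k m"
    using gcd_cofactors by blast
  then have "h \<noteq> 0" using False by auto
  have "k dvd h * m\<^sup>2"
  proof -
    have "h * k dvd h * (h * m\<^sup>2)" using assms(2) h by (simp add: power2_eq_square algebra_simps)
    with \<open>h \<noteq> 0\<close> show ?thesis by simp
  qed
  then have "k dvd m * (m * h)" by (simp add: power2_eq_square mult_ac)
  then have "k dvd h" using h(3) comaximal_dvd_multD by blast
  moreover have "comaximal h k" using assms(1) h(1) squarefree_mult_comaximal by blast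
  ultimately have "k dvd 1" using comaximalD[of h k k] by simp
  then have "h * k dvd h * 1" by (rule mult_dvd_mono[OF dvd_refl])
  then have "g dvd h" unfolding h(1) by simp
  then show ?thesis unfolding h(2) by (rule dvd_mult2)
qed

lemma squarefree_decomposition:
  fixes x :: 'a
  assumes "x \<noteq> 0"
  shows "\<exists>y c. x = y * c\<^sup>2 \<and> squarefree y"
  using assms
proof (induction "nrm x" arbitrary: x rule: less_induct)
  case less
  show ?case
  proof (cases "squarefree x")
    case True
    then show ?thesis by (metis mult_1_right power_one)
  next
    case False
    then obtain c x' where c: "x = c\<^sup>2 * x'" "\<not> c dvd 1" unfolding squarefree_def by blast
    with less(2) have nz: "c \<noteq> 0" "x' \<noteq> 0" by auto
    then have "nrm c > 1" "nrm x' > 0" using c(2) nrm_eq_1_iff nrm_eq_0_iff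
      by (metis less_one linorder_neqE_nat not_gr_zero)+
    then have "(nrm c)\<^sup>2 > 1" using one_less_power[of "nrm c" 2] by simp
    with \<open>nrm x' > 0\<close> have "nrm x' < nrm x" by (simp add: c nrm_mult nrm_power2)
    with less(1) nz obtain y d where "x' = y * d\<^sup>2" "squarefree y" by blast
    then have "x = y * (c * d)\<^sup>2 \<and> squarefree y" using c by (simp add: power_mult_distrib mult_ac)
    then show ?thesis by blast
  qed
qed

section \<open>The descent step and Legendre's theorem\<close>

lemma legendre_cond_square_mod:
  fixes a b :: 'a
  assumes "legendre_cond a b" "squarefree b"
  shows "square_mod a b"
proof -
  obtain g a' b' where g: "a = g * a'" "b = g * b'" "square_mod a b'"
    using assms(1) unfolding legendre_cond_def by blast
  have "square_mod a g" by (rule square_mod_0) (simp add: g)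
  with g assms(2) squarefree_mult_comaximal show ?thesis by (simp add: square_mod_mult)
qed

text \<open>The equation says that \<open>b * b1\<close> is, up to squares, a norm from the
  extension by a square root of \<open>a\<close>, so \<open>b\<close> and \<open>b1\<close> have the
  same Hilbert symbols with \<open>a\<close>. The proof verifies this on the factorisation
  \<open>a = g * g' * a2\<close>, where \<open>g\<close> is shared with \<open>b\<close>,
  \<open>g'\<close> with \<open>b1\<close>, and \<open>a2\<close> is the rest.\<close>

lemma legendre_cond_descent:
  fixes a b b1 c w :: 'a
  assumes sf: "squarefree a" "squarefree b" "squarefree b1" and a0: "a \<noteq> 0"
    and cond: "legendre_cond a b" and eq: "w\<^sup>2 - a = b * (b1 * c\<^sup>2)"
  shows "legendre_cond a b1"
proof -
  obtain g a1 b2 where g: "a = g * a1" "b = g * b2" "comaximal a1 b2"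
      "square_mod a b2" "square_mod b a1" "square_mod (- a1 * b2) g"
    using cond unfolding legendre_cond_def by blast
  then have nz: "g \<noteq> 0" "a1 \<noteq> 0" using a0 by auto
  have ga1: "comaximal g a1" and gb2: "comaximal g b2"
    using g sf squarefree_mult_comaximal by blast+
  have w2: "w\<^sup>2 = a + b * (b1 * c\<^sup>2)" using eq by (simp add: algebra_simps)
  have sg: "squarefree g" using sf(1) g(1) squarefree_dvd by (metis dvd_triv_left)
  have "g dvd w\<^sup>2" unfolding w2 g by (simp add: mult.assoc)
  then obtain w1 where w1: "w = g * w1" using squarefree_dvd_square sg by blast
  have e1: "g * w1\<^sup>2 - a1 = b2 * (b1 * c\<^sup>2)"
  proof -
    have "g * (g * w1\<^sup>2 - a1) = g * (b2 * (b1 * c\<^sup>2))"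
      using eq unfolding w1 g by (simp add: power2_eq_square algebra_simps)
    then show ?thesis using nz by simp
  qed
  have "comaximal g (b2 * (b1 * c\<^sup>2))" unfolding comaximal_iff e1[symmetric]
  proof safe
    fix h assume h: "h dvd g" "h dvd g * w1\<^sup>2 - a1"
    then have "h dvd g * w1\<^sup>2 - (g * w1\<^sup>2 - a1)" by (metis dvd_diff dvd_mult2)
    then have "h dvd a1" by simp
    with h ga1 show "h dvd 1" using comaximalD[of g a1 h] by simp
  qed
  then have gb1: "comaximal g b1" and gc: "comaximal g c"
    by (auto elim!: comaximal_dvd_right simp: power2_eq_square)
  obtain g' a2' b3 where g': "a = g' * a2'" "b1 = g' * b3" "comaximal a2' b3"
    using gcd_cofactors a0 by metis
  have "comaximal g' g" using gb1 g'(2) comaximal_commute comaximal_dvd_right by (metis dvd_triv_left)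
  then have "g' dvd a1" using g(1) g'(1) comaximal_dvd_multD by (metis dvd_triv_left)
  then obtain a2 where a2: "a1 = g' * a2" by blast
  have nz': "g' \<noteq> 0" using g' a0 by auto
  have a2': "a2' = g * a2" using g'(1) g(1) a2 nz' by (metis mult.left_commute mult_left_cancel)
  obtain v where v: "a1 dvd v\<^sup>2 - b" using g(5) unfolding square_mod_def by blast
  have "square_mod a b3" unfolding square_mod_def eq g'(2)
    by (rule exI[of _ w]) (simp add: eq g'(2) dvd_mult dvd_mult2)
  moreover have "square_mod b1 a2'"
    unfolding a2'
  proof (rule square_mod_mult)
    show "comaximal g a2" using ga1 a2 comaximal_dvd_right by (metis dvd_triv_right)
    \<comment> \<open>Modulo \<open>g\<close>, \<open>e1\<close> reads
      \<open>- a1 = b2 * b1 * c^2\<close>, so \<open>- a1 * b2\<close> is \<open>b1\<close> times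
      the square of \<open>b2 * c\<close>.\<close>
    show "square_mod b1 g"
    proof (rule square_mod_cancel)
      show "comaximal g (b2 * c)" using gb2 gc comaximal_mult_right by blast
      have "- a1 * b2 - b1 * (b2 * c)\<^sup>2 = b2 * (- a1 - b2 * (b1 * c\<^sup>2))"
        by (simp add: power2_eq_square algebra_simps)
      also have "\<dots> = g * (- b2 * w1\<^sup>2)"
        unfolding e1[symmetric] by (simp add: algebra_simps)
      finally show "square_mod (b1 * (b2 * c)\<^sup>2) g"
        using square_mod_cong[OF g(6)] by simp
    qed
    \<comment> \<open>Modulo \<open>a2\<close>, \<open>b\<close> is the square of \<open>v\<close>
      and \<open>w^2\<close> equals \<open>b * b1 * c^2\<close>, so \<open>(v * w)^2\<close> equals
      \<open>b1 * (b * c)^2\<close>.\<close>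
    show "square_mod b1 a2"
    proof (rule square_mod_cancel)
      have "comaximal a1 b" unfolding g(2) using ga1 g(3) comaximal_commute comaximal_mult_right by blast
      then have 1: "comaximal a2 b" using a2 comaximal_dvd_left by (metis dvd_triv_right)
      \<comment> \<open>A common divisor \<open>h\<close> divides \<open>a\<close>, hence
        \<open>w^2\<close> and, being squarefree, also \<open>w\<close>; then \<open>h^2\<close>
        divides \<open>a\<close>.\<close>
      have "comaximal a2 c" unfolding comaximal_iff
      proof safe
        fix h assume h: "h dvd a2" "h dvd c"
        then have ha: "h dvd a" using g(1) a2 by (simp add: dvd_mult)
        then have "squarefree h" using sf squarefree_dvd by blast
        moreover have "h dvd w\<^sup>2" unfolding w2 using ha h by (simp add: power2_eq_square dvd_mult)
        ultimately have "h dvd w" using squarefree_dvd_square by blast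
        then have "h\<^sup>2 dvd w\<^sup>2" by (simp add: dvd_power_same)
        moreover have "h\<^sup>2 dvd b * (b1 * c\<^sup>2)" using h by (simp add: dvd_mult dvd_power_same)
        ultimately have "h\<^sup>2 dvd w\<^sup>2 - b * (b1 * c\<^sup>2)" by (rule dvd_diff)
        then have "h\<^sup>2 dvd a" unfolding w2 by simp
        then show "h dvd 1" using sf(1) unfolding squarefree_def by blast
      qed
      with 1 show "comaximal a2 (b * c)" using comaximal_mult_right by blast
      have "a2 dvd v\<^sup>2 - b" using v a2 by (metis dvd_mult_right)
      moreover have "a2 dvd a" using g a2 by simp
      ultimately have "a2 dvd w\<^sup>2 * (v\<^sup>2 - b) + b * a" by simp
      also have "w\<^sup>2 * (v\<^sup>2 - b) + b * a = (v * w)\<^sup>2 - b * (w\<^sup>2 - a)"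
        by (simp add: power2_eq_square algebra_simps)
      also have "\<dots> = (v * w)\<^sup>2 - b1 * (b * c)\<^sup>2"
        unfolding eq by (simp add: power2_eq_square algebra_simps)
      finally show "square_mod (b1 * (b * c)\<^sup>2) a2" unfolding square_mod_def by blast
    qed
  qed
  \<comment> \<open>Dividing the equation by \<open>g'\<close> gives
    \<open>- a2' = b * b3 * c^2\<close> modulo \<open>g'\<close>, where \<open>b\<close> is the
    square of \<open>v\<close>.\<close>
  moreover have "square_mod (- a2' * b3) g'"
  proof -
    have "squarefree g'" using sf(1) g'(1) squarefree_dvd by (metis dvd_triv_left)
    moreover have "g' dvd w\<^sup>2" unfolding w2 g' by (simp add: dvd_mult mult.assoc)
    ultimately obtain w2 where "w = g' * w2" using squarefree_dvd_square by blast
    then have "g' * (g' * w2\<^sup>2 - a2') = g' * (b * (b3 * c\<^sup>2))"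
      using eq unfolding g' by (simp add: power2_eq_square algebra_simps)
    then have e: "g' * w2\<^sup>2 - a2' = b * (b3 * c\<^sup>2)" using nz' by simp
    have "g' dvd v\<^sup>2 - b" using v a2 by (metis dvd_mult_left)
    then have "g' dvd (b3 * c)\<^sup>2 * (v\<^sup>2 - b) + b3 * (g' * w2\<^sup>2)" by simp
    also have "\<dots> = (b3 * c * v)\<^sup>2 - (- a2' * b3) + b3 * ((g' * w2\<^sup>2 - a2') - b * (b3 * c\<^sup>2))"
      by (simp add: power2_eq_square algebra_simps)
    finally show ?thesis unfolding square_mod_def e by auto
  qed
  ultimately show ?thesis unfolding legendre_cond_def using g' by blast
qed

end

text \<open>Norms from the extension by a square root of \<open>a\<close> are multiplicative: the
  product of \<open>z^2 - a * x^2 = b1 * y^2\<close> and \<open>w^2 - a = b * b1 * c^2\<close>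
  represents \<open>b\<close> times a square.\<close>

lemma conic_isotropic_descent:
  fixes a :: "'a::idom"
  assumes eq: "w\<^sup>2 - a = b * (b1 * c\<^sup>2)" and nz: "b \<noteq> 0" "b1 * c\<^sup>2 \<noteq> 0"
    and iso: "conic_isotropic a b1"
  shows "conic_isotropic a b"
proof -
  obtain x y z where xyz: "(x, y, z) \<noteq> (0, 0, 0)" "z\<^sup>2 = a * x\<^sup>2 + b1 * y\<^sup>2"
    using iso unfolding conic_isotropic_def by blast
  have w2: "w\<^sup>2 = a + b * (b1 * c\<^sup>2)" using eq by (simp add: algebra_simps)
  show ?thesis
  proof (cases "y = 0")
    case True
    then show ?thesis using xyz unfolding conic_isotropic_def
      by (intro exI[of _ x] exI[of _ 0] exI[of _ z]) auto
  next
    case False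
    have "(z * w + a * x)\<^sup>2 - a * (z + x * w)\<^sup>2 = (z\<^sup>2 - a * x\<^sup>2) * (w\<^sup>2 - a)"
      by (simp add: power2_eq_square algebra_simps)
    also have "\<dots> = b * (b1 * y * c)\<^sup>2"
      unfolding xyz w2 by (simp add: power2_eq_square algebra_simps)
    finally have "(z * w + a * x)\<^sup>2 = a * (z + x * w)\<^sup>2 + b * (b1 * y * c)\<^sup>2"
      by (simp add: algebra_simps)
    moreover have "b1 * y * c \<noteq> 0" using False nz by auto
    ultimately show ?thesis unfolding conic_isotropic_def by blast
  qed
qed

text \<open>The rings in question have no real place, so units need no sign condition.
  \<open>reduction\<close> isolates the arithmetic of the particular ring: a root \<open>w\<close>
  with small \<open>w^2 - a\<close>, or a zero where none exists. The residue condition with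
  \<open>v\<close> serves to discard exceptional pairs that are locally anisotropic.\<close>

locale legendre_domain = norm_euclidean nrm for nrm :: "'a::idom \<Rightarrow> nat" +
  assumes unit_case: "u dvd 1 \<Longrightarrow> v dvd 1 \<Longrightarrow> conic_isotropic u v"
    and reduction: "\<lbrakk>squarefree a; squarefree b; nrm a \<le> nrm b; 1 < nrm b; a \<noteq> 0;
      b dvd w\<^sup>2 - a; a dvd v\<^sup>2 - b\<rbrakk> \<Longrightarrow>
      conic_isotropic a b \<or> (\<exists>w. b dvd w\<^sup>2 - a \<and> nrm (w\<^sup>2 - a) < (nrm b)\<^sup>2)"
begin

theorem legendre:
  fixes a b :: 'a
  assumes "squarefree a" "squarefree b" "a \<noteq> 0" "b \<noteq> 0" "legendre_cond a b"
  shows "conic_isotropic a b"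
  using assms
proof (induction "nrm a + nrm b" arbitrary: a b rule: less_induct)
  case less
  \<comment> \<open>The step acts on the entry of larger norm. The induction hypothesis is a
    parameter, so that \<open>main\<close> serves for both orders of the pair.\<close>
  have main: "conic_isotropic a b"
    if sf: "squarefree a" "squarefree b" and nz: "a \<noteq> 0" "b \<noteq> 0" and cond: "legendre_cond a b"
      and le: "nrm a \<le> nrm b"
      and IH: "\<And>b1. nrm b1 < nrm b \<Longrightarrow> squarefree b1 \<Longrightarrow> b1 \<noteq> 0 \<Longrightarrow> legendre_cond a b1 \<Longrightarrow>
                  conic_isotropic a b1" for a b :: 'a
  proof (cases "nrm b = 1")
    case True
    moreover have "nrm a \<noteq> 0" using nz nrm_eq_0_iff by blast
    ultimately show ?thesis using le by (intro unit_case) (auto simp flip: nrm_eq_1_iff)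
  next
    case False
    then have b1: "1 < nrm b" using nz(2) nrm_eq_0_iff[of b] by linarith
    obtain w0 where "b dvd w0\<^sup>2 - a"
      using legendre_cond_square_mod[OF cond sf(2)] unfolding square_mod_def by blast
    moreover obtain v where "a dvd v\<^sup>2 - b"
      using legendre_cond_square_mod[OF legendre_cond_commute[OF cond] sf(1)]
      unfolding square_mod_def by blast
    ultimately consider "conic_isotropic a b"
      | w where "b dvd w\<^sup>2 - a" "nrm (w\<^sup>2 - a) < (nrm b)\<^sup>2"
      using reduction[OF sf le b1 nz(1)] by blast
    then show ?thesis
    proof cases
      case 2
      then obtain b' where b': "w\<^sup>2 - a = b * b'" by blast
      show ?thesis
      proof (cases "b' = 0")
        case True
        then have "a = w\<^sup>2" using b' by simp
        then show ?thesis using conic_isotropic_square by blast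
      next
        case b'0: False
        then obtain b1 c where b1: "b' = b1 * c\<^sup>2" "squarefree b1"
          using squarefree_decomposition by blast
        then have nz': "b1 \<noteq> 0" "c \<noteq> 0" using b'0 by auto
        have "nrm b * nrm b' < nrm b * nrm b" using 2(2) unfolding b' by (simp add: nrm_mult power2_eq_square)
        then have "nrm b' < nrm b" by simp
        moreover have "nrm b1 \<le> nrm b'"
          using nz' nrm_eq_0_iff[of c] unfolding b1 by (simp add: nrm_mult nrm_power2)
        ultimately have "conic_isotropic a b1"
          using IH b1(2) nz' legendre_cond_descent[OF sf b1(2) nz(1) cond b'[unfolded b1(1)]] by simp
        then show ?thesis
          using conic_isotropic_descent[OF b'[unfolded b1(1)] nz(2)] b'0 b1(1) by simp
      qed
    qed
  qed
  show ?case
  proof (cases "nrm a \<le> nrm b")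
    case True
    show ?thesis by (rule main) (use less True in auto)
  next
    case False
    have "conic_isotropic b a"
    proof (rule main)
      fix b1 assume *: "nrm b1 < nrm a" "squarefree b1" "b1 \<noteq> 0" "legendre_cond b b1"
      have "conic_isotropic b1 b"
        by (rule less.hyps) (use * less.prems legendre_cond_commute[of b b1] in auto)
      then show "conic_isotropic b b1" using conic_isotropic_commute by blast
    qed (use less.prems False legendre_cond_commute[of a b] in auto)
    then show ?thesis using conic_isotropic_commute by blast
  qed
qed

end

section \<open>Three Euclidean rings of quadratic integers\<close>

text \<open>Since \<open>qtr\<close> is 0 or 1, it equals its own square, and
  \<open>4 * qnm - qtr\<close> below is minus the discriminant: 8, 3 or 11.\<close>

class quad_param =
  fixes qtr :: "'a itself \<Rightarrow> int" and qnm :: "'a itself \<Rightarrow> int"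
  assumes quad_param_cases: "qtr TYPE('a) = 0 \<and> qnm TYPE('a) = 2 \<or>
    qtr TYPE('a) = 1 \<and> (qnm TYPE('a) = 1 \<or> qnm TYPE('a) = 3)"

text \<open>\<open>Quad x y\<close> stands for \<open>x + y \<omega>\<close>, where \<open>\<omega>\<^sup>2 = qtr \<omega> - qnm\<close>: the rings of integers of
  \<open>\<rat>(\<surd>-2)\<close>, \<open>\<rat>(\<surd>-3)\<close> and \<open>\<rat>(\<surd>-11)\<close>, selected by the phantom type parameter.\<close>

datatype 'd quad_int = Quad (qre: int) (qim: int)

lemma quad_int_eq_iff: "x = y \<longleftrightarrow> qre x = qre y \<and> qim x = qim y"
  by (cases x; cases y) simp

instantiation quad_int :: (quad_param) comm_ring_1
begin

definition "0 = Quad 0 0"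
definition "1 = Quad 1 0"
definition "x + y = Quad (qre x + qre y) (qim x + qim y)"
definition "x - y = Quad (qre x - qre y) (qim x - qim y)"
definition "- x = Quad (- qre x) (- qim x)"
definition times_quad_int :: "'a quad_int \<Rightarrow> 'a quad_int \<Rightarrow> 'a quad_int" where
  "x * y = Quad (qre x * qre y - qnm TYPE('a) * (qim x * qim y))
    (qre x * qim y + qim x * qre y + qtr TYPE('a) * (qim x * qim y))"

lemmas quad_int_defs = zero_quad_int_def one_quad_int_def plus_quad_int_def
  minus_quad_int_def uminus_quad_int_def times_quad_int_def

instance
  by standard (auto simp: quad_int_defs quad_int_eq_iff algebra_simps)

end

lemma quad_int_sel [simp]:
  "qre 0 = 0" "qim 0 = 0" "qre 1 = 1" "qim 1 = 0"
  "qre (x + y) = qre x + qre y" "qim (x + y) = qim x + qim y"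
  "qre (x - y) = qre x - qre y" "qim (x - y) = qim x - qim y"
  "qre (- x) = - qre x" "qim (- x) = - qim x"
  by (simp_all add: quad_int_defs)

lemma qre_mult: "qre (x * y) = qre x * qre y - qnm TYPE('d) * (qim x * qim y)"
  and qim_mult: "qim (x * y) = qre x * qim y + qim x * qre y + qtr TYPE('d) * (qim x * qim y)"
  for x y :: "'d::quad_param quad_int"
  by (simp_all add: quad_int_defs)

lemma of_nat_quad_int: "(of_nat n :: 'd::quad_param quad_int) = Quad (int n) 0"
  by (induction n) (simp_all add: quad_int_eq_iff)

lemma of_int_quad_int: "(of_int n :: 'd::quad_param quad_int) = Quad n 0"
  by (cases n) (simp_all add: of_nat_quad_int quad_int_eq_iff)

lemma quad_int_of_int_sel [simp]:
  "qre (of_int n :: 'd::quad_param quad_int) = n" "qim (of_int n :: 'd::quad_param quad_int) = 0"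
  by (simp_all add: of_int_quad_int)

lemma quad_int_numeral_sel [simp]:
  "qre (numeral n :: 'd::quad_param quad_int) = numeral n"
  "qim (numeral n :: 'd::quad_param quad_int) = 0"
  using quad_int_of_int_sel[of "numeral n", where 'd = 'd] by (simp_all del: quad_int_of_int_sel)

definition quad_norm :: "'d::quad_param quad_int \<Rightarrow> int" where
  "quad_norm x = (qre x)\<^sup>2 + qtr TYPE('d) * qre x * qim x + qnm TYPE('d) * (qim x)\<^sup>2"

definition quad_nrm :: "'d::quad_param quad_int \<Rightarrow> nat" where
  "quad_nrm x = nat (quad_norm x)"

definition quad_cnj :: "'d::quad_param quad_int \<Rightarrow> 'd quad_int" where
  "quad_cnj x = Quad (qre x + qtr TYPE('d) * qim x) (- qim x)"

lemma quad_norm_mult: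
  fixes x y :: "'d::quad_param quad_int"
  shows "quad_norm (x * y) = quad_norm x * quad_norm y"
  using quad_param_cases[where 'a = 'd]
  unfolding quad_norm_def qre_mult qim_mult by (elim disjE conjE) (simp_all add: power2_eq_square algebra_simps)

lemma quad_norm_conv_mult: "x * quad_cnj x = of_int (quad_norm x)"
  by (auto simp: quad_int_eq_iff qre_mult qim_mult quad_cnj_def quad_norm_def
      power2_eq_square algebra_simps)

lemma four_quad_norm:
  fixes x :: "'d::quad_param quad_int"
  shows "4 * quad_norm x = (2 * qre x + qtr TYPE('d) * qim x)\<^sup>2
    + (4 * qnm TYPE('d) - qtr TYPE('d)) * (qim x)\<^sup>2"
  using quad_param_cases[where 'a = 'd] unfolding quad_norm_def
  by (elim disjE conjE) (simp_all add: power2_eq_square algebra_simps)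

lemma quad_norm_nonneg: "quad_norm x \<ge> 0" for x :: "'d::quad_param quad_int"
proof -
  have "(4 * qnm TYPE('d) - qtr TYPE('d)) * (qim x)\<^sup>2 \<ge> 0"
    using quad_param_cases[where 'a = 'd] by auto
  then have "4 * quad_norm x \<ge> 0" unfolding four_quad_norm by simp
  then show ?thesis by simp
qed

lemma quad_norm_0_iff: "quad_norm x = 0 \<longleftrightarrow> x = 0" for x :: "'d::quad_param quad_int"
proof
  assume "quad_norm x = 0"
  then have 0: "(2 * qre x + qtr TYPE('d) * qim x)\<^sup>2
    + (4 * qnm TYPE('d) - qtr TYPE('d)) * (qim x)\<^sup>2 = 0" using four_quad_norm[of x] by simp
  have p: "4 * qnm TYPE('d) - qtr TYPE('d) > 0" using quad_param_cases[where 'a = 'd] by auto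
  then have "(4 * qnm TYPE('d) - qtr TYPE('d)) * (qim x)\<^sup>2 \<ge> 0" by simp
  with 0 have "(4 * qnm TYPE('d) - qtr TYPE('d)) * (qim x)\<^sup>2 = 0"
    "(2 * qre x + qtr TYPE('d) * qim x)\<^sup>2 = 0"
    using zero_le_power2[of "2 * qre x + qtr TYPE('d) * qim x"] by linarith+
  with p have "qim x = 0" "qre x = 0" by auto
  then show "x = 0" by (simp add: quad_int_eq_iff)
qed (simp add: quad_norm_def)

instance quad_int :: (quad_param) idom
proof
  fix a b :: "'a quad_int"
  assume "a \<noteq> 0" "b \<noteq> 0"
  then have "quad_norm (a * b) \<noteq> 0" by (simp add: quad_norm_mult quad_norm_0_iff)
  then show "a * b \<noteq> 0" using quad_norm_0_iff by blast
qed

lemma of_nat_quad_nrm: "int (quad_nrm x) = quad_norm x"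
  by (simp add: quad_nrm_def quad_norm_nonneg)

lemma quad_norm_of_int: "quad_norm (of_int n :: 'd::quad_param quad_int) = n\<^sup>2"
  by (simp add: quad_norm_def)

text \<open>The embedding into the complex numbers turns the triangle inequality of the modulus into
  a bound for the norm of a sum.\<close>

definition quad_cplx :: "'d::quad_param quad_int \<Rightarrow> complex" where
  "quad_cplx x = Complex (of_int (qre x) + of_int (qtr TYPE('d)) / 2 * of_int (qim x))
    (sqrt (of_int (4 * qnm TYPE('d) - qtr TYPE('d))) / 2 * of_int (qim x))"

lemma quad_cplx_diff: "quad_cplx (x - y) = quad_cplx x - quad_cplx y"
  by (simp add: quad_cplx_def complex_eq_iff algebra_simps diff_divide_distrib)

lemma cmod_quad_cplx: "(cmod (quad_cplx x))\<^sup>2 = of_int (quad_norm x)"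
  for x :: "'d::quad_param quad_int"
proof -
  define s where "s = sqrt (real_of_int (4 * qnm TYPE('d) - qtr TYPE('d)))"
  have s2: "s\<^sup>2 = of_int (4 * qnm TYPE('d) - qtr TYPE('d))"
    using quad_param_cases[where 'a = 'd] unfolding s_def by (intro real_sqrt_pow2) auto
  have "(cmod (quad_cplx x))\<^sup>2 = (of_int (qre x) + of_int (qtr TYPE('d)) / 2 * of_int (qim x))\<^sup>2
    + (s / 2 * of_int (qim x))\<^sup>2"
    unfolding quad_cplx_def s_def by (simp only: cmod_power2 complex.sel)
  also have "\<dots> = (2 * of_int (qre x) + of_int (qtr TYPE('d)) * of_int (qim x))\<^sup>2 / 4
    + s\<^sup>2 * (of_int (qim x))\<^sup>2 / 4"
    by (simp add: power2_eq_square field_simps)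
  also have "\<dots> = of_int (4 * quad_norm x) / 4"
    unfolding four_quad_norm s2 by (simp add: add_divide_distrib)
  finally show ?thesis by simp
qed

lemma cmod_quad_cplx_power2: "cmod (quad_cplx (x\<^sup>2)) = (cmod (quad_cplx x))\<^sup>2"
  for x :: "'d::quad_param quad_int"
proof (rule power2_eq_imp_eq)
  show "(cmod (quad_cplx (x\<^sup>2)))\<^sup>2 = ((cmod (quad_cplx x))\<^sup>2)\<^sup>2"
    unfolding cmod_quad_cplx by (simp add: power2_eq_square[of x] quad_norm_mult power2_eq_square)
qed auto

text \<open>The modulus |b| is the square root of the norm N(b), so the last hypothesis means |b| <
  N(b) - N(w); then |w^2 - a| is at most N(w) + |b| < N(b).\<close>

lemma quad_norm_square_diff_less:
  fixes a b w :: "'d::quad_param quad_int"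
  assumes "quad_norm a \<le> quad_norm b" "quad_norm w < quad_norm b"
    "quad_norm b < (quad_norm b - quad_norm w)\<^sup>2"
  shows "quad_norm (w\<^sup>2 - a) < (quad_norm b)\<^sup>2"
proof -
  let ?c = "\<lambda>x. cmod (quad_cplx x)"
  have a: "?c a \<le> ?c b"
    by (rule power2_le_imp_le) (use assms in \<open>simp_all add: cmod_quad_cplx\<close>)
  have "(?c b)\<^sup>2 < (of_int (quad_norm b - quad_norm w))\<^sup>2"
    unfolding cmod_quad_cplx using assms(3) by (metis of_int_less_iff of_int_power)
  then have "?c b < of_int (quad_norm b - quad_norm w)"
    by (rule power2_less_imp_less) (use assms(2) in simp)
  then have b: "?c b < (?c b)\<^sup>2 - (?c w)\<^sup>2" by (simp add: cmod_quad_cplx)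
  have "?c (w\<^sup>2 - a) \<le> ?c (w\<^sup>2) + ?c a"
    unfolding quad_cplx_diff by (rule norm_triangle_ineq4)
  also have "\<dots> < (?c b)\<^sup>2" unfolding cmod_quad_cplx_power2 using a b by simp
  finally have "(?c (w\<^sup>2 - a))\<^sup>2 < ((?c b)\<^sup>2)\<^sup>2" by (rule power_strict_mono) auto
  then have "real_of_int (quad_norm (w\<^sup>2 - a)) < real_of_int ((quad_norm b)\<^sup>2)"
    unfolding cmod_quad_cplx by simp
  then show ?thesis by (simp only: of_int_less_iff)
qed

section \<open>Covering radii and division with remainder\<close>

lemma round_half: "\<bar>p - of_int (round p)\<bar> \<le> (1 / 2 :: real)"
  using of_int_round_abs_le[of p] by (simp add: abs_minus_commute)

lemma lattice_cover_straight:
  fixes p q :: real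
  shows "\<exists>x y :: int. (p - of_int x)\<^sup>2 + 2 * (q - of_int y)\<^sup>2 \<le> 3 / 4"
proof (intro exI)
  have "(p - of_int (round p))\<^sup>2 \<le> (1 / 2)\<^sup>2" "(q - of_int (round q))\<^sup>2 \<le> (1 / 2)\<^sup>2"
    using round_half[of p] round_half[of q] by (simp_all add: abs_le_square_iff[symmetric])
  then show "(p - of_int (round p))\<^sup>2 + 2 * (q - of_int (round q))\<^sup>2 \<le> 3 / 4"
    by (simp add: power2_eq_square)
qed

text \<open>The bound is the square of the circumradius of the triangle \<open>0, 1, 1/2 + i \<surd>\<delta>\<close>.\<close>

lemma lattice_cover_tilted:
  fixes p q \<delta> :: real
  assumes \<delta>: "\<delta> \<ge> 3 / 4"
  shows "\<exists>x y :: int. (p - of_int x + (q - of_int y) / 2)\<^sup>2 + \<delta> * (q - of_int y)\<^sup>2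
    \<le> (\<delta> + 1 / 4)\<^sup>2 / (4 * \<delta>)"
proof -
  define y where "y = round q"
  define v where "v = q - of_int y"
  define x where "x = round (p + v / 2)"
  define u where "u = p + v / 2 - of_int x"
  have uv: "\<bar>u\<bar> \<le> 1 / 2" "\<bar>v\<bar> \<le> 1 / 2"
    unfolding u_def v_def x_def y_def by (rule round_half)+
  define R where "R = (\<delta> + 1 / 4)\<^sup>2 / (4 * \<delta>)"
  \<comment> \<open>A second candidate, in the neighbouring row on the side of the point. Rows are
    shifted by one half against each other, so the distances become
    \<open>1/2 - \<bar>u\<bar>\<close> across and \<open>1 - \<bar>v\<bar>\<close> in row
    units.\<close>
  define y' where "y' = (if v \<ge> 0 then y + 1 else y - 1)"
  define x' where "x' = (if u \<ge> 0 then (if v \<ge> 0 then x else x + 1) else (if v \<ge> 0 then x - 1 else x))"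
  have v': "(q - of_int y')\<^sup>2 = (1 - \<bar>v\<bar>)\<^sup>2"
    by (auto simp: y'_def v_def power2_eq_square algebra_simps)
  have u': "(p - of_int x' + (q - of_int y') / 2)\<^sup>2 = (1 / 2 - \<bar>u\<bar>)\<^sup>2"
  proof -
    have "p - of_int x' + (q - of_int y') / 2 = (if u \<ge> 0 then u - 1 / 2 else u + 1 / 2)"
      unfolding u_def v_def x'_def y'_def by (simp add: field_simps)
    then show ?thesis by (simp add: power2_eq_square algebra_simps)
  qed
  \<comment> \<open>The circumcentre lies at \<open>\<bar>u\<bar> = 1/2\<close> and
    \<open>\<bar>v\<bar> = 1/2 - 1/(8 * \<delta>)\<close>; \<open>B\<close> and \<open>t\<close>
    measure the offset from it.\<close>
  define B where "B = 1 / 2 - \<bar>u\<bar>"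
  define t where "t = \<bar>v\<bar> - (1 / 2 - 1 / (8 * \<delta>))"
  have B: "0 \<le> B" "B \<le> 1 / 2" using uv by (simp_all add: B_def)
  have vt: "\<bar>v\<bar> = t + (1 / 2 - 1 / (8 * \<delta>))" by (simp add: t_def)
  have t: "\<delta> * t \<le> 1 / 8"
    using uv(2) \<delta> unfolding t_def by (simp add: field_simps)
  have e1: "u\<^sup>2 + \<delta> * v\<^sup>2 - R = B\<^sup>2 - B + (\<delta> - 1 / 4) * t + \<delta> * t\<^sup>2"
  proof -
    have uu: "u\<^sup>2 = (1 / 2 - B)\<^sup>2" and vv: "v\<^sup>2 = (t + (1 / 2 - 1 / (8 * \<delta>)))\<^sup>2"
      unfolding vt[symmetric] by (simp_all add: B_def)
    show ?thesis using \<delta> unfolding R_def uu vv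
      by (simp add: power2_eq_square field_simps)
  qed
  have e2: "(1 / 2 - \<bar>u\<bar>)\<^sup>2 + \<delta> * (1 - \<bar>v\<bar>)\<^sup>2 - R = B\<^sup>2 - (\<delta> + 1 / 4) * t + \<delta> * t\<^sup>2"
    unfolding vt B_def[symmetric] R_def using \<delta> by (simp add: power2_eq_square field_simps)
  \<comment> \<open>Up to the height of the circumcentre (\<open>t \<le> 0\<close>) the first
    candidate is close enough. Above it, eliminating \<open>t\<close> from the two failed bounds
    would force \<open>B > 1/2\<close>.\<close>
  have "u\<^sup>2 + \<delta> * v\<^sup>2 \<le> R \<or> (1 / 2 - \<bar>u\<bar>)\<^sup>2 + \<delta> * (1 - \<bar>v\<bar>)\<^sup>2 \<le> R"
  proof (rule ccontr)
    assume "\<not> ?thesis"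
    then have 1: "B - B\<^sup>2 < (\<delta> - 1 / 4) * t + \<delta> * t\<^sup>2" and 2: "(\<delta> + 1 / 4) * t - \<delta> * t\<^sup>2 < B\<^sup>2"
      using e1 e2 by linarith+
    have "B\<^sup>2 \<le> B" using B by (simp add: power2_eq_square mult_left_le_one_le)
    have t0: "t > 0"
    proof (rule ccontr)
      assume t: "\<not> t > 0"
      have "t \<ge> - (1 / 2 - 1 / (8 * \<delta>))" by (simp add: t_def)
      then have "\<delta> * t \<ge> \<delta> * - (1 / 2 - 1 / (8 * \<delta>))" using \<delta> by (intro mult_left_mono) auto
      moreover have "\<delta> * - (1 / 2 - 1 / (8 * \<delta>)) = - \<delta> / 2 + 1 / 8"
        using \<delta> by (simp add: field_simps)
      ultimately have "\<delta> * t \<ge> - \<delta> / 2 + 1 / 8" by simp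
      then have "(\<delta> - 1 / 4) + \<delta> * t \<ge> 0" using \<delta> by simp
      with t have "((\<delta> - 1 / 4) + \<delta> * t) * t \<le> 0" by (simp add: mult_nonneg_nonpos)
      then have "(\<delta> - 1 / 4) * t + \<delta> * t\<^sup>2 \<le> 0" by (simp add: power2_eq_square algebra_simps)
      with 1 \<open>B\<^sup>2 \<le> B\<close> show False by simp
    qed
    have "\<delta> * t\<^sup>2 \<le> 1 / 8 * t" using mult_right_mono[OF t, of t] t0 by (simp add: power2_eq_square)
    with 1 2 have 3: "B - B\<^sup>2 < (\<delta> - 1 / 8) * t" "(\<delta> + 1 / 8) * t < B\<^sup>2"
      by (simp_all add: algebra_simps)
    have "(B - B\<^sup>2) * (\<delta> + 1 / 8) < ((\<delta> - 1 / 8) * t) * (\<delta> + 1 / 8)"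
      using 3(1) \<delta> by (intro mult_strict_right_mono) auto
    also have "\<dots> = ((\<delta> + 1 / 8) * t) * (\<delta> - 1 / 8)" by simp
    also have "\<dots> \<le> B\<^sup>2 * (\<delta> - 1 / 8)" using 3(2) \<delta> by (intro mult_right_mono) auto
    finally have "B * (\<delta> + 1 / 8) < B * (2 * \<delta> * B)"
      by (simp add: power2_eq_square algebra_simps diff_divide_distrib)
    with B(1) have "\<delta> + 1 / 8 < 2 * \<delta> * B" by (simp add: mult_less_cancel_left)
    also have "\<dots> \<le> 2 * \<delta> * (1 / 2)" using B(2) \<delta> by (intro mult_left_mono) auto
    finally show False by simp
  qed
  then show ?thesis
  proof
    assume "u\<^sup>2 + \<delta> * v\<^sup>2 \<le> R"
    then show ?thesis unfolding R_def u_def v_def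
      by (intro exI[of _ x] exI[of _ y]) (simp add: algebra_simps)
  next
    assume "(1 / 2 - \<bar>u\<bar>)\<^sup>2 + \<delta> * (1 - \<bar>v\<bar>)\<^sup>2 \<le> R"
    then show ?thesis unfolding R_def u'[symmetric] v'[symmetric] by blast
  qed
qed

text \<open>The square of the covering radius of the lattice of integers.\<close>

definition quad_radius :: "'d::quad_param itself \<Rightarrow> real" where
  "quad_radius T = (if qtr T = 0 then 3 / 4 else (of_int (qnm T))\<^sup>2 / (4 * of_int (qnm T) - 1))"

text \<open>The quotient is a lattice point close to \<open>a / b\<close>, computed as
  \<open>a * quad_cnj b\<close> over the norm. For \<open>qtr = 1\<close>,
  \<open>\<delta> = qnm - 1/4\<close> turns the circumradius bound into
  \<open>qnm^2 / (4 * qnm - 1)\<close>, that is 1/3 or 9/11.\<close>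

lemma quad_division:
  fixes a b :: "'d::quad_param quad_int"
  assumes b: "b \<noteq> 0"
  shows "\<exists>q. quad_norm (a - b * q) \<le> quad_radius TYPE('d) * quad_norm b"
proof -
  define m where "m = quad_norm b"
  have m: "m > 0" using b quad_norm_nonneg[of b] quad_norm_0_iff[of b] by (auto simp: m_def)
  define c where "c = a * quad_cnj b"
  define p where "p = real_of_int (qre c) / m"
  define s where "s = real_of_int (qim c) / m"
  have "\<exists>(x :: int) (y :: int). (p - x)\<^sup>2 + qtr TYPE('d) * (p - x) * (s - y) + qnm TYPE('d) * (s - y)\<^sup>2
    \<le> quad_radius TYPE('d)"
    using quad_param_cases[where 'a = 'd]
  proof (elim disjE conjE)
    assume "qtr TYPE('d) = 0" "qnm TYPE('d) = 2"
    then show ?thesis using lattice_cover_straight[of p s] by (simp add: quad_radius_def)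
  next
    assume *: "qtr TYPE('d) = 1" "qnm TYPE('d) = 1"
    obtain x y :: int where "(p - x + (s - y) / 2)\<^sup>2 + 3 / 4 * (s - y)\<^sup>2
        \<le> (3 / 4 + 1 / 4)\<^sup>2 / (4 * (3 / 4))"
      using lattice_cover_tilted[of "3 / 4" p s] by auto
    also have "(p - x + (s - y) / 2)\<^sup>2 + 3 / 4 * (s - y)\<^sup>2
        = (p - x)\<^sup>2 + (p - x) * (s - y) + 1 * (s - y)\<^sup>2"
      by (simp add: power2_eq_square field_simps)
    finally show ?thesis unfolding quad_radius_def * by (auto simp: power2_eq_square)
  next
    assume *: "qtr TYPE('d) = 1" "qnm TYPE('d) = 3"
    obtain x y :: int where "(p - x + (s - y) / 2)\<^sup>2 + 11 / 4 * (s - y)\<^sup>2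
        \<le> (11 / 4 + 1 / 4)\<^sup>2 / (4 * (11 / 4))"
      using lattice_cover_tilted[of "11 / 4" p s] by auto
    also have "(p - x + (s - y) / 2)\<^sup>2 + 11 / 4 * (s - y)\<^sup>2
        = (p - x)\<^sup>2 + (p - x) * (s - y) + 3 * (s - y)\<^sup>2"
      by (simp add: power2_eq_square field_simps)
    finally show ?thesis unfolding quad_radius_def * by (auto simp: power2_eq_square)
  qed
  then obtain x y :: int where xy: "(p - x)\<^sup>2 + qtr TYPE('d) * (p - x) * (s - y)
    + qnm TYPE('d) * (s - y)\<^sup>2 \<le> quad_radius TYPE('d)" by blast
  define q :: "'d quad_int" where "q = Quad x y"
  have "quad_norm (a - b * q) * m = quad_norm ((a - b * q) * quad_cnj b)"
    unfolding quad_norm_mult m_def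
    by (simp add: quad_norm_def quad_cnj_def power2_eq_square algebra_simps)
  also have "(a - b * q) * quad_cnj b = c - (b * quad_cnj b) * q"
    by (simp add: c_def algebra_simps)
  also have "\<dots> = c - of_int m * q" by (simp add: quad_norm_conv_mult m_def)
  finally have 1: "quad_norm (a - b * q) * m = quad_norm (c - of_int m * q)" .
  have "real_of_int (quad_norm (c - of_int m * q)) = m\<^sup>2 * ((p - x)\<^sup>2
    + qtr TYPE('d) * (p - x) * (s - y) + qnm TYPE('d) * (s - y)\<^sup>2)"
  proof -
    have r: "real_of_int (qre (c - of_int m * q)) = m * (p - x)"
      and i: "real_of_int (qim (c - of_int m * q)) = m * (s - y)"
      using m by (simp_all add: p_def s_def q_def qre_mult qim_mult algebra_simps)
    show ?thesis
      unfolding quad_norm_def of_int_add of_int_mult of_int_power r i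
      by (simp add: power2_eq_square algebra_simps)
  qed
  also have "\<dots> \<le> m\<^sup>2 * quad_radius TYPE('d)" using xy by (intro mult_left_mono) auto
  finally have "real_of_int (quad_norm (a - b * q)) * m \<le> (quad_radius TYPE('d) * m) * m"
    unfolding of_int_mult[symmetric] 1 by (simp add: power2_eq_square mult_ac)
  then have "real_of_int (quad_norm (a - b * q)) \<le> quad_radius TYPE('d) * m"
    using m by simp
  then show ?thesis unfolding m_def by blast
qed

lemma quad_radius_less_1: "quad_radius TYPE('d::quad_param) < 1"
  using quad_param_cases[where 'a = 'd] by (auto simp: quad_radius_def)

lemma quad_norm_euclidean: "norm_euclidean (quad_nrm :: 'd::quad_param quad_int \<Rightarrow> nat)"
proof
  fix a b :: "'d quad_int"
  show "quad_nrm (a * b) = quad_nrm a * quad_nrm b"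
    by (simp add: quad_nrm_def quad_norm_mult nat_mult_distrib quad_norm_nonneg)
  show "quad_nrm a = 0 \<longleftrightarrow> a = 0"
    using quad_norm_nonneg[of a] quad_norm_0_iff[of a] by (auto simp: quad_nrm_def)
  assume b: "b \<noteq> 0"
  then obtain q where q: "quad_norm (a - b * q) \<le> quad_radius TYPE('d) * quad_norm b"
    using quad_division by blast
  have "quad_norm b > 0" using b quad_norm_nonneg[of b] quad_norm_0_iff[of b] by simp
  then have "quad_radius TYPE('d) * quad_norm b < 1 * real_of_int (quad_norm b)"
    by (intro mult_strict_right_mono quad_radius_less_1) simp
  with q have "quad_norm (a - b * q) < quad_norm b" by simp
  then show "\<exists>q. quad_nrm (a - b * q) < quad_nrm b"
    using quad_norm_nonneg[of "a - b * q"] by (auto simp: quad_nrm_def)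
qed

section \<open>Small cases of the descent\<close>

lemma quad_coordinate_bounds:
  fixes x :: "'d::quad_param quad_int"
  assumes "quad_norm x \<le> B"
  shows "(4 * qnm TYPE('d) - qtr TYPE('d)) * (qim x)\<^sup>2 \<le> 4 * B"
    and "(4 * qnm TYPE('d) - qtr TYPE('d)) * (qre x)\<^sup>2 \<le> 4 * qnm TYPE('d) * B"
proof -
  show "(4 * qnm TYPE('d) - qtr TYPE('d)) * (qim x)\<^sup>2 \<le> 4 * B"
    using assms four_quad_norm[of x] zero_le_power2[of "2 * qre x + qtr TYPE('d) * qim x"] by linarith
  have "4 * qnm TYPE('d) * quad_norm x = (qtr TYPE('d) * qre x + 2 * qnm TYPE('d) * qim x)\<^sup>2
    + (4 * qnm TYPE('d) - qtr TYPE('d)) * (qre x)\<^sup>2"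
    using quad_param_cases[where 'a = 'd] unfolding quad_norm_def
    by (elim disjE conjE) (simp_all add: power2_eq_square algebra_simps)
  moreover have "4 * qnm TYPE('d) * quad_norm x \<le> 4 * qnm TYPE('d) * B"
    using quad_param_cases[where 'a = 'd] assms by (intro mult_left_mono) auto
  ultimately show "(4 * qnm TYPE('d) - qtr TYPE('d)) * (qre x)\<^sup>2 \<le> 4 * qnm TYPE('d) * B"
    using zero_le_power2[of "qtr TYPE('d) * qre x + 2 * qnm TYPE('d) * qim x"] by linarith
qed

text \<open>Let \<rho> be the squared covering radius. If the reduced \<open>w'\<close> fails the
  size test, then (1 - \<rho>) N(b) is at most N(b) - N(w'), which is at most the square root of
  N(b). Hence N(b) is at most 1/(1 - \<rho>)^2: 9/4, 16 and 121/4 for the three rings.\<close>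

lemma quad_reduction:
  fixes a b w :: "'d::quad_param quad_int"
  assumes le: "quad_norm a \<le> quad_norm b" and b0: "b \<noteq> 0" and dvd: "b dvd w\<^sup>2 - a"
  obtains w' where "b dvd w'\<^sup>2 - a" "quad_norm (w'\<^sup>2 - a) < (quad_norm b)\<^sup>2"
  | w' where "b dvd w'\<^sup>2 - a" "quad_norm w' \<le> quad_radius TYPE('d) * quad_norm b"
      "(quad_norm b - quad_norm w')\<^sup>2 \<le> quad_norm b"
      "(1 - quad_radius TYPE('d))\<^sup>2 * quad_norm b \<le> 1"
proof -
  obtain q where q: "quad_norm (w - b * q) \<le> quad_radius TYPE('d) * quad_norm b"
    using quad_division[OF b0] by blast
  define w' where "w' = w - b * q"
  have "w'\<^sup>2 - a = (w\<^sup>2 - a) + b * (q * (b * q - 2 * w))"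
    by (simp add: w'_def power2_eq_square algebra_simps)
  then have dvd': "b dvd w'\<^sup>2 - a" using dvd by (metis dvd_add dvd_triv_left)
  have pos: "quad_norm b > 0" using b0 quad_norm_nonneg[of b] quad_norm_0_iff[of b] by simp
  have "quad_radius TYPE('d) * quad_norm b < 1 * real_of_int (quad_norm b)"
    using pos by (intro mult_strict_right_mono quad_radius_less_1) simp
  with q have less: "quad_norm w' < quad_norm b" by (simp add: w'_def)
  show ?thesis
  proof (cases "quad_norm b < (quad_norm b - quad_norm w')\<^sup>2")
    case True
    then show ?thesis using that(1) dvd' quad_norm_square_diff_less[OF le less] by blast
  next
    case False
    define r where "r = 1 - quad_radius TYPE('d)"
    have r: "r > 0" using quad_radius_less_1[where 'd = 'd] by (simp add: r_def)
    have "r * quad_norm b \<le> real_of_int (quad_norm b - quad_norm w')"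
      using q by (simp add: r_def w'_def algebra_simps)
    then have "(r * quad_norm b)\<^sup>2 \<le> (real_of_int (quad_norm b - quad_norm w'))\<^sup>2"
      using r pos by (intro power_mono) auto
    also have "\<dots> \<le> quad_norm b" using False by (metis not_less of_int_le_iff of_int_power)
    finally have "(r\<^sup>2 * quad_norm b) * quad_norm b \<le> 1 * real_of_int (quad_norm b)"
      by (simp add: power2_eq_square mult_ac)
    then have "r\<^sup>2 * quad_norm b \<le> 1" using pos by simp
    with that(2)[OF dvd' q[folded w'_def]] False show ?thesis unfolding r_def by simp
  qed
qed

text \<open>The norm on bare integer coordinates, in a form suited to evaluation.\<close>

definition norm_form :: "int \<Rightarrow> int \<Rightarrow> int \<Rightarrow> int \<Rightarrow> int" where
  "norm_form t n x y = x * x + t * (x * y) + n * (y * y)"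

text \<open>The result of replacing \<open>w\<close> by \<open>w + k b\<close>: whether \<open>(w\<^sup>2 - a) / b\<close> gets smaller than \<open>b\<close>.\<close>

definition shift_ok where
  "shift_ok t n Nb a1 a2 b1 b2 w1 w2 = (\<lambda>(k1, k2).
     let x = w1 + (k1 * b1 - n * (k2 * b2)); y = w2 + (k1 * b2 + k2 * b1 + t * (k2 * b2))
     in norm_form t n (x * x - n * (y * y) - a1) (2 * (x * y) + t * (y * y) - a2) < Nb * Nb)"

text \<open>Divisibility by \<open>b\<close> is tested on the coordinates of
  \<open>(w^2 - a) * quad_cnj b\<close> modulo the norm of \<open>b\<close>.\<close>

definition not_dvd where
  "not_dvd t n Nb a1 a2 b1 b2 w1 w2 =
     (let u = w1 * w1 - n * (w2 * w2) - a1; v = 2 * (w1 * w2) + t * (w2 * w2) - a2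
      in (u * (b1 + t * b2) + n * (v * b2)) mod Nb \<noteq> 0 \<or>
         (v * (b1 + t * b2) - u * b2 - t * (v * b2)) mod Nb \<noteq> 0)"

text \<open>\<open>exc\<close> lists the pairs \<open>(a, b)\<close> for which no shift of \<open>w\<close> helps; the range of the coordinates is bounded by
  \<open>p, q\<close>, the norm of \<open>b\<close> by \<open>B\<close>, and \<open>c / d\<close> is the squared covering radius.\<close>

definition small_case_check where
  "small_case_check t n c d B p q exc \<longleftrightarrow>
    list_all (\<lambda>b1. list_all (\<lambda>b2. let Nb = norm_form t n b1 b2 in Nb \<le> 1 \<or> B < Nb \<or>
      list_all (\<lambda>w1. list_all (\<lambda>w2. let Nw = norm_form t n w1 w2 in
          c * Nb < d * Nw \<or> Nb < (Nb - Nw) * (Nb - Nw) \<or>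
        list_all (\<lambda>a1. list_all (\<lambda>a2. Nb < norm_form t n a1 a2 \<or>
            shift_ok t n Nb a1 a2 b1 b2 w1 w2 (0, 0) \<or> not_dvd t n Nb a1 a2 b1 b2 w1 w2 \<or>
            list_ex (shift_ok t n Nb a1 a2 b1 b2 w1 w2) [(1, 0), (-1, 0), (0, 1), (0, -1)] \<or>
            ((a1, a2), (b1, b2)) \<in> set exc)
          (upto (- q) q)) (upto (- p) p)) (upto (- q) q)) (upto (- p) p)) (upto (- q) q)) (upto (- p) p)"

text \<open>3/4 is the squared covering radius and 16 = 1/(1 - 3/4)^2; a norm up to 16 confines the
  coordinates to 4 and 2.\<close>

lemma small_case_check_8:
  "small_case_check 0 2 3 4 16 4 2
     [((-1, 0), (0, 1)), ((-1, 0), (0, -1)), ((2, 0), (2, 0)), ((2, 0), (-2, 0))]"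
  by code_simp

text \<open>The squared covering radius is 9/11, 30 is the integer part of 121/4, and norms up to 30
  confine the coordinates to 5 and 3. The exceptional \<open>b\<close> are
  \<open>2 * \<omega>\<close>, its conjugate and their negatives.\<close>

lemma small_case_check_11:
  "small_case_check 1 3 9 11 30 5 3
     [((-3, 0), (0, 2)), ((-3, 0), (2, -2)), ((-3, 0), (0, -2)), ((-3, 0), (-2, 2))]"
  by code_simp

lemma square_leD: "\<bar>x\<bar> \<le> p" if "x\<^sup>2 \<le> k" "k < (p + 1)\<^sup>2" "0 \<le> p" for x p :: int
proof -
  have "\<bar>x\<bar>\<^sup>2 < (p + 1)\<^sup>2" using that by simp
  then have "\<bar>x\<bar> < p + 1" by (rule power2_less_imp_less) (use that(3) in simp)
  then show ?thesis by simp
qed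

lemma small_case:
  fixes a b w :: "'d::quad_param quad_int"
  assumes check: "small_case_check (qtr TYPE('d)) (qnm TYPE('d)) c d B p q exc"
    and bounds: "\<And>x :: 'd quad_int. quad_norm x \<le> B \<Longrightarrow> \<bar>qre x\<bar> \<le> p \<and> \<bar>qim x\<bar> \<le> q"
    and b: "1 < quad_norm b" "quad_norm b \<le> B" and a: "quad_norm a \<le> quad_norm b"
    and w: "d * quad_norm w \<le> c * quad_norm b" "quad_norm w \<le> quad_norm b"
      "(quad_norm b - quad_norm w)\<^sup>2 \<le> quad_norm b"
    and dvd: "b dvd w\<^sup>2 - a"
  shows "(\<exists>w. b dvd w\<^sup>2 - a \<and> quad_norm (w\<^sup>2 - a) < (quad_norm b)\<^sup>2) \<or>
    ((qre a, qim a), (qre b, qim b)) \<in> set exc"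
proof -
  let ?t = "qtr TYPE('d)" and ?n = "qnm TYPE('d)"
  have nf: "norm_form ?t ?n (qre x) (qim x) = quad_norm x" for x :: "'d quad_int"
    by (simp add: norm_form_def quad_norm_def power2_eq_square algebra_simps)
  have sq: "qre (x\<^sup>2) = qre x * qre x - ?n * (qim x * qim x)"
    "qim (x\<^sup>2) = 2 * (qre x * qim x) + ?t * (qim x * qim x)" for x :: "'d quad_int"
    by (simp_all add: power2_eq_square qre_mult qim_mult)
  have shift: "shift_ok ?t ?n (quad_norm b) (qre a) (qim a) (qre b) (qim b) (qre w) (qim w) k \<longleftrightarrow>
      quad_norm ((w + Quad (fst k) (snd k) * b)\<^sup>2 - a) < (quad_norm b)\<^sup>2" for k
    unfolding shift_ok_def Let_def
    by (cases k) (simp add: nf[symmetric] sq qre_mult qim_mult power2_eq_square)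
  \<comment> \<open>Multiplying by \<open>quad_cnj b\<close> replaces \<open>b\<close> by its norm,
    a rational integer, for which divisibility is coordinatewise.\<close>
  have nd: "\<not> not_dvd ?t ?n (quad_norm b) (qre a) (qim a) (qre b) (qim b) (qre w) (qim w)"
  proof -
    obtain e where e: "w\<^sup>2 - a = b * e" using dvd by blast
    have "(w\<^sup>2 - a) * quad_cnj b = (b * quad_cnj b) * e" unfolding e by (simp add: mult_ac)
    then have "(w\<^sup>2 - a) * quad_cnj b = of_int (quad_norm b) * e" unfolding quad_norm_conv_mult .
    then have "qre ((w\<^sup>2 - a) * quad_cnj b) mod quad_norm b = 0"
      "qim ((w\<^sup>2 - a) * quad_cnj b) mod quad_norm b = 0"
      by (simp_all add: qre_mult qim_mult)
    then show ?thesis unfolding not_dvd_def Let_def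
      by (simp add: qre_mult qim_mult quad_cnj_def sq algebra_simps)
  qed
  have range: "qre x \<in> set (upto (- p) p)" "qim x \<in> set (upto (- q) q)"
    if "quad_norm x \<le> B" for x :: "'d quad_int"
    using bounds[OF that] by auto
  have "shift_ok ?t ?n (quad_norm b) (qre a) (qim a) (qre b) (qim b) (qre w) (qim w) (0, 0) \<or>
      list_ex (shift_ok ?t ?n (quad_norm b) (qre a) (qim a) (qre b) (qim b) (qre w) (qim w))
        [(1, 0), (-1, 0), (0, 1), (0, -1)] \<or> ((qre a, qim a), (qre b, qim b)) \<in> set exc"
  proof -
    have r: "qre b \<in> set (upto (- p) p)" "qim b \<in> set (upto (- q) q)"
      "qre w \<in> set (upto (- p) p)" "qim w \<in> set (upto (- q) q)"
      "qre a \<in> set (upto (- p) p)" "qim a \<in> set (upto (- q) q)"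
      using range[of b] range[of w] range[of a] a b w by auto
    have "\<not> (quad_norm b \<le> 1 \<or> B < quad_norm b)"
      "\<not> (c * quad_norm b < d * quad_norm w \<or>
        quad_norm b < (quad_norm b - quad_norm w) * (quad_norm b - quad_norm w))"
      "\<not> quad_norm b < quad_norm a"
      using a b w by (auto simp: power2_eq_square)
    then show ?thesis using check nd r
      unfolding small_case_check_def list_all_iff Let_def by (metis nf)
  qed
  then obtain "\<exists>k. quad_norm ((w + k * b)\<^sup>2 - a) < (quad_norm b)\<^sup>2 \<or>
      ((qre a, qim a), (qre b, qim b)) \<in> set exc"
    unfolding shift list_ex_iff by blast
  moreover have "b dvd (w + k * b)\<^sup>2 - a" for k
  proof -
    have "(w + k * b)\<^sup>2 - a = (w\<^sup>2 - a) + b * (k * (2 * w + k * b))"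
      by (simp add: power2_eq_square algebra_simps)
    then show ?thesis using dvd by (metis dvd_add dvd_triv_left)
  qed
  ultimately show ?thesis by blast
qed

section \<open>The rings of discriminant -3, -8 and -11\<close>

datatype disc3 = Disc3
datatype disc8 = Disc8
datatype disc11 = Disc11

instantiation disc3 :: quad_param
begin
definition "qtr (_ :: disc3 itself) = (1 :: int)"
definition "qnm (_ :: disc3 itself) = (1 :: int)"
instance by standard (simp add: qtr_disc3_def qnm_disc3_def)
end

instantiation disc8 :: quad_param
begin
definition "qtr (_ :: disc8 itself) = (0 :: int)"
definition "qnm (_ :: disc8 itself) = (2 :: int)"
instance by standard (simp add: qtr_disc8_def qnm_disc8_def)
end

instantiation disc11 :: quad_param
begin
definition "qtr (_ :: disc11 itself) = (1 :: int)"
definition "qnm (_ :: disc11 itself) = (3 :: int)"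
instance by standard (simp add: qtr_disc11_def qnm_disc11_def)
end

lemmas qtr_qnm_defs = qtr_disc3_def qnm_disc3_def qtr_disc8_def qnm_disc8_def
  qtr_disc11_def qnm_disc11_def

lemma legendre_domain_quadI:
  assumes units: "\<And>u v :: 'd::quad_param quad_int. u dvd 1 \<Longrightarrow> v dvd 1 \<Longrightarrow> conic_isotropic u v"
    and red: "\<And>a b w v :: 'd quad_int. \<lbrakk>squarefree a; squarefree b; quad_norm a \<le> quad_norm b;
      1 < quad_norm b; a \<noteq> 0; b dvd w\<^sup>2 - a; a dvd v\<^sup>2 - b\<rbrakk> \<Longrightarrow>
      conic_isotropic a b \<or> (\<exists>w. b dvd w\<^sup>2 - a \<and> quad_norm (w\<^sup>2 - a) < (quad_norm b)\<^sup>2)"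
  shows "legendre_domain (quad_nrm :: 'd quad_int \<Rightarrow> nat)"
proof -
  interpret norm_euclidean "quad_nrm :: 'd quad_int \<Rightarrow> nat" by (rule quad_norm_euclidean)
  show ?thesis
  proof
    fix a b w v :: "'d quad_int"
    assume *: "squarefree a" "squarefree b" "quad_nrm a \<le> quad_nrm b" "1 < quad_nrm b" "a \<noteq> 0"
      "b dvd w\<^sup>2 - a" "a dvd v\<^sup>2 - b"
    have "quad_norm a \<le> quad_norm b" "1 < quad_norm b"
      using *(3,4) by (simp_all flip: of_nat_quad_nrm)
    then have "conic_isotropic a b \<or> (\<exists>w. b dvd w\<^sup>2 - a \<and> quad_norm (w\<^sup>2 - a) < (quad_norm b)\<^sup>2)"
      using red * by blast
    then show "conic_isotropic a b \<or> (\<exists>w. b dvd w\<^sup>2 - a \<and> quad_nrm (w\<^sup>2 - a) < (quad_nrm b)\<^sup>2)"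
      by (simp flip: of_nat_quad_nrm of_nat_power)
  qed (rule units)
qed

lemma quad_unit_iff: "u dvd 1 \<longleftrightarrow> quad_norm u = 1" for u :: "'d::quad_param quad_int"
proof -
  interpret norm_euclidean "quad_nrm :: 'd quad_int \<Rightarrow> nat" by (rule quad_norm_euclidean)
  show ?thesis using nrm_eq_1_iff[of u] by (simp flip: of_nat_quad_nrm)
qed

lemma quad_eqI: "qre x = p \<Longrightarrow> qim x = q \<Longrightarrow> x = Quad p q"
  by (simp add: quad_int_eq_iff)

lemma quad_mult_Quad: "Quad p q * (Quad r s :: 'd::quad_param quad_int)
  = Quad (p * r - qnm TYPE('d) * (q * s)) (p * s + q * r + qtr TYPE('d) * (q * s))"
  by (simp add: times_quad_int_def)

lemma conic_isotropicI:
  "(x, y, z) \<noteq> (0, 0, 0) \<Longrightarrow> z * z = a * (x * x) + b * (y * y) \<Longrightarrow> conic_isotropic a b"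
  unfolding conic_isotropic_def power2_eq_square by blast

lemmas quad_calc = qre_mult qim_mult plus_quad_int_def quad_mult_Quad quad_int_eq_iff qtr_qnm_defs one_quad_int_def zero_quad_int_def

text \<open>The exceptional pairs with \<open>a = 2\<close> drop out because 2 is
  \<open>- (\<omega>^2)\<close>. For \<open>a = -1\<close> and \<open>b = \<omega>\<close> or
  \<open>- \<omega>\<close> only the single prime above 2 could obstruct, so by the product formula
  a zero exists; it is written down.\<close>

lemma legendre_domain_disc8: "legendre_domain (quad_nrm :: disc8 quad_int \<Rightarrow> nat)"
proof (rule legendre_domain_quadI)
  fix u v :: "disc8 quad_int"
  have unit: "x = 1\<^sup>2 \<or> x = Quad (-1) 0" if "x dvd 1" for x :: "disc8 quad_int"
  proof -
    have 1: "(qre x)\<^sup>2 + 2 * (qim x)\<^sup>2 = 1"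
      using that by (simp add: quad_unit_iff quad_norm_def qtr_qnm_defs)
    then have "(qim x)\<^sup>2 \<le> 0" using zero_le_power2[of "qre x"] by linarith
    with 1 have "qim x = 0" "(qre x)\<^sup>2 = 1" by auto
    then show ?thesis by (auto simp: quad_int_eq_iff power2_eq_1_iff)
  qed
  assume "u dvd 1" "v dvd 1"
  then consider "u = 1\<^sup>2" | "v = 1\<^sup>2" | "u = Quad (-1) 0" "v = Quad (-1) 0" using unit by blast
  then show "conic_isotropic u v"
  proof cases
    case 3
    show ?thesis
      by (rule conic_isotropicI[of 1 1 "Quad 0 1"]) (simp_all add: 3 quad_calc)
  qed (auto simp only: conic_isotropic_square conic_isotropic_commute[of u])
next
  fix a b w v :: "disc8 quad_int"
  assume sf: "squarefree a" "squarefree b" and le: "quad_norm a \<le> quad_norm b"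
    and b1: "1 < quad_norm b" and dvd: "b dvd w\<^sup>2 - a"
  have "b \<noteq> 0" using b1 by (auto simp: quad_norm_def)
  from le this dvd show
    "conic_isotropic a b \<or> (\<exists>w. b dvd w\<^sup>2 - a \<and> quad_norm (w\<^sup>2 - a) < (quad_norm b)\<^sup>2)"
  proof (cases rule: quad_reduction)
    case (2 w)
    have "(\<exists>w. b dvd w\<^sup>2 - a \<and> quad_norm (w\<^sup>2 - a) < (quad_norm b)\<^sup>2) \<or>
      ((qre a, qim a), (qre b, qim b)) \<in> set [((-1, 0), (0, 1)), ((-1, 0), (0, -1)),
        ((2, 0), (2, 0)), ((2, 0), (-2, 0))]"
    proof (rule small_case[of 3 4 16 4 2 _ b a w])
      show "4 * quad_norm w \<le> 3 * quad_norm b" "quad_norm w \<le> quad_norm b" "quad_norm b \<le> 16"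
        using 2(2,4) quad_norm_nonneg[of b]
        by (simp_all add: quad_radius_def qtr_qnm_defs power2_eq_square)
      fix x :: "disc8 quad_int" assume "quad_norm x \<le> 16"
      from quad_coordinate_bounds[OF this]
      show "\<bar>qre x\<bar> \<le> 4 \<and> \<bar>qim x\<bar> \<le> 2"
        by (intro conjI square_leD[of _ 16] square_leD[of _ 8]) (simp_all add: qtr_qnm_defs)
    qed (use small_case_check_8 b1 le 2 in \<open>simp_all add: qtr_qnm_defs\<close>)
    moreover have "\<not> squarefree (Quad 2 0 :: disc8 quad_int)"
    proof
      assume "squarefree (Quad 2 0 :: disc8 quad_int)"
      moreover have "(Quad 0 1)\<^sup>2 * Quad (-1) 0 = (Quad 2 0 :: disc8 quad_int)"
        by (simp add: power2_eq_square quad_calc)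
      ultimately have "(Quad 0 1 :: disc8 quad_int) dvd 1" unfolding squarefree_def by (metis dvd_triv_left)
      then show False by (simp add: quad_unit_iff quad_norm_def qtr_qnm_defs)
    qed
    then have "(qre a, qim a) \<noteq> (2, 0)" using sf(1) by (metis Pair_inject quad_eqI)
    moreover have "conic_isotropic a b" if "qre a = -1" "qim a = 0" "qre b = 0" "qim b = -1"
      by (rule conic_isotropicI[of "Quad 1 1" "Quad 0 1" 1])
        (simp_all add: quad_eqI[OF that(1,2)] quad_eqI[OF that(3,4)] quad_calc)
    moreover have "conic_isotropic a b" if "qre a = -1" "qim a = 0" "qre b = 0" "qim b = 1"
      by (rule conic_isotropicI[of "Quad (-5) (-2)" "Quad (-2) 1" "Quad 3 (-3)"])
        (simp_all add: quad_eqI[OF that(1,2)] quad_eqI[OF that(3,4)] quad_calc)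
    ultimately show ?thesis by auto
  qed blast
qed

text \<open>For \<open>a = -3\<close> and \<open>b = 2 * \<omega>\<close> or its conjugate, the
  residue condition modulo \<open>a\<close> fails; for the negatives of these \<open>b\<close> a
  zero is written down.\<close>

lemma legendre_domain_disc11: "legendre_domain (quad_nrm :: disc11 quad_int \<Rightarrow> nat)"
proof (rule legendre_domain_quadI)
  fix u v :: "disc11 quad_int"
  have unit: "x = 1\<^sup>2 \<or> x = Quad (-1) 0" if "x dvd 1" for x :: "disc11 quad_int"
  proof -
    have 1: "(qre x)\<^sup>2 + qre x * qim x + 3 * (qim x)\<^sup>2 = 1"
      using that by (simp add: quad_unit_iff quad_norm_def qtr_qnm_defs)
    have "11 * (qim x)\<^sup>2 \<le> 4"
      using quad_coordinate_bounds(1)[of x 1] that by (simp add: quad_unit_iff qtr_qnm_defs)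
    then have "(qim x)\<^sup>2 \<le> 0" by linarith
    with 1 have "qim x = 0" "(qre x)\<^sup>2 = 1" by auto
    then show ?thesis by (auto simp: quad_int_eq_iff power2_eq_1_iff)
  qed
  assume "u dvd 1" "v dvd 1"
  then consider "u = 1\<^sup>2" | "v = 1\<^sup>2" | "u = Quad (-1) 0" "v = Quad (-1) 0" using unit by blast
  then show "conic_isotropic u v"
  proof cases
    case 3
    show ?thesis
      by (rule conic_isotropicI[of "Quad 5 0" "Quad 5 (-3)" "Quad 2 3"]) (simp_all add: 3 quad_calc)
  qed (auto simp only: conic_isotropic_square conic_isotropic_commute[of u])
next
  fix a b w v :: "disc11 quad_int"
  assume le: "quad_norm a \<le> quad_norm b"
    and b1: "1 < quad_norm b" and dvd: "b dvd w\<^sup>2 - a" and dvd': "a dvd v\<^sup>2 - b"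
  have "b \<noteq> 0" using b1 by (auto simp: quad_norm_def)
  from le this dvd show
    "conic_isotropic a b \<or> (\<exists>w. b dvd w\<^sup>2 - a \<and> quad_norm (w\<^sup>2 - a) < (quad_norm b)\<^sup>2)"
  proof (cases rule: quad_reduction)
    case (2 w)
    have "(\<exists>w. b dvd w\<^sup>2 - a \<and> quad_norm (w\<^sup>2 - a) < (quad_norm b)\<^sup>2) \<or>
      ((qre a, qim a), (qre b, qim b)) \<in> set [((-3, 0), (0, 2)), ((-3, 0), (2, -2)),
        ((-3, 0), (0, -2)), ((-3, 0), (-2, 2))]"
    proof (rule small_case[of 9 11 30 5 3 _ b a w])
      show "11 * quad_norm w \<le> 9 * quad_norm b" "quad_norm w \<le> quad_norm b" "quad_norm b \<le> 30"
        using 2(2,4) quad_norm_nonneg[of b]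
        by (simp_all add: quad_radius_def qtr_qnm_defs power2_eq_square)
      fix x :: "disc11 quad_int" assume "quad_norm x \<le> 30"
      from quad_coordinate_bounds[OF this]
      show "\<bar>qre x\<bar> \<le> 5 \<and> \<bar>qim x\<bar> \<le> 3"
        by (intro conjI square_leD[of _ 32] square_leD[of _ 10]) (simp_all add: qtr_qnm_defs)
    qed (use small_case_check_11 b1 le 2 in \<open>simp_all add: qtr_qnm_defs\<close>)
    \<comment> \<open>Modulo the prime factor of 3 that does not divide \<open>b\<close>,
      \<open>b\<close> is congruent to the nonresidue 2. In coordinates modulo 3, either
      \<open>x * x\<close> or \<open>y * y\<close> would be 2.\<close>
    moreover have False if "qre a = -3" "qim a = 0" and qb: "(qre b, qim b) = (0, 2) \<or> (qre b, qim b) = (2, -2)"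
    proof -
      obtain e where e: "v\<^sup>2 - b = a * e" using dvd' by blast
      define x y where "x = qre v" and "y = qim v"
      have "x * x - 3 * (y * y) - qre b = - 3 * qre e" "2 * (x * y) + y * y - qim b = - 3 * qim e"
        using arg_cong[OF e, of qre] arg_cong[OF e, of qim] that(1,2)
        by (simp_all add: power2_eq_square qre_mult qim_mult qtr_qnm_defs x_def y_def mult.commute)
      then have 3: "x * x = qre b + 3 * (y * y - qre e)" "2 * (x * y) + y * y = qim b + 3 * (- qim e)"
        by (simp_all add: algebra_simps)
      have m: "z * z mod 3 = 0 \<and> z mod 3 = 0 \<or> z * z mod 3 = 1" for z :: int
      proof -
        have "z mod 3 = 0 \<or> z mod 3 = 1 \<or> z mod 3 = 2" by presburger
        moreover have "z * z mod 3 = (z mod 3) * (z mod 3) mod 3" by (simp add: mod_mult_eq)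
        ultimately show ?thesis by auto
      qed
      have xx: "x * x mod 3 = qre b mod 3" unfolding 3(1) by (rule mod_mult_self2)
      from qb show False
      proof
        assume *: "(qre b, qim b) = (0, 2)"
        then have "x mod 3 = 0" using m[of x] xx by auto
        then obtain k where "x = 3 * k" by auto
        then have "y * y = 2 + 3 * (- qim e - 2 * (k * y))" using 3(2) * by (simp add: algebra_simps)
        then have "y * y mod 3 = 2" by presburger
        then show False using m[of y] by auto
      next
        assume "(qre b, qim b) = (2, -2)"
        then show False using m[of x] xx by auto
      qed
    qed
    moreover have "conic_isotropic a b" if "qre a = -3" "qim a = 0" "qre b = 0" "qim b = -2"
      by (rule conic_isotropicI[of "Quad (-5) (-1)" "Quad (-2) 4" "Quad 3 5"])
        (simp_all add: quad_eqI[OF that(1,2)] quad_eqI[OF that(3,4)] quad_calc)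
    moreover have "conic_isotropic a b" if "qre a = -3" "qim a = 0" "qre b = -2" "qim b = 2"
      by (rule conic_isotropicI[of "Quad (-5) 0" "Quad (-4) 2" "Quad 1 2"])
        (simp_all add: quad_eqI[OF that(1,2)] quad_eqI[OF that(3,4)] quad_calc)
    ultimately show ?thesis by auto
  qed blast
qed

lemma legendre_domain_disc3: "legendre_domain (quad_nrm :: disc3 quad_int \<Rightarrow> nat)"
proof (rule legendre_domain_quadI)
  fix u v :: "disc3 quad_int"
  have bounds: "\<bar>qre x\<bar> \<le> 1 \<and> \<bar>qim x\<bar> \<le> 1" if "quad_norm x \<le> 2" for x :: "disc3 quad_int"
    using quad_coordinate_bounds[OF that]
    by (intro conjI square_leD[of _ 2]) (simp_all add: qtr_qnm_defs)
  have unit: "\<exists>y. x = y\<^sup>2 \<or> x = - (y\<^sup>2) \<and> y dvd 1" if "x dvd 1" for x :: "disc3 quad_int"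
  proof -
    have 1: "qre x * qre x + qre x * qim x + qim x * qim x = 1"
      using that by (simp add: quad_unit_iff quad_norm_def qtr_qnm_defs power2_eq_square)
    have "quad_norm x \<le> 2" using that by (simp add: quad_unit_iff)
    from bounds[OF this] have "qre x \<in> {-1, 0, 1}" "qim x \<in> {-1, 0, 1}" by auto
    with 1 have "(qre x, qim x) \<in> {(1, 0), (0, 1), (-1, 1), (-1, 0), (0, -1), (1, -1)}" by auto
    then have "x = 1\<^sup>2 \<or> x = - ((Quad (-1) 1)\<^sup>2) \<or> x = (Quad 0 1)\<^sup>2 \<or> x = - (1\<^sup>2) \<or>
        x = (Quad (-1) 1)\<^sup>2 \<or> x = - ((Quad 0 1)\<^sup>2)"
      by (auto simp: power2_eq_square quad_calc)
    moreover have "(1 :: disc3 quad_int) dvd 1" "(Quad (-1) 1 :: disc3 quad_int) dvd 1"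
      "(Quad 0 1 :: disc3 quad_int) dvd 1"
      by (simp_all add: quad_unit_iff quad_norm_def qtr_qnm_defs)
    ultimately show ?thesis by (elim disjE; blast)
  qed
  assume u: "u dvd 1" and v: "v dvd 1"
  obtain y where y: "u = y\<^sup>2 \<or> u = - (y\<^sup>2) \<and> y dvd 1" using unit[OF u] by blast
  obtain z where z: "v = z\<^sup>2 \<or> v = - (z\<^sup>2) \<and> z dvd 1" using unit[OF v] by blast
  from y z consider "u = y\<^sup>2" | "v = z\<^sup>2"
    | "u = - (y\<^sup>2)" "v = - (z\<^sup>2)" "y dvd 1" "z dvd 1" by argo
  then show "conic_isotropic u v"
  proof cases
    case 3
    obtain y' z' where yz': "1 = y * y'" "1 = z * z'" using 3(3,4) by (elim dvdE)
    note yz = yz'[symmetric]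
    define \<omega> :: "disc3 quad_int" where "\<omega> = Quad 0 1"
    have \<omega>: "\<omega> * \<omega> = \<omega> - 1" by (simp add: \<omega>_def quad_calc)
    \<comment> \<open>\<open>\<omega>^2\<close> is a primitive cube root of unity, so
      \<open>1 + \<omega>^2 + \<omega>^4 = 0\<close> makes -1 a sum of two squares;
      \<open>y'\<close> and \<open>z'\<close> cancel the square parts of the units.\<close>
    have "1 * 1 = u * ((\<omega> * y') * (\<omega> * y')) + v * ((\<omega> * \<omega> * z') * (\<omega> * \<omega> * z'))"
    proof -
      have "u * ((\<omega> * y') * (\<omega> * y')) = - ((y * y')\<^sup>2 * (\<omega> * \<omega>))"
        "v * ((\<omega> * \<omega> * z') * (\<omega> * \<omega> * z')) = - ((z * z')\<^sup>2 * ((\<omega> * \<omega>) * (\<omega> * \<omega>)))"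
        by (simp_all add: 3 power2_eq_square algebra_simps)
      then show ?thesis unfolding yz \<omega> by (simp add: algebra_simps \<omega>)
    qed
    from conic_isotropicI[OF _ this] show ?thesis by simp
  qed (auto simp only: conic_isotropic_square conic_isotropic_commute[of u])
next
  fix a b w v :: "disc3 quad_int"
  assume le: "quad_norm a \<le> quad_norm b"
    and b1: "1 < quad_norm b" and dvd: "b dvd w\<^sup>2 - a"
  have "b \<noteq> 0" using b1 by (auto simp: quad_norm_def)
  from le this dvd show
    "conic_isotropic a b \<or> (\<exists>w. b dvd w\<^sup>2 - a \<and> quad_norm (w\<^sup>2 - a) < (quad_norm b)\<^sup>2)"
  proof (cases rule: quad_reduction)
    case (2 w)
    \<comment> \<open>The bound 9/4 leaves only norm 2, and 2 is not a norm from the Eisenstein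
      integers.\<close>
    then have 2: "quad_norm b = 2"
      using b1 by (simp add: quad_radius_def qtr_qnm_defs power2_eq_square)
    then have "quad_norm b \<le> 2" by simp
    from quad_coordinate_bounds[OF this] have "\<bar>qre b\<bar> \<le> 1 \<and> \<bar>qim b\<bar> \<le> 1"
      by (intro conjI square_leD[of _ 2]) (simp_all add: qtr_qnm_defs)
    then have "qre b \<in> {-1, 0, 1}" "qim b \<in> {-1, 0, 1}" by auto
    with 2 show ?thesis by (auto simp: quad_norm_def qtr_qnm_defs)
  qed blast
qed

section \<open>Conics with rational coefficients over a quadratic field\<close>

text \<open>For squarefree \<open>a, b\<close> and an odd prime \<open>p\<close>: the Hilbert symbol of \<open>a, b\<close> at \<open>p\<close> is trivial.\<close>

definition tame_at :: "int \<Rightarrow> int \<Rightarrow> int \<Rightarrow> bool" where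
  "tame_at a b p \<longleftrightarrow>
    (p dvd b \<longrightarrow> \<not> p dvd a \<longrightarrow> square_mod a p) \<and>
    (p dvd a \<longrightarrow> \<not> p dvd b \<longrightarrow> square_mod b p) \<and>
    (p dvd a \<longrightarrow> p dvd b \<longrightarrow> square_mod (- (a div p) * (b div p)) p)"

lemma comaximal_int_iff: "comaximal a b \<longleftrightarrow> coprime a b" for a b :: int
proof
  assume "comaximal a b"
  then show "coprime a b" unfolding comaximal_def
    by (metis coprimeI dvd_add dvd_mult)
next
  assume "coprime a b"
  then show "comaximal a b" unfolding comaximal_def
    by (metis bezout_int coprime_iff_gcd_eq_1)
qed

text \<open>A Bezout relation is an equation and survives the ring homomorphism.\<close>

lemma comaximal_of_int:
  "coprime a b \<Longrightarrow> comaximal (of_int a) (of_int b :: 'a::comm_ring_1)"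
proof -
  assume "coprime a b"
  then obtain u v where "u * a + v * b = 1" using comaximal_int_iff unfolding comaximal_def by blast
  then have "of_int u * of_int a + of_int v * of_int b = (1 :: 'a)" by (metis of_int_1 of_int_add of_int_mult)
  then show ?thesis unfolding comaximal_def by blast
qed

lemma square_mod_of_int:
  assumes "square_mod a m"
  shows "square_mod (of_int a) (of_int m :: 'a::comm_ring_1)"
proof -
  obtain w e where "w\<^sup>2 - a = m * e" using assms unfolding square_mod_def by blast
  then have "(of_int w)\<^sup>2 - of_int a = of_int m * (of_int e :: 'a)"
    by (metis of_int_diff of_int_mult of_int_power)
  then show ?thesis unfolding square_mod_def by (metis dvd_triv_left)
qed

lemma square_mod_2: "square_mod a (2 :: int)"
  unfolding square_mod_def by (rule exI[of _ a]) (simp add: power2_eq_square)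

lemma square_mod_iff_QuadRes: "square_mod a p \<longleftrightarrow> QuadRes p a"
  by (simp add: square_mod_def QuadRes_def cong_iff_dvd_diff)

text \<open>Chinese remaindering over the rational prime factors of \<open>m\<close>, while
  \<open>A\<close> may lie in the larger ring.\<close>

lemma square_mod_squarefree:
  fixes m :: int and A :: "'a::comm_ring_1"
  assumes "squarefree m" "\<And>p. Factorial_Ring.prime p \<Longrightarrow> p dvd m \<Longrightarrow> square_mod A (of_int p)"
  shows "square_mod A (of_int m)"
  using assms
proof (induction "nat \<bar>m\<bar>" arbitrary: m rule: less_induct)
  case less
  have m0: "m \<noteq> 0" using less(2) by (metis not_squarefree_0)
  show ?case
  proof (cases "is_unit m")
    case True
    then obtain k where "1 = m * k" by (rule dvdE)
    then have "(1 :: 'a) = of_int m * of_int k" by (metis of_int_1 of_int_mult)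
    then have "of_int m dvd (1 :: 'a)" by (rule dvdI)
    then have "of_int m dvd A" using dvd_trans one_dvd by blast
    then show ?thesis by (rule square_mod_0)
  next
    case False
    then obtain p where p: "Factorial_Ring.prime p" "p dvd m" using m0 prime_divisor_exists by blast
    then obtain k where k: "m = p * k" by blast
    have pp: "p > 1" using p(1) prime_gt_1_int by blast
    have "coprime p k"
      using less(2) p(1) unfolding k squarefree_def
      by (metis mult_dvd_mono dvd_refl not_prime_unit power2_eq_square prime_imp_coprime)
    moreover have "squarefree k" using less(2) k squarefree_dvd by (metis dvd_triv_right)
    moreover have "nat \<bar>k\<bar> < nat \<bar>m\<bar>"
    proof -
      have "\<bar>k\<bar> > 0" using m0 k by auto
      then have "1 * \<bar>k\<bar> < p * \<bar>k\<bar>" using pp by (intro mult_strict_right_mono) auto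
      then show ?thesis using pp by (simp add: k abs_mult)
    qed
    ultimately have "square_mod A (of_int k)" using less(1,3) k by (metis dvd_mult)
    with \<open>coprime p k\<close> less(3)[OF p] show ?thesis
      unfolding k of_int_mult by (intro square_mod_mult comaximal_of_int)
  qed
qed

text \<open>A rational prime at which the quadratic field does not split: two nonresidues have a residue as
  product, and \<open>-P\<close> is a square in the field.\<close>

lemma square_mod_nonsplit:
  fixes \<delta> :: "'a::comm_ring_1"
  assumes r: "Factorial_Ring.prime r" "r > 2" and \<delta>: "\<delta>\<^sup>2 = of_int (- P)"
    and P: "\<not> QuadRes (int r) (- P)"
  shows "square_mod (of_int n) (of_int (int r) :: 'a)"
proof (cases "int r dvd n \<or> QuadRes (int r) n")
  case True
  then have "square_mod n (int r)" using square_mod_0 square_mod_iff_QuadRes by blast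
  then show ?thesis by (rule square_mod_of_int)
next
  case False
  have PL: "\<not> int r dvd - P" using P square_mod_0 square_mod_iff_QuadRes by blast
  have 1: "Legendre n (int r) = -1" "Legendre (- P) (int r) = -1"
    using False P PL by (auto simp: Legendre_def cong_0_iff)
  let ?e = "(r - 1) div 2"
  have "[Legendre (n * - P) (int r) = (n * - P) ^ ?e] (mod int r)"
    by (rule euler_criterion) (use r in auto)
  moreover have "[n ^ ?e * (- P) ^ ?e = (-1) * (-1)] (mod int r)"
    using euler_criterion[OF r(1), of n] euler_criterion[OF r(1), of "- P"] r 1
    by (intro cong_mult) (auto simp: cong_sym)
  ultimately have "[Legendre (n * - P) (int r) = 1] (mod int r)"
    unfolding power_mult_distrib using cong_trans by force
  then have "Legendre (n * - P) (int r) = 1"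
    using r by (auto simp: Legendre_def cong_iff_dvd_diff split: if_splits dest!: zdvd_imp_le)
  then have "QuadRes (int r) (n * - P)" by (auto simp: Legendre_def split: if_splits)
  then have "square_mod (of_int (n * - P)) (of_int (int r) :: 'a)"
    using square_mod_iff_QuadRes square_mod_of_int by blast
  then have "square_mod (of_int n * \<delta>\<^sup>2) (of_int (int r) :: 'a)" by (simp add: \<delta>)
  moreover have "comaximal (of_int (int r)) (of_int (- P) :: 'a)"
    using PL r by (intro comaximal_of_int prime_imp_coprime) auto
  then have "comaximal (of_int (int r)) \<delta>"
    unfolding \<delta>[symmetric] by (rule comaximal_dvd_right) (simp add: power2_eq_square)
  ultimately show ?thesis using square_mod_cancel by blast
qed

lemma of_int_dvd_quad_iff:
  "of_int p dvd x \<longleftrightarrow> p dvd qre x \<and> p dvd qim x" for x :: "'d::quad_param quad_int"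
proof
  assume "p dvd qre x \<and> p dvd qim x"
  then obtain u v where "qre x = p * u" "qim x = p * v" by (auto elim!: dvdE)
  then have "x = of_int p * Quad u v" by (simp add: quad_int_eq_iff qre_mult qim_mult)
  then show "of_int p dvd x" by simp
qed (auto simp: qre_mult qim_mult elim!: dvdE)

text \<open>Only ramified primes acquire a square factor, and these divide the discriminant. A prime
  \<open>p\<close> dividing the norm of a nonunit \<open>x\<close> divides \<open>a\<close> exactly
  once, so after one cancellation it divides \<open>(quad_cnj x)^2\<close>. Coordinates then give
  either \<open>p^2\<close> dividing \<open>a\<close> or \<open>p\<close> dividing the
  discriminant.\<close>

lemma squarefree_quad_of_int:
  fixes a :: int
  assumes sf: "squarefree a"
    and P: "\<And>p. Factorial_Ring.prime p \<Longrightarrow> p dvd a \<Longrightarrow> \<not> p dvd 4 * qnm TYPE('d::quad_param) - qtr TYPE('d)"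
  shows "squarefree (of_int a :: 'd quad_int)"
  unfolding squarefree_def
proof safe
  fix x :: "'d quad_int"
  assume "x\<^sup>2 dvd of_int a"
  then obtain y where y: "of_int a = x\<^sup>2 * y" by blast
  have a0: "a \<noteq> 0" using sf by (metis not_squarefree_0)
  have "(quad_norm x)\<^sup>2 * quad_norm y = a\<^sup>2"
    using arg_cong[OF y, of quad_norm]
    by (simp add: quad_norm_mult power2_eq_square quad_norm_of_int[unfolded power2_eq_square])
  then have na: "quad_norm x dvd a" by (metis dvd_triv_left pow_divides_pow_iff zero_less_numeral)
  show "x dvd 1"
  proof (rule ccontr)
    assume "\<not> x dvd 1"
    then have "\<not> is_unit (quad_norm x)" using quad_norm_nonneg[of x] by (auto simp: quad_unit_iff)
    moreover have "quad_norm x \<noteq> 0" using na a0 by auto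
    ultimately obtain p where p: "Factorial_Ring.prime p" "p dvd quad_norm x"
      using prime_divisor_exists by blast
    obtain a' where a': "a = p * a'" using p na dvd_trans by blast
    obtain m where m: "quad_norm x = p * m" using p by blast
    have sfp: "\<not> p\<^sup>2 dvd a" using sf p(1) unfolding squarefree_def by (metis not_prime_unit)
    then have pa': "\<not> p dvd a'" by (simp add: a' power2_eq_square)
    have p0: "p \<noteq> 0" using p by auto
    have "of_int a * (quad_cnj x)\<^sup>2 = (x * quad_cnj x)\<^sup>2 * y" unfolding y by (simp add: power2_eq_square mult_ac)
    also have "\<dots> = of_int p * of_int p * (of_int (m\<^sup>2) * y)"
      unfolding quad_norm_conv_mult m by (simp add: power2_eq_square mult_ac)
    finally have "of_int p * (of_int a' * (quad_cnj x)\<^sup>2) = of_int p * (of_int p * (of_int (m\<^sup>2) * y))"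
      unfolding a' by (simp add: mult_ac)
    moreover have "(of_int p :: 'd quad_int) \<noteq> 0" using p0 by (simp add: quad_int_eq_iff)
    ultimately have "of_int a' * (quad_cnj x)\<^sup>2 = of_int p * (of_int (m\<^sup>2) * y)" by simp
    then have "of_int p dvd of_int a' * (quad_cnj x)\<^sup>2" by simp
    moreover have "comaximal (of_int p) (of_int a' :: 'd quad_int)"
      using pa' p(1) by (intro comaximal_of_int prime_imp_coprime) auto
    ultimately have "of_int p dvd (quad_cnj x)\<^sup>2" using comaximal_dvd_multD by blast
    moreover have e1: "qre ((quad_cnj x)\<^sup>2) = qre (quad_cnj x) * qre (quad_cnj x) - qnm TYPE('d) * (qim x * qim x)"
      and e2: "qim ((quad_cnj x)\<^sup>2) = - (qim x * (2 * qre (quad_cnj x) - qtr TYPE('d) * qim x))"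
      by (simp_all add: power2_eq_square qre_mult qim_mult quad_cnj_def algebra_simps)
    ultimately have "p dvd qre ((quad_cnj x)\<^sup>2)" and d2: "p dvd qim ((quad_cnj x)\<^sup>2)"
      unfolding of_int_dvd_quad_iff by blast+
    then have d: "p dvd qre (quad_cnj x) * qre (quad_cnj x) - qnm TYPE('d) * (qim x * qim x)"
      "p dvd qim x * (2 * qre (quad_cnj x) - qtr TYPE('d) * qim x)"
      unfolding e1 e2 dvd_minus_iff by blast+
    define z where "z = qre (quad_cnj x)"
    have qx: "qre x = z - qtr TYPE('d) * qim x" by (simp add: z_def quad_cnj_def)
    show False
    proof (cases "p dvd qim x")
      case True
      then have "p dvd z * z" using d(1) unfolding z_def
        by (metis dvd_diff_left_iff dvd_mult dvd_mult2)
      then have "p dvd z" using p(1) by (simp add: prime_dvd_mult_iff)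
      then have "p dvd qre x" using True qx by simp
      with True have "p\<^sup>2 dvd quad_norm x"
        by (auto simp: quad_norm_def power2_eq_square elim!: dvdE)
      then show False using na sfp dvd_trans by blast
    next
      case False
      then have e: "p dvd 2 * z - qtr TYPE('d) * qim x"
        using d(2) p(1) unfolding z_def by (simp add: prime_dvd_mult_iff)
      \<comment> \<open>The combination eliminates \<open>z\<close> and leaves the discriminant
        times \<open>(qim x)^2\<close>, up to sign.\<close>
      have "p dvd (2 * z - qtr TYPE('d) * qim x) * (2 * z + qtr TYPE('d) * qim x)
          - 4 * (z * z - qnm TYPE('d) * (qim x * qim x))"
        using dvd_diff[OF dvd_mult2[OF e] dvd_mult[OF d(1)[folded z_def]]] .
      also have "\<dots> = (4 * qnm TYPE('d) - qtr TYPE('d)) * (qim x * qim x)"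
        using quad_param_cases[where 'a = 'd] by (auto simp: algebra_simps)
      finally have "p dvd 4 * qnm TYPE('d) - qtr TYPE('d)"
        using False p(1) by (simp add: prime_dvd_mult_iff)
      then show False using P p(1) a' by auto
    qed
  qed
qed

lemma conic_isotropic_scale:
  fixes a b s t :: "'a::idom"
  assumes "conic_isotropic a b" "s \<noteq> 0" "t \<noteq> 0"
  shows "conic_isotropic (a * s\<^sup>2) (b * t\<^sup>2)"
proof -
  obtain x y z where *: "(x, y, z) \<noteq> (0, 0, 0)" "z\<^sup>2 = a * x\<^sup>2 + b * y\<^sup>2"
    using assms unfolding conic_isotropic_def by blast
  have "(z * s * t)\<^sup>2 = a * s\<^sup>2 * (x * t)\<^sup>2 + b * t\<^sup>2 * (y * s)\<^sup>2"
    using *(2) by (simp add: power_mult_distrib algebra_simps)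
  moreover have "(x * t, y * s, z * s * t) \<noteq> (0, 0, 0)" using *(1) assms by auto
  ultimately show ?thesis unfolding conic_isotropic_def by blast
qed

text \<open>\<open>a\<close> and \<open>b\<close> arise from \<open>a0\<close> and \<open>b0\<close>
  by removing factors \<open>\<delta>^2 = - P\<close>, units modulo every prime other than
  \<open>P\<close>; so residue conditions carry over. At 2 every integer is a square, at
  \<open>r\<close> non-splitting makes every integer a square in the larger ring, and
  \<open>P\<close> divides neither \<open>a\<close> nor \<open>b\<close>.\<close>

lemma tame_at_imp_legendre_cond:
  fixes a b :: int and \<delta> :: "'d::quad_param quad_int"
  assumes sf: "squarefree a" "squarefree b" and P: "Factorial_Ring.prime P" and \<delta>: "\<delta>\<^sup>2 = of_int (- P)"
    and PE: "\<And>p. Factorial_Ring.prime p \<Longrightarrow> p dvd 4 * qnm TYPE('d) - qtr TYPE('d) \<Longrightarrow> p = P"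
    and Pab: "\<not> P dvd a" "\<not> P dvd b"
    and s: "s = 1 \<or> s = \<delta>" and t: "t = 1 \<or> t = \<delta>"
    and a0: "of_int a0 = of_int a * s\<^sup>2" and b0: "of_int b0 = of_int b * t\<^sup>2"
    and r: "Factorial_Ring.prime r" "r > 2" "int r = P \<or> \<not> QuadRes (int r) (- P)"
    and tame: "\<And>p. Factorial_Ring.prime p \<Longrightarrow> p > 2 \<Longrightarrow> p \<noteq> int r \<Longrightarrow> p \<noteq> P \<Longrightarrow> tame_at a0 b0 p"
  shows "legendre_cond (of_int a) (of_int b :: 'd quad_int)"
proof -
  interpret norm_euclidean "quad_nrm :: 'd quad_int \<Rightarrow> nat" by (rule quad_norm_euclidean)
  have twist: "x0 = x \<or> x0 = - P * x" if "of_int x0 = of_int x * u\<^sup>2" "u = 1 \<or> u = \<delta>" for x0 x u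
    using that(2)
  proof
    assume "u = 1"
    then have "(of_int x0 :: 'd quad_int) = of_int x" using that(1) by simp
    then show ?thesis unfolding quad_int_eq_iff quad_int_of_int_sel by blast
  next
    assume "u = \<delta>"
    then have "(of_int x0 :: 'd quad_int) = of_int (- P * x)" using that(1) \<delta> by (simp add: mult.commute)
    then show ?thesis unfolding quad_int_eq_iff quad_int_of_int_sel by blast
  qed
  have a0': "a0 = a \<or> a0 = - P * a" and b0': "b0 = b \<or> b0 = - P * b"
    using twist a0 b0 s t by blast+
  have com\<delta>: "comaximal (of_int p) u"
    if "Factorial_Ring.prime p" "p \<noteq> P" "u = 1 \<or> u = \<delta>" for p u
  proof -
    have "coprime p (- P)" using that P primes_coprime by auto
    then have "comaximal (of_int p) (\<delta> * \<delta>)"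
      using comaximal_of_int[of p "- P"] \<delta> by (metis power2_eq_square)
    moreover have "comaximal (of_int p) (1 :: 'd quad_int)"
      unfolding comaximal_def by (intro exI[of _ 0] exI[of _ 1]) simp
    ultimately show ?thesis using that(3) comaximal_dvd_right by (metis dvd_triv_left)
  qed
  have key: "square_mod (of_int n) (of_int p :: 'd quad_int)"
    if p: "Factorial_Ring.prime p" "p \<noteq> P" and n: "of_int n0 = of_int n * u\<^sup>2"
      and u: "comaximal (of_int p) u" and sq: "p > 2 \<Longrightarrow> p \<noteq> int r \<Longrightarrow> square_mod n0 p" for p n n0 and u :: "'d quad_int"
  proof -
    consider "p = 2" | "p = int r" | "p > 2" "p \<noteq> int r" using p(1) prime_ge_2_int[of p] by fastforce
    then show ?thesis
    proof cases
      case 1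
      then show ?thesis using square_mod_2 square_mod_of_int by blast
    next
      case 2
      then show ?thesis using square_mod_nonsplit[OF r(1,2) \<delta>] r(3) p(2) by blast
    next
      case 3
      then have "square_mod (of_int n0) (of_int p :: 'd quad_int)"
        using square_mod_of_int sq by blast
      then have "square_mod (of_int n * u\<^sup>2) (of_int p)" unfolding n .
      then show ?thesis using u square_mod_cancel by blast
    qed
  qed
  have nz: "a \<noteq> 0" "b \<noteq> 0" using sf by (metis not_squarefree_0)+
  define g where "g = gcd a b"
  obtain a' b' where ab: "a = g * a'" "b = g * b'" by (metis g_def dvdE gcd_dvd1 gcd_dvd2)
  have "g \<noteq> 0" using nz ab by auto
  then have cop: "coprime a' b'" using nz ab g_def by (metis gcd_coprime mult.commute mult_right_cancel)
  have sfc: "coprime x y" if "squarefree (x * y)" for x y :: int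
    using that unfolding squarefree_def
    by (intro coprimeI) (metis mult_dvd_mono power2_eq_square)
  have cga: "coprime g a'" and cgb: "coprime g b'" using sf ab sfc by auto
  have sf': "squarefree a'" "squarefree b'" "squarefree g"
    using sf ab squarefree_dvd by (metis dvd_triv_left dvd_triv_right)+
  have pP: "p \<noteq> P" if "p dvd a \<or> p dvd b" for p using that Pab by auto
  have dvd0: "p dvd a0 \<longleftrightarrow> p dvd a" "p dvd b0 \<longleftrightarrow> p dvd b"
    if "Factorial_Ring.prime p" "p \<noteq> P" for p
    using a0' b0' that P by (auto simp: prime_dvd_mult_iff primes_dvd_imp_eq)
  have nd: False if "Factorial_Ring.prime p" "p dvd x" "p dvd y" "coprime x y" for p x y :: int
    using that by (metis coprime_common_divisor not_prime_unit)
  have "square_mod (of_int a) (of_int b' :: 'd quad_int)"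
  proof (rule square_mod_squarefree[OF sf'(2)])
    fix p assume p: "Factorial_Ring.prime p" "p dvd b'"
    then have "\<not> p dvd a" using nd[OF p(1)] cop cgb p unfolding ab by (metis prime_dvd_mult_iff)
    moreover have pb: "p dvd b" using p ab by simp
    moreover from pb have "p \<noteq> P" using pP by blast
    ultimately have "p > 2 \<Longrightarrow> p \<noteq> int r \<Longrightarrow> square_mod a0 p"
      using tame[OF p(1)] dvd0[OF p(1)] unfolding tame_at_def by blast
    then show "square_mod (of_int a) (of_int p :: 'd quad_int)"
      using key[OF p(1) \<open>p \<noteq> P\<close> a0] com\<delta>[OF p(1) \<open>p \<noteq> P\<close> s] by blast
  qed
  moreover have "square_mod (of_int b) (of_int a' :: 'd quad_int)"
  proof (rule square_mod_squarefree[OF sf'(1)])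
    fix p assume p: "Factorial_Ring.prime p" "p dvd a'"
    then have "\<not> p dvd b" using nd[OF p(1)] cop cga p unfolding ab by (metis prime_dvd_mult_iff)
    moreover have pb: "p dvd a" using p ab by simp
    moreover from pb have "p \<noteq> P" using pP by blast
    ultimately have "p > 2 \<Longrightarrow> p \<noteq> int r \<Longrightarrow> square_mod b0 p"
      using tame[OF p(1)] dvd0[OF p(1)] unfolding tame_at_def by blast
    then show "square_mod (of_int b) (of_int p :: 'd quad_int)"
      using key[OF p(1) \<open>p \<noteq> P\<close> b0] com\<delta>[OF p(1) \<open>p \<noteq> P\<close> t] by blast
  qed
  moreover have "square_mod (of_int (- a' * b')) (of_int g :: 'd quad_int)"
  proof (rule square_mod_squarefree[OF sf'(3)])
    fix p assume p: "Factorial_Ring.prime p" "p dvd g"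
    then obtain h where h: "g = p * h" by blast
    have p0: "p \<noteq> 0" using p(1) by auto
    have pab: "p dvd a" "p dvd b" using p ab by simp_all
    then have "p \<noteq> P" using pP by blast
    have ph: "coprime p h" using sf'(3) h sfc by blast
    have tm: "p > 2 \<Longrightarrow> p \<noteq> int r \<Longrightarrow> square_mod (- (a0 div p) * (b0 div p)) p"
      using tame[OF p(1)] dvd0[OF p(1) \<open>p \<noteq> P\<close>] pab \<open>p \<noteq> P\<close> unfolding tame_at_def by blast
    have ad: "of_int (a0 div p) = of_int (h * a') * s\<^sup>2" "of_int (b0 div p) = of_int (h * b') * t\<^sup>2"
    proof -
      have *: "of_int (x0 div p) = of_int (h * x') * u\<^sup>2"
        if "of_int x0 = of_int (p * h * x') * u\<^sup>2" "p dvd x0" for x0 x' and u :: "'d quad_int"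
      proof -
        have "of_int p * of_int (x0 div p) = (of_int x0 :: 'd quad_int)"
          using that(2) by (metis dvd_mult_div_cancel of_int_mult)
        also have "\<dots> = of_int p * (of_int (h * x') * u\<^sup>2)" unfolding that(1) by (simp add: mult_ac)
        finally show ?thesis using p0 by (simp add: quad_int_eq_iff[of "of_int p"])
      qed
      show "of_int (a0 div p) = of_int (h * a') * s\<^sup>2" "of_int (b0 div p) = of_int (h * b') * t\<^sup>2"
        by (rule *; use a0 b0 ab h dvd0[OF p(1) \<open>p \<noteq> P\<close>] pab in simp)+
    qed
    have "of_int (- (a0 div p) * (b0 div p)) = of_int (- a' * b') * (of_int h * (s * t))\<^sup>2"
      unfolding of_int_mult of_int_minus ad by (simp add: power2_eq_square mult_ac)
    moreover have "comaximal (of_int p) (of_int h * (s * t))"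
      using com\<delta>[OF p(1) \<open>p \<noteq> P\<close>] s t comaximal_of_int[OF ph] by (intro comaximal_mult_right) auto
    ultimately show "square_mod (of_int (- a' * b')) (of_int p :: 'd quad_int)"
      using key[OF p(1) \<open>p \<noteq> P\<close>] tm by blast
  qed
  ultimately show ?thesis
    unfolding legendre_cond_def using comaximal_of_int[OF cop]
    by (intro exI[of _ "of_int g"] exI[of _ "of_int a'"] exI[of _ "of_int b'"]) (simp add: ab)
qed

lemma legendre_over_quadratic_field:
  fixes a0 b0 :: int and \<delta> :: "'d::quad_param quad_int"
  assumes dom: "legendre_domain (quad_nrm :: 'd quad_int \<Rightarrow> nat)"
    and sf: "squarefree a0" "squarefree b0" and P: "Factorial_Ring.prime P" and \<delta>: "\<delta>\<^sup>2 = of_int (- P)"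
    and PE: "\<And>p. Factorial_Ring.prime p \<Longrightarrow> p dvd 4 * qnm TYPE('d) - qtr TYPE('d) \<Longrightarrow> p = P"
    and r: "Factorial_Ring.prime r" "r > 2" "int r = P \<or> \<not> QuadRes (int r) (- P)"
    and tame: "\<And>p. Factorial_Ring.prime p \<Longrightarrow> p > 2 \<Longrightarrow> p \<noteq> int r \<Longrightarrow> p \<noteq> P \<Longrightarrow> tame_at a0 b0 p"
  shows "conic_isotropic (of_int a0) (of_int b0 :: 'd quad_int)"
proof -
  \<comment> \<open>A factor \<open>P\<close> equals \<open>- (\<delta>^2)\<close> and is absorbed
    into a square; what remains is prime to \<open>P\<close> and stays squarefree in the quadratic
    ring.\<close>
  have split: "\<exists>a s. of_int a0 = of_int a * s\<^sup>2 \<and> squarefree a \<and> \<not> P dvd a \<and> (s = 1 \<or> s = \<delta>)"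
    if "squarefree a0" for a0 :: int
  proof (cases "P dvd a0")
    case True
    then obtain a where a: "a0 = P * a" by blast
    have "squarefree (- a)" using that a squarefree_dvd by (metis dvd_triv_right dvd_minus_iff minus_dvd_iff)
    moreover have "\<not> P dvd a" using that P unfolding a squarefree_def
      by (metis not_prime_unit power2_eq_square mult_dvd_mono dvd_refl)
    moreover have "of_int a0 = of_int (- a) * \<delta>\<^sup>2" by (simp add: a \<delta>)
    ultimately show ?thesis by (metis dvd_minus_iff)
  next
    case False
    then show ?thesis using that by (intro exI[of _ a0] exI[of _ 1]) simp
  qed
  obtain a s where a: "of_int a0 = of_int a * s\<^sup>2" "squarefree a" "\<not> P dvd a" "s = 1 \<or> s = \<delta>"
    using split[OF sf(1)] by blast
  obtain b t where b: "of_int b0 = of_int b * t\<^sup>2" "squarefree b" "\<not> P dvd b" "t = 1 \<or> t = \<delta>"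
    using split[OF sf(2)] by blast
  interpret legendre_domain "quad_nrm :: 'd quad_int \<Rightarrow> nat" by (rule dom)
  have nz: "x \<noteq> 0" if "squarefree x" for x :: int using that by (metis not_squarefree_0)
  have sfq: "squarefree (of_int x :: 'd quad_int)" if "squarefree x" "\<not> P dvd x" for x
    using that PE by (intro squarefree_quad_of_int) auto
  have "conic_isotropic (of_int a) (of_int b :: 'd quad_int)"
    using a b nz sfq tame_at_imp_legendre_cond[OF a(2) b(2) P \<delta> PE a(3) b(3) a(4) b(4) a(1) b(1) r tame]
    by (intro legendre) (simp_all add: quad_int_eq_iff)
  moreover have "\<delta> \<noteq> 0"
  proof
    assume "\<delta> = 0"
    then have "(of_int (- P) :: 'd quad_int) = 0" using \<delta> by simp
    then have "P = 0" by (simp add: quad_int_eq_iff)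
    then show False using P by simp
  qed
  then have "s \<noteq> 0" "t \<noteq> 0" using a(4) b(4) by auto
  ultimately show ?thesis unfolding a(1) b(1) by (rule conic_isotropic_scale)
qed

section \<open>The p-adic absolute value\<close>

lemma rat_as_fraction:
  obtains a m where "(x :: rat) = of_int a / of_int m" "m \<noteq> 0"
  using quotient_of_div[of x] quotient_of_denom_pos[of x] by (metis less_irrefl surj_pair)

context
  fixes p :: nat
  assumes p: "Factorial_Ring.prime p"
begin

lemma prime_int_p: "Factorial_Ring.prime (int p)" using p by simp

lemma padic_base_gt_1: "real p > 1" using prime_gt_1_nat[OF p] by simp

text \<open>Expanding a fraction does not change the difference of multiplicities, so lowest terms
  can be forgotten from here on.\<close>

lemma padic_abs_divide_int:
  assumes "a \<noteq> 0" "m \<noteq> 0"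
  shows "padic_abs p (of_int a / of_int m) =
    real p powi (int (multiplicity (int p) m) - int (multiplicity (int p) a))"
proof -
  obtain n d where q: "quotient_of (of_int a / of_int m) = (n, d)" by (metis surj_pair)
  have d: "d > 0" by (rule quotient_of_denom_pos[OF q])
  have e: "(of_int a / of_int m :: rat) = of_int n / of_int d" by (rule quotient_of_div[OF q])
  then have "(of_int (a * d) :: rat) = of_int (n * m)" using d assms by (simp add: field_simps)
  then have ad: "a * d = n * m" by (simp only: of_int_eq_iff)
  then have n: "n \<noteq> 0" using assms d by auto
  have pe: "prime_elem (int p)" using prime_int_p by blast
  have "multiplicity (int p) (a * d) = multiplicity (int p) (n * m)" using ad by simp
  then have "multiplicity (int p) a + multiplicity (int p) d = multiplicity (int p) n + multiplicity (int p) m"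
    using assms d n by (simp add: prime_elem_multiplicity_mult_distrib[OF pe])
  then have "int (multiplicity (int p) d) - int (multiplicity (int p) n)
      = int (multiplicity (int p) m) - int (multiplicity (int p) a)" by linarith
  then show ?thesis using assms by (simp add: padic_abs_def q)
qed

lemma padic_abs_0 [simp]: "padic_abs p 0 = 0"
  by (simp add: padic_abs_def)

lemma padic_abs_pos: "x \<noteq> 0 \<Longrightarrow> padic_abs p x > 0"
  using padic_base_gt_1 by (simp add: padic_abs_def)

lemma padic_abs_nonneg [simp]: "padic_abs p x \<ge> 0"
  using padic_abs_pos[of x] by (cases "x = 0") auto

lemma padic_abs_mult: "padic_abs p (x * y) = padic_abs p x * padic_abs p y"
proof (cases "x = 0 \<or> y = 0")
  case False
  obtain a m where x: "x = of_int a / of_int m" "m \<noteq> 0" by (rule rat_as_fraction)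
  obtain b k where y: "y = of_int b / of_int k" "k \<noteq> 0" by (rule rat_as_fraction)
  have nz: "a \<noteq> 0" "b \<noteq> 0" using False x y by auto
  have xy: "x * y = of_int (a * b) / of_int (m * k)" by (simp add: x y)
  have pe: "prime_elem (int p)" using prime_int_p by blast
  show ?thesis unfolding xy unfolding x(1) y(1)
    using nz x(2) y(2) padic_base_gt_1
    by (subst (1 2 3) padic_abs_divide_int)
      (simp_all add: prime_elem_multiplicity_mult_distrib[OF pe] power_int_add[symmetric] algebra_simps)
qed auto

lemma padic_abs_1 [simp]: "padic_abs p 1 = 1"
  using padic_abs_mult[of 1 1] padic_abs_pos[of 1] by simp

lemma padic_abs_minus [simp]: "padic_abs p (- x) = padic_abs p x"
proof -
  have "(padic_abs p (- 1))\<^sup>2 = 1"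
    using padic_abs_mult[of "- 1" "- 1"] by (simp add: power2_eq_square)
  then have "padic_abs p (- 1) = 1" using padic_abs_nonneg[of "- 1"] by (auto simp: power2_eq_1_iff)
  then show ?thesis using padic_abs_mult[of "- 1" x] by simp
qed

text \<open>Over a fixed denominator a ball around 0 is a divisibility condition on numerators; the
  ultrametric inequality then becomes closure of divisibility under addition.\<close>

lemma padic_abs_le_iff:
  assumes "m \<noteq> 0"
  shows "padic_abs p (of_int a / of_int m) \<le> real p powi (int (multiplicity (int p) m) - int k)
    \<longleftrightarrow> int p ^ k dvd a"
proof (cases "a = 0")
  case False
  have nu: "\<not> is_unit (int p)" using prime_int_p not_prime_unit by blast
  have "int p ^ k dvd a \<longleftrightarrow> k \<le> multiplicity (int p) a"
    using False nu by (simp add: power_dvd_iff_le_multiplicity)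
  moreover have "real p powi i \<le> real p powi j \<longleftrightarrow> i \<le> j" for i j
    using power_int_strict_increasing[of j i "real p"] power_int_increasing[of i j "real p"]
      padic_base_gt_1 by (meson less_le not_le)
  ultimately show ?thesis
    using False assms by (simp add: padic_abs_divide_int)
qed (use padic_base_gt_1 in simp)

lemma padic_abs_int_le_iff: "padic_abs p (of_int a) \<le> 1 / real p ^ k \<longleftrightarrow> int p ^ k dvd a"
  using padic_abs_le_iff[of 1 a k] by (simp add: power_int_minus divide_inverse)

lemma padic_abs_int_le_1: "padic_abs p (of_int a) \<le> 1"
  using padic_abs_int_le_iff[of a 0] by simp

lemma padic_abs_add: "padic_abs p (x + y) \<le> max (padic_abs p x) (padic_abs p y)"
proof -
  have *: "padic_abs p (x + y) \<le> padic_abs p x" if le: "padic_abs p y \<le> padic_abs p x" for x y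
  proof (cases "x = 0")
    case True
    then show ?thesis using le padic_abs_nonneg[of y] by simp
  next
    case False
    obtain a m where x: "x = of_int a / of_int m" "m \<noteq> 0" by (rule rat_as_fraction)
    obtain b n where y: "y = of_int b / of_int n" "n \<noteq> 0" by (rule rat_as_fraction)
    define k where "k = multiplicity (int p) (a * n)"
    have mn: "m * n \<noteq> 0" and an: "a * n \<noteq> 0" using x y False by auto
    have x': "x = of_int (a * n) / of_int (m * n)" and y': "y = of_int (b * m) / of_int (m * n)"
      and xy: "x + y = of_int (a * n + b * m) / of_int (m * n)" using x y by (simp_all add: field_simps)
    have ax: "padic_abs p x = real p powi (int (multiplicity (int p) (m * n)) - int k)"
      unfolding x' k_def by (rule padic_abs_divide_int[OF an mn])
    have "int p ^ k dvd a * n" unfolding k_def by (rule multiplicity_dvd)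
    moreover have "int p ^ k dvd b * m"
      using le unfolding ax unfolding y' padic_abs_le_iff[OF mn] .
    ultimately show ?thesis
      unfolding ax unfolding xy padic_abs_le_iff[OF mn] by (rule dvd_add)
  qed
  show ?thesis using *[of x y] *[of y x] by (cases "padic_abs p y \<le> padic_abs p x") (auto simp: add.commute)
qed

lemma padic_abs_add_le: "padic_abs p x \<le> e \<Longrightarrow> padic_abs p y \<le> e \<Longrightarrow> padic_abs p (x + y) \<le> e"
  using padic_abs_add[of x y] by simp

lemma padic_abs_add_less: "padic_abs p x < e \<Longrightarrow> padic_abs p y < e \<Longrightarrow> padic_abs p (x + y) < e"
  using padic_abs_add[of x y] by simp

lemma padic_abs_diff_less: "padic_abs p x < e \<Longrightarrow> padic_abs p y < e \<Longrightarrow> padic_abs p (x - y) < e"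
  using padic_abs_add_less[of x e "- y"] by simp

lemma padic_null_iff: "x \<in> padic_null p \<longleftrightarrow> (\<forall>e>0. \<exists>N. \<forall>n\<ge>N. padic_abs p (x n) < e)"
  by (simp add: padic_null_def LIMSEQ_iff)

lemma padic_null_subset_Cauchy: "padic_null p \<subseteq> padic_Cauchy p"
proof
  fix x assume x: "x \<in> padic_null p"
  show "x \<in> padic_Cauchy p" unfolding padic_Cauchy_def
  proof safe
    fix e :: real assume "e > 0"
    then obtain N where "\<forall>n\<ge>N. padic_abs p (x n) < e" using x padic_null_iff by blast
    then show "\<exists>N. \<forall>m\<ge>N. \<forall>n\<ge>N. padic_abs p (x m - x n) < e" using padic_abs_diff_less by blast
  qed
qed

lemma padic_CauchyD:
  assumes "x \<in> padic_Cauchy p" "e > 0"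
  obtains N where "\<And>m n. m \<ge> N \<Longrightarrow> n \<ge> N \<Longrightarrow> padic_abs p (x m - x n) < e"
  using assms unfolding padic_Cauchy_def by blast

lemma padic_Cauchy_const: "(\<lambda>_. c) \<in> padic_Cauchy p"
  by (simp add: padic_Cauchy_def)

lemma padic_Cauchy_add:
  assumes "x \<in> padic_Cauchy p" "y \<in> padic_Cauchy p"
  shows "(\<lambda>n. x n + y n) \<in> padic_Cauchy p"
  unfolding padic_Cauchy_def
proof safe
  fix e :: real assume e: "e > 0"
  obtain N where N: "\<And>m n. m \<ge> N \<Longrightarrow> n \<ge> N \<Longrightarrow> padic_abs p (x m - x n) < e"
    using padic_CauchyD[OF assms(1) e] by blast
  obtain M where M: "\<And>m n. m \<ge> M \<Longrightarrow> n \<ge> M \<Longrightarrow> padic_abs p (y m - y n) < e"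
    using padic_CauchyD[OF assms(2) e] by blast
  have "padic_abs p ((x m + y m) - (x n + y n)) < e" if "m \<ge> max N M" "n \<ge> max N M" for m n
    using padic_abs_add_less[OF N[of m n] M[of m n]] that by (simp add: algebra_simps)
  then show "\<exists>N. \<forall>m\<ge>N. \<forall>n\<ge>N. padic_abs p (x m + y m - (x n + y n)) < e" by blast
qed

lemma padic_Cauchy_bounded:
  assumes "x \<in> padic_Cauchy p"
  obtains K where "K > 0" "\<And>n. padic_abs p (x n) \<le> K"
proof -
  obtain N where N: "\<And>m n. m \<ge> N \<Longrightarrow> n \<ge> N \<Longrightarrow> padic_abs p (x m - x n) < 1"
    using padic_CauchyD[OF assms, of 1] by auto
  define K where "K = Max (insert 1 ((\<lambda>n. padic_abs p (x n)) ` {..N}))"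
  have K: "c \<le> K" if "c \<in> insert 1 ((\<lambda>n. padic_abs p (x n)) ` {..N})" for c
    unfolding K_def using that by (intro Max_ge) auto
  have K1: "1 \<le> K" using K by blast
  have "padic_abs p (x n) \<le> K" for n
  proof (cases "n \<le> N")
    case False
    have "padic_abs p (x N) \<le> K" using K by auto
    moreover have "padic_abs p (x n - x N) \<le> K" using N[of n N] False K1 by simp
    ultimately show ?thesis using padic_abs_add_le[of "x n - x N" K "x N"] by simp
  qed (use K in auto)
  with K1 show ?thesis by (intro that[of K]) auto
qed

lemma padic_Cauchy_mult:
  assumes "x \<in> padic_Cauchy p" "y \<in> padic_Cauchy p"
  shows "(\<lambda>n. x n * y n) \<in> padic_Cauchy p"
  unfolding padic_Cauchy_def
proof safe
  fix e :: real assume e: "e > 0"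
  obtain K where K: "K > 0" "\<And>n. padic_abs p (x n) \<le> K" using padic_Cauchy_bounded assms by blast
  obtain L where L: "L > 0" "\<And>n. padic_abs p (y n) \<le> L" using padic_Cauchy_bounded assms by blast
  obtain N where N: "\<And>m n. m \<ge> N \<Longrightarrow> n \<ge> N \<Longrightarrow> padic_abs p (x m - x n) < e / L"
    using padic_CauchyD[OF assms(1), of "e / L"] e L by auto
  obtain M where M: "\<And>m n. m \<ge> M \<Longrightarrow> n \<ge> M \<Longrightarrow> padic_abs p (y m - y n) < e / K"
    using padic_CauchyD[OF assms(2), of "e / K"] e K by auto
  have "padic_abs p (x m * y m - x n * y n) < e" if "m \<ge> max N M" "n \<ge> max N M" for m n
  proof -
    have "padic_abs p ((x m - x n) * y m) \<le> padic_abs p (x m - x n) * L"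
      unfolding padic_abs_mult by (intro mult_left_mono L) simp
    also have "\<dots> < e / L * L" using N[of m n] that L by (intro mult_strict_right_mono) auto
    finally have 1: "padic_abs p ((x m - x n) * y m) < e" using L by simp
    have "padic_abs p (x n * (y m - y n)) \<le> K * padic_abs p (y m - y n)"
      unfolding padic_abs_mult by (intro mult_right_mono K) simp
    also have "\<dots> < K * (e / K)" using M[of m n] that K by (intro mult_strict_left_mono) auto
    finally have "padic_abs p (x n * (y m - y n)) < e" using K by simp
    with 1 show ?thesis using padic_abs_add_less[of "(x m - x n) * y m" e "x n * (y m - y n)"]
      by (simp add: algebra_simps)
  qed
  then show "\<exists>N. \<forall>m\<ge>N. \<forall>n\<ge>N. padic_abs p (x m * y m - x n * y n) < e" by blast
qed

lemma padic_null_add: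
  assumes "x \<in> padic_null p" "y \<in> padic_null p"
  shows "(\<lambda>n. x n + y n) \<in> padic_null p"
  unfolding padic_null_iff
proof safe
  fix e :: real assume e: "e > 0"
  obtain N M where "\<forall>n\<ge>N. padic_abs p (x n) < e" "\<forall>n\<ge>M. padic_abs p (y n) < e"
    using assms e unfolding padic_null_iff by meson
  then have "\<forall>n\<ge>max N M. padic_abs p (x n + y n) < e" using padic_abs_add_less by auto
  then show "\<exists>N. \<forall>n\<ge>N. padic_abs p (x n + y n) < e" by blast
qed

lemma padic_null_mult:
  assumes "x \<in> padic_Cauchy p" "y \<in> padic_null p"
  shows "(\<lambda>n. x n * y n) \<in> padic_null p"
  unfolding padic_null_iff
proof safe
  fix e :: real assume e: "e > 0"
  obtain K where K: "K > 0" "\<And>n. padic_abs p (x n) \<le> K" using padic_Cauchy_bounded assms by blast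
  obtain N where N: "\<forall>n\<ge>N. padic_abs p (y n) < e / K"
    using assms(2) e K unfolding padic_null_iff by (meson divide_pos_pos)
  have "padic_abs p (x n * y n) < e" if "n \<ge> N" for n
  proof -
    have "padic_abs p (x n * y n) \<le> K * padic_abs p (y n)"
      unfolding padic_abs_mult by (intro mult_right_mono K) simp
    also have "\<dots> < K * (e / K)" using N that K by (intro mult_strict_left_mono) auto
    finally show ?thesis using K by simp
  qed
  then show "\<exists>N. \<forall>n\<ge>N. padic_abs p (x n * y n) < e" by blast
qed

lemma padic_Cauchy_minus: "x \<in> padic_Cauchy p \<Longrightarrow> (\<lambda>n. - x n) \<in> padic_Cauchy p"
  using padic_Cauchy_mult[OF padic_Cauchy_const[of "- 1"], of x] by simp

lemma padic_null_minus: "x \<in> padic_null p \<Longrightarrow> (\<lambda>n. - x n) \<in> padic_null p"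
  by (simp add: padic_null_iff)

lemma padic_Cauchy_not_null:
  assumes "x \<in> padic_Cauchy p" "x \<notin> padic_null p"
  obtains c N where "c > 0" "\<And>n. n \<ge> N \<Longrightarrow> padic_abs p (x n) \<ge> c"
proof -
  obtain e where e: "e > 0" "\<And>N. \<exists>n\<ge>N. padic_abs p (x n) \<ge> e"
    using assms(2) unfolding padic_null_iff by (meson not_le)
  obtain N where N: "\<And>m n. m \<ge> N \<Longrightarrow> n \<ge> N \<Longrightarrow> padic_abs p (x m - x n) < e"
    using padic_CauchyD[OF assms(1) e(1)] by blast
  have "padic_abs p (x n) \<ge> e" if "n \<ge> N" for n
  proof (rule ccontr)
    assume "\<not> ?thesis"
    moreover obtain m where m: "m \<ge> N" "padic_abs p (x m) \<ge> e" using e(2) by blast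
    ultimately have "padic_abs p ((x m - x n) + x n) < e"
      using N[of m n] that by (intro padic_abs_add_less) auto
    then show False using m by simp
  qed
  then show ?thesis using e(1) that by blast
qed

lemma padic_Cauchy_inverse:
  assumes x: "x \<in> padic_Cauchy p" "x \<notin> padic_null p"
  shows "(\<lambda>n. inverse (x n)) \<in> padic_Cauchy p" and "(\<lambda>n. x n * inverse (x n) - 1) \<in> padic_null p"
proof -
  obtain c N where c: "c > 0" "\<And>n. n \<ge> N \<Longrightarrow> padic_abs p (x n) \<ge> c"
    using padic_Cauchy_not_null[OF x] by blast
  \<comment> \<open>Finitely many terms may vanish; \<open>inverse\<close> sends them to 0, which
    does not affect the tail.\<close>
  have nz: "x n \<noteq> 0" if "n \<ge> N" for n using c(2)[OF that] c(1) by auto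
  show "(\<lambda>n. inverse (x n)) \<in> padic_Cauchy p" unfolding padic_Cauchy_def
  proof safe
    fix e :: real assume e: "e > 0"
    obtain M where M: "\<And>m n. m \<ge> M \<Longrightarrow> n \<ge> M \<Longrightarrow> padic_abs p (x m - x n) < e * (c * c)"
      using padic_CauchyD[OF x(1), of "e * (c * c)"] e c by auto
    have "padic_abs p (inverse (x m) - inverse (x n)) < e" if "m \<ge> max N M" "n \<ge> max N M" for m n
    proof -
      have nz': "x m \<noteq> 0" "x n \<noteq> 0" using nz that by auto
      have "(inverse (x m) - inverse (x n)) * (x m * x n) = x n - x m"
        using nz' by (simp add: field_simps)
      then have "padic_abs p (inverse (x m) - inverse (x n)) * (padic_abs p (x m) * padic_abs p (x n))
          = padic_abs p (x n - x m)" by (metis padic_abs_mult)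
      also have "\<dots> < e * (c * c)" using M[of n m] that by simp
      also have "\<dots> \<le> e * (padic_abs p (x m) * padic_abs p (x n))"
        using c that e by (intro mult_left_mono mult_mono) auto
      finally show ?thesis
        using padic_abs_pos[OF nz'(1)] padic_abs_pos[OF nz'(2)] by (simp add: mult_less_cancel_right)
    qed
    then show "\<exists>N. \<forall>m\<ge>N. \<forall>n\<ge>N. padic_abs p (inverse (x m) - inverse (x n)) < e" by blast
  qed
  show "(\<lambda>n. x n * inverse (x n) - 1) \<in> padic_null p"
    unfolding padic_null_iff using nz by (metis padic_abs_0 diff_self right_inverse)
qed

end

section \<open>Quaternion algebras over the p-adic numbers\<close>

text \<open>The polynomial identities behind the ring axioms are proved for the ring of Cauchy sequences, where
  the operations are those of a type class, and carried over to the quotient \<open>\<rat>\<^sub>p\<close>.\<close>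

context
  fixes p :: nat
  assumes p: "Factorial_Ring.prime p"
begin

definition padic_class :: "(nat \<Rightarrow> rat) \<Rightarrow> (nat \<Rightarrow> rat) set" where
  "padic_class x = padic_null p +>\<^bsub>padic_Cauchy_ring p\<^esub> x"

lemma padic_Cauchy_ring_simps:
  "carrier (padic_Cauchy_ring p) = padic_Cauchy p"
  "x \<otimes>\<^bsub>padic_Cauchy_ring p\<^esub> y = x * y" "x \<oplus>\<^bsub>padic_Cauchy_ring p\<^esub> y = x + y"
  "\<one>\<^bsub>padic_Cauchy_ring p\<^esub> = 1" "\<zero>\<^bsub>padic_Cauchy_ring p\<^esub> = 0"
  by (simp_all add: padic_Cauchy_ring_def fun_eq_iff)

lemma padic_Cauchy_closed [simp]:
  "0 \<in> padic_Cauchy p" "1 \<in> padic_Cauchy p" "(\<lambda>_. c) \<in> padic_Cauchy p"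
  "x \<in> padic_Cauchy p \<Longrightarrow> y \<in> padic_Cauchy p \<Longrightarrow> x + y \<in> padic_Cauchy p"
  "x \<in> padic_Cauchy p \<Longrightarrow> y \<in> padic_Cauchy p \<Longrightarrow> x - y \<in> padic_Cauchy p"
  "x \<in> padic_Cauchy p \<Longrightarrow> - x \<in> padic_Cauchy p"
  "x \<in> padic_Cauchy p \<Longrightarrow> y \<in> padic_Cauchy p \<Longrightarrow> x * y \<in> padic_Cauchy p"
  using padic_Cauchy_const[OF p] padic_Cauchy_add[OF p, of x y] padic_Cauchy_mult[OF p, of x y]
    padic_Cauchy_minus[OF p, of x] padic_Cauchy_add[OF p, of x "- y"] padic_Cauchy_minus[OF p, of y]
  by (simp_all add: plus_fun_def times_fun_def fun_Compl_def zero_fun_def one_fun_def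
      fun_diff_def)

lemma padic_Cauchy_ring_cring: "cring (padic_Cauchy_ring p)"
proof (rule cringI)
  show "abelian_group (padic_Cauchy_ring p)"
  proof (rule abelian_groupI)
    fix x assume "x \<in> carrier (padic_Cauchy_ring p)"
    then show "\<exists>y\<in>carrier (padic_Cauchy_ring p). y \<oplus>\<^bsub>padic_Cauchy_ring p\<^esub> x = \<zero>\<^bsub>padic_Cauchy_ring p\<^esub>"
      by (intro bexI[of _ "- x"]) (simp_all add: padic_Cauchy_ring_simps)
  qed (simp_all add: padic_Cauchy_ring_simps algebra_simps)
  show "Group.comm_monoid (padic_Cauchy_ring p)"
    by (rule comm_monoidI) (simp_all add: padic_Cauchy_ring_simps algebra_simps)
qed (simp_all add: padic_Cauchy_ring_simps algebra_simps)

lemma padic_null_ideal: "ideal (padic_null p) (padic_Cauchy_ring p)"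
proof -
  interpret R: cring "padic_Cauchy_ring p" by (rule padic_Cauchy_ring_cring)
  have sub: "x \<in> padic_Cauchy p" if "x \<in> padic_null p" for x
    using padic_null_subset_Cauchy[OF p] that by blast
  show ?thesis
  proof (rule idealI)
    show "subgroup (padic_null p) (add_monoid (padic_Cauchy_ring p))"
    proof (rule R.add.subgroupI)
      have "(0 :: nat \<Rightarrow> rat) \<in> padic_null p"
        unfolding padic_null_iff[OF p] by (simp add: padic_abs_0[OF p])
      then show "padic_null p \<noteq> {}" by blast
      fix x assume x: "x \<in> padic_null p"
      have "\<ominus>\<^bsub>padic_Cauchy_ring p\<^esub> x = - x"
        by (rule R.minus_equality) (use sub[OF x] in \<open>simp_all add: padic_Cauchy_ring_simps\<close>)
      then show "\<ominus>\<^bsub>padic_Cauchy_ring p\<^esub> x \<in> padic_null p"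
        using padic_null_minus[OF p x] by (simp add: fun_Compl_def)
    next
      fix x y assume "x \<in> padic_null p" "y \<in> padic_null p"
      then show "x \<oplus>\<^bsub>padic_Cauchy_ring p\<^esub> y \<in> padic_null p"
        using padic_null_add[OF p] by (simp add: padic_Cauchy_ring_def)
    qed (use sub in \<open>auto simp: padic_Cauchy_ring_simps\<close>)
  next
    fix x y assume "x \<in> padic_null p" "y \<in> carrier (padic_Cauchy_ring p)"
    then show "y \<otimes>\<^bsub>padic_Cauchy_ring p\<^esub> x \<in> padic_null p" "x \<otimes>\<^bsub>padic_Cauchy_ring p\<^esub> y \<in> padic_null p"
      using padic_null_mult[OF p, of y x]
      by (simp_all add: padic_Cauchy_ring_def mult.commute[of "x _"])
  qed (rule R.ring_axioms)
qed

lemma padic_field_cring: "cring (padic_field p)"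
  unfolding padic_field_def by (rule ideal.quotient_is_cring[OF padic_null_ideal padic_Cauchy_ring_cring])

lemma padic_field_carrier: "carrier (padic_field p) = padic_class ` padic_Cauchy p"
  by (auto simp: padic_field_def FactRing_def A_RCOSETS_def' padic_class_def padic_Cauchy_ring_simps)

lemma padic_class_closed [simp]: "x \<in> padic_Cauchy p \<Longrightarrow> padic_class x \<in> carrier (padic_field p)"
  by (auto simp: padic_field_carrier)

lemma padic_class_add [simp]: "x \<in> padic_Cauchy p \<Longrightarrow> y \<in> padic_Cauchy p \<Longrightarrow>
    padic_class x \<oplus>\<^bsub>padic_field p\<^esub> padic_class y = padic_class (x + y)"
  and padic_class_mult [simp]: "x \<in> padic_Cauchy p \<Longrightarrow> y \<in> padic_Cauchy p \<Longrightarrow>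
    padic_class x \<otimes>\<^bsub>padic_field p\<^esub> padic_class y = padic_class (x * y)"
  and padic_class_one: "\<one>\<^bsub>padic_field p\<^esub> = padic_class 1"
  and padic_class_zero: "\<zero>\<^bsub>padic_field p\<^esub> = padic_class 0"
proof -
  interpret I: ideal "padic_null p" "padic_Cauchy_ring p" by (rule padic_null_ideal)
  show "x \<in> padic_Cauchy p \<Longrightarrow> y \<in> padic_Cauchy p \<Longrightarrow>
    padic_class x \<oplus>\<^bsub>padic_field p\<^esub> padic_class y = padic_class (x + y)"
    using I.a_rcos_sum[of x y] by (simp add: padic_field_def FactRing_def padic_class_def padic_Cauchy_ring_simps)
  show "x \<in> padic_Cauchy p \<Longrightarrow> y \<in> padic_Cauchy p \<Longrightarrow>
    padic_class x \<otimes>\<^bsub>padic_field p\<^esub> padic_class y = padic_class (x * y)"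
    using I.rcoset_mult_add[of x y] by (simp add: padic_field_def FactRing_def padic_class_def padic_Cauchy_ring_simps)
  show "\<one>\<^bsub>padic_field p\<^esub> = padic_class 1"
    by (simp add: padic_field_def FactRing_def padic_class_def padic_Cauchy_ring_simps)
  have "padic_class \<zero>\<^bsub>padic_Cauchy_ring p\<^esub> = padic_null p"
    unfolding padic_class_def by (rule I.a_rcos_const) (simp add: I.additive_subgroup_axioms additive_subgroup.zero_closed)
  then show "\<zero>\<^bsub>padic_field p\<^esub> = padic_class 0"
    by (simp add: padic_field_def FactRing_def padic_Cauchy_ring_simps)
qed

lemma padic_class_eq_zero_iff:
  assumes "x \<in> padic_Cauchy p"
  shows "padic_class x = \<zero>\<^bsub>padic_field p\<^esub> \<longleftrightarrow> x \<in> padic_null p"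
proof -
  interpret I: ideal "padic_null p" "padic_Cauchy_ring p" by (rule padic_null_ideal)
  have z: "\<zero>\<^bsub>padic_field p\<^esub> = padic_null p" by (simp add: padic_field_def FactRing_def)
  show ?thesis unfolding z padic_class_def
    using assms I.a_rcos_const I.a_rcos_self[of x] by (auto simp: padic_Cauchy_ring_simps)
qed

lemma padic_class_minus [simp]:
  assumes "x \<in> padic_Cauchy p"
  shows "\<ominus>\<^bsub>padic_field p\<^esub> padic_class x = padic_class (- x)"
proof -
  interpret Q: cring "padic_field p" by (rule padic_field_cring)
  show ?thesis using assms by (intro Q.minus_equality) (simp_all add: padic_class_zero)
qed

lemma padic_class_diff [simp]: "x \<in> padic_Cauchy p \<Longrightarrow> y \<in> padic_Cauchy p \<Longrightarrow>
    padic_class x \<ominus>\<^bsub>padic_field p\<^esub> padic_class y = padic_class (x - y)"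
  by (simp add: a_minus_def)

lemma padic_of_rat_eq: "padic_of_rat p c = padic_class (\<lambda>_. c)"
  by (simp add: padic_of_rat_def padic_class_def)

lemma padic_class_1_neq_0: "padic_class 1 \<noteq> \<zero>\<^bsub>padic_field p\<^esub>"
proof
  assume "padic_class 1 = \<zero>\<^bsub>padic_field p\<^esub>"
  then have "(1 :: nat \<Rightarrow> rat) \<in> padic_null p"
    unfolding padic_class_eq_zero_iff[OF padic_Cauchy_closed(2)] .
  then obtain N :: nat where "\<forall>n\<ge>N. padic_abs p ((1 :: nat \<Rightarrow> rat) n) < 1"
    unfolding padic_null_iff[OF p] by (meson zero_less_one)
  then show False by (auto simp: padic_abs_1[OF p])
qed

abbreviation quat_alg_padic where
  "quat_alg_padic a b \<equiv> quat_alg (padic_field p) (padic_of_rat p a) (padic_of_rat p b)"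

lemma quat_alg_padic_carrier_cases:
  assumes "x \<in> carrier (quat_alg_padic a b)"
  obtains x0 x1 x2 x3 where "x = (padic_class x0, padic_class x1, padic_class x2, padic_class x3)"
    "x0 \<in> padic_Cauchy p" "x1 \<in> padic_Cauchy p" "x2 \<in> padic_Cauchy p" "x3 \<in> padic_Cauchy p"
  using assms by (auto simp: quat_alg_def padic_field_carrier)

lemma quat_alg_padic_ring: "ring (quat_alg_padic a b)"
proof (rule ringI)
  show "abelian_group (quat_alg_padic a b)"
  proof (rule abelian_groupI)
    fix x assume "x \<in> carrier (quat_alg_padic a b)"
    then obtain x0 x1 x2 x3 where x: "x = (padic_class x0, padic_class x1, padic_class x2, padic_class x3)"
      "x0 \<in> padic_Cauchy p" "x1 \<in> padic_Cauchy p" "x2 \<in> padic_Cauchy p" "x3 \<in> padic_Cauchy p"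
      by (rule quat_alg_padic_carrier_cases)
    then show "\<exists>y\<in>carrier (quat_alg_padic a b). y \<oplus>\<^bsub>quat_alg_padic a b\<^esub> x = \<zero>\<^bsub>quat_alg_padic a b\<^esub>"
      by (intro bexI[of _ "(padic_class (- x0), padic_class (- x1), padic_class (- x2), padic_class (- x3))"])
        (simp_all add: quat_alg_def padic_class_zero)
  next
    fix x y assume "x \<in> carrier (quat_alg_padic a b)" "y \<in> carrier (quat_alg_padic a b)"
    then show "x \<oplus>\<^bsub>quat_alg_padic a b\<^esub> y \<in> carrier (quat_alg_padic a b)"
      "x \<oplus>\<^bsub>quat_alg_padic a b\<^esub> y = y \<oplus>\<^bsub>quat_alg_padic a b\<^esub> x"
      by (elim quat_alg_padic_carrier_cases; simp add: quat_alg_def add.commute)+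
  next
    fix x y z assume "x \<in> carrier (quat_alg_padic a b)" "y \<in> carrier (quat_alg_padic a b)"
      "z \<in> carrier (quat_alg_padic a b)"
    then show "x \<oplus>\<^bsub>quat_alg_padic a b\<^esub> y \<oplus>\<^bsub>quat_alg_padic a b\<^esub> z
        = x \<oplus>\<^bsub>quat_alg_padic a b\<^esub> (y \<oplus>\<^bsub>quat_alg_padic a b\<^esub> z)"
      by (elim quat_alg_padic_carrier_cases; simp add: quat_alg_def add.assoc)
  next
    show "\<zero>\<^bsub>quat_alg_padic a b\<^esub> \<in> carrier (quat_alg_padic a b)"
      by (simp add: quat_alg_def padic_class_zero)
    fix x assume "x \<in> carrier (quat_alg_padic a b)"
    then show "\<zero>\<^bsub>quat_alg_padic a b\<^esub> \<oplus>\<^bsub>quat_alg_padic a b\<^esub> x = x"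
      by (elim quat_alg_padic_carrier_cases; simp add: quat_alg_def padic_class_zero)
  qed
  show "monoid (quat_alg_padic a b)"
  proof (rule monoidI)
    fix x y assume "x \<in> carrier (quat_alg_padic a b)" "y \<in> carrier (quat_alg_padic a b)"
    then show "x \<otimes>\<^bsub>quat_alg_padic a b\<^esub> y \<in> carrier (quat_alg_padic a b)"
      by (elim quat_alg_padic_carrier_cases; simp add: quat_alg_def padic_of_rat_eq)
  next
    fix x y z assume "x \<in> carrier (quat_alg_padic a b)" "y \<in> carrier (quat_alg_padic a b)"
      "z \<in> carrier (quat_alg_padic a b)"
    then show "x \<otimes>\<^bsub>quat_alg_padic a b\<^esub> y \<otimes>\<^bsub>quat_alg_padic a b\<^esub> z
        = x \<otimes>\<^bsub>quat_alg_padic a b\<^esub> (y \<otimes>\<^bsub>quat_alg_padic a b\<^esub> z)"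
      by (elim quat_alg_padic_carrier_cases; simp add: quat_alg_def padic_of_rat_eq)
        (intro conjI arg_cong[of _ _ padic_class]; simp add: algebra_simps)
  next
    show "\<one>\<^bsub>quat_alg_padic a b\<^esub> \<in> carrier (quat_alg_padic a b)"
      by (simp add: quat_alg_def padic_class_zero padic_class_one)
    fix x assume "x \<in> carrier (quat_alg_padic a b)"
    then show "\<one>\<^bsub>quat_alg_padic a b\<^esub> \<otimes>\<^bsub>quat_alg_padic a b\<^esub> x = x"
      "x \<otimes>\<^bsub>quat_alg_padic a b\<^esub> \<one>\<^bsub>quat_alg_padic a b\<^esub> = x"
      by (elim quat_alg_padic_carrier_cases;
        simp add: quat_alg_def padic_class_zero padic_class_one padic_of_rat_eq)+
  qed
  fix x y z assume "x \<in> carrier (quat_alg_padic a b)" "y \<in> carrier (quat_alg_padic a b)"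
    "z \<in> carrier (quat_alg_padic a b)"
  then show "(x \<oplus>\<^bsub>quat_alg_padic a b\<^esub> y) \<otimes>\<^bsub>quat_alg_padic a b\<^esub> z
      = x \<otimes>\<^bsub>quat_alg_padic a b\<^esub> z \<oplus>\<^bsub>quat_alg_padic a b\<^esub> y \<otimes>\<^bsub>quat_alg_padic a b\<^esub> z"
    "z \<otimes>\<^bsub>quat_alg_padic a b\<^esub> (x \<oplus>\<^bsub>quat_alg_padic a b\<^esub> y)
      = z \<otimes>\<^bsub>quat_alg_padic a b\<^esub> x \<oplus>\<^bsub>quat_alg_padic a b\<^esub> z \<otimes>\<^bsub>quat_alg_padic a b\<^esub> y"
    by (elim quat_alg_padic_carrier_cases; simp add: quat_alg_def padic_of_rat_eq;
      intro conjI arg_cong[of _ _ padic_class]; simp add: algebra_simps)+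
qed

text \<open>A pure quaternion x of reduced norm E satisfies x^2 = -E, so (s + x)(-s + x) = -(s^2 +
  E) vanishes.\<close>

lemma quat_alg_padic_zero_divisor:
  assumes div: "is_division_ring (quat_alg_padic a b)"
    and s: "s \<in> padic_Cauchy p" "s * s + (\<lambda>_. E) \<in> padic_null p"
    and E: "quat_nrd a b (0, x1, x2, x3) = E" "E \<noteq> 0"
  shows False
proof -
  let ?D = "quat_alg_padic a b" and ?k = "\<lambda>x. padic_class (\<lambda>_. x)"
  interpret D: ring ?D by (rule quat_alg_padic_ring)
  define x where "x = (padic_class s, ?k x1, ?k x2, ?k x3)"
  define y where "y = (padic_class (- s), ?k x1, ?k x2, ?k x3)"
  have xy: "x \<in> carrier ?D" "y \<in> carrier ?D" using s by (simp_all add: x_def y_def quat_alg_def)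
  have const: "?k c \<noteq> \<zero>\<^bsub>padic_field p\<^esub>" if "c \<noteq> 0" for c
  proof
    assume "?k c = \<zero>\<^bsub>padic_field p\<^esub>"
    then have "(\<lambda>_. c) \<in> padic_null p" by (simp add: padic_class_eq_zero_iff)
    then have "\<exists>N. \<forall>n\<ge>N. padic_abs p c < padic_abs p c"
      unfolding padic_null_iff[OF p] using padic_abs_pos[OF p that] by blast
    then show False by auto
  qed
  have "x1 \<noteq> 0 \<or> x2 \<noteq> 0 \<or> x3 \<noteq> 0" using E by auto
  then have nz: "x \<noteq> \<zero>\<^bsub>?D\<^esub>" "y \<noteq> \<zero>\<^bsub>?D\<^esub>"
    using const by (auto simp: x_def y_def quat_alg_def)
  have "x \<otimes>\<^bsub>?D\<^esub> y = (padic_class (- (s * s + (\<lambda>_. E))), padic_class 0, padic_class 0, padic_class 0)"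
    unfolding x_def y_def E(1)[symmetric] using s(1)
    by (simp add: quat_alg_def padic_of_rat_eq)
      (intro conjI arg_cong[of _ _ padic_class]; simp add: fun_eq_iff power2_eq_square algebra_simps)
  also have "\<dots> = \<zero>\<^bsub>?D\<^esub>"
  proof -
    have "- (s * s + (\<lambda>_. E)) \<in> padic_null p"
      using padic_null_minus[OF p s(2)] by (simp add: fun_Compl_def)
    moreover have "- (s * s + (\<lambda>_. E)) \<in> padic_Cauchy p" using s(1) by (simp del: minus_add_distrib)
    ultimately have "padic_class (- (s * s + (\<lambda>_. E))) = \<zero>\<^bsub>padic_field p\<^esub>"
      using padic_class_eq_zero_iff by blast
    then show ?thesis by (simp add: quat_alg_def padic_class_zero)
  qed
  finally have "x \<otimes>\<^bsub>?D\<^esub> y = x \<otimes>\<^bsub>?D\<^esub> \<zero>\<^bsub>?D\<^esub>" using xy by simp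
  moreover have "x \<in> Units ?D" using div xy nz unfolding is_division_ring_def by blast
  ultimately have "y = \<zero>\<^bsub>?D\<^esub>" using xy D.Units_l_cancel by blast
  then show False using nz by blast
qed

text \<open>A nontrivial zero of the norm form over \<open>\<rat>\<^sub>p\<close>, expressed by rational approximations.\<close>

definition padic_isotropic :: "rat \<Rightarrow> rat \<Rightarrow> bool" where
  "padic_isotropic a b \<longleftrightarrow> (\<exists>c>0. \<forall>e>0. \<exists>x0 x1 x2 x3. padic_abs p (quat_nrd a b (x0, x1, x2, x3)) < e \<and>
    (c \<le> padic_abs p x0 \<or> c \<le> padic_abs p x1 \<or> c \<le> padic_abs p x2 \<or> c \<le> padic_abs p x3))"

text \<open>The conjugate divided by the norm inverts an element, unless the norm sequence is null;
  then the terms of the coordinate sequences are the approximate zeros of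
  \<open>padic_isotropic\<close>.\<close>

lemma quat_alg_padic_division:
  assumes "\<not> padic_isotropic a b"
  shows "is_division_ring (quat_alg_padic a b)"
proof -
  let ?D = "quat_alg_padic a b"
  interpret D: ring ?D by (rule quat_alg_padic_ring)
  have one: "\<one>\<^bsub>?D\<^esub> \<noteq> \<zero>\<^bsub>?D\<^esub>" using padic_class_1_neq_0 by (simp add: quat_alg_def padic_class_one)
  have "x \<in> Units ?D" if x: "x \<in> carrier ?D" "x \<noteq> \<zero>\<^bsub>?D\<^esub>" for x
  proof -
    obtain x0 x1 x2 x3 where xx: "x = (padic_class x0, padic_class x1, padic_class x2, padic_class x3)"
      and c: "x0 \<in> padic_Cauchy p" "x1 \<in> padic_Cauchy p" "x2 \<in> padic_Cauchy p" "x3 \<in> padic_Cauchy p"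
      by (rule quat_alg_padic_carrier_cases[OF x(1)])
    define A B :: "nat \<Rightarrow> rat" where "A = (\<lambda>_. a)" and "B = (\<lambda>_. b)"
    have AB: "A \<in> padic_Cauchy p" "B \<in> padic_Cauchy p" by (simp_all add: A_def B_def)
    define N where "N = x0 * x0 - A * (x1 * x1) - B * (x2 * x2) + A * B * (x3 * x3)"
    have N: "N \<in> padic_Cauchy p" using c AB by (simp add: N_def)
    have Nn: "N n = quat_nrd a b (x0 n, x1 n, x2 n, x3 n)" for n
      by (simp add: N_def A_def B_def power2_eq_square)
    have "N \<notin> padic_null p"
    proof
      assume null: "N \<in> padic_null p"
      have "\<exists>z. z \<in> {x0, x1, x2, x3} \<and> z \<notin> padic_null p"
        using x(2) c padic_class_eq_zero_iff unfolding xx by (auto simp: quat_alg_def)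
      then obtain z where z: "z \<in> {x0, x1, x2, x3}" "z \<notin> padic_null p" by blast
      then have "z \<in> padic_Cauchy p" using c by auto
      then obtain d M where d: "d > 0" "\<And>n. n \<ge> M \<Longrightarrow> padic_abs p (z n) \<ge> d"
        using padic_Cauchy_not_null[OF p _ z(2)] by blast
      have "padic_isotropic a b" unfolding padic_isotropic_def
      proof (intro exI[of _ d] conjI allI impI d(1))
        fix e :: real assume "e > 0"
        then obtain L where "\<forall>n\<ge>L. padic_abs p (N n) < e" using null padic_null_iff[OF p] by blast
        then have "padic_abs p (N (max L M)) < e" "d \<le> padic_abs p (z (max L M))"
          using d(2) by auto
        from this(1)[unfolded Nn] this(2)
        show "\<exists>x0 x1 x2 x3. padic_abs p (quat_nrd a b (x0, x1, x2, x3)) < e \<and>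
            (d \<le> padic_abs p x0 \<or> d \<le> padic_abs p x1 \<or> d \<le> padic_abs p x2 \<or> d \<le> padic_abs p x3)"
          using z(1) by blast
      qed
      then show False using assms by blast
    qed
    define M where "M = (\<lambda>n. inverse (N n))"
    have M: "M \<in> padic_Cauchy p" and NM: "(\<lambda>n. N n * M n - 1) \<in> padic_null p"
      using padic_Cauchy_inverse[OF p N \<open>N \<notin> padic_null p\<close>] by (simp_all add: M_def)
    have eq: "padic_class u = padic_class 1"
      if u: "u = N * M" for u
    proof -
      interpret Q: cring "padic_field p" by (rule padic_field_cring)
      have "N * M - 1 \<in> padic_null p" using NM by (simp add: fun_diff_def times_fun_def one_fun_def)
      then have "padic_class (N * M) \<ominus>\<^bsub>padic_field p\<^esub> padic_class 1 = \<zero>\<^bsub>padic_field p\<^esub>"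
        using N M by (simp add: padic_class_eq_zero_iff)
      then show ?thesis unfolding u
        using N M Q.r_right_minus_eq[of "padic_class (N * M)" "padic_class 1"] by simp
    qed
    define y where "y = (padic_class (x0 * M), padic_class (- x1 * M), padic_class (- x2 * M), padic_class (- x3 * M))"
    have y: "y \<in> carrier ?D" using c M by (simp add: y_def quat_alg_def)
    have "x \<otimes>\<^bsub>?D\<^esub> y = \<one>\<^bsub>?D\<^esub>" "y \<otimes>\<^bsub>?D\<^esub> x = \<one>\<^bsub>?D\<^esub>"
      using c M AB
      by (simp_all add: xx y_def quat_alg_def padic_of_rat_eq padic_class_zero padic_class_one
          A_def[symmetric] B_def[symmetric])
        (intro conjI eq arg_cong[of _ _ padic_class]; simp add: N_def algebra_simps)+
    then show ?thesis using x y unfolding Units_def by blast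
  qed
  moreover have "x \<noteq> \<zero>\<^bsub>?D\<^esub>" if "x \<in> Units ?D" for x
    using that one D.Units_closed D.Units_r_inv D.Units_inv_closed D.l_null by metis
  ultimately show ?thesis
    unfolding is_division_ring_def using D.ring_axioms D.Units_closed by blast
qed

end

section \<open>Pure quaternions of given norm\<close>

lemma hensel_square_root:
  fixes p :: nat and d :: int
  assumes p: "Factorial_Ring.prime p" "p > 2" and d: "\<not> int p dvd d" "QuadRes (int p) d"
  obtains s where "s \<in> padic_Cauchy p" "s * s - (\<lambda>_. of_int d) \<in> padic_null p"
proof -
  obtain s0 where s0: "int p dvd s0\<^sup>2 - d" using d(2) unfolding QuadRes_def cong_iff_dvd_diff by blast
  have step: "\<exists>t. int p ^ Suc (Suc k) dvd t\<^sup>2 - d \<and> int p ^ Suc k dvd t - s"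
    if s: "int p ^ Suc k dvd s\<^sup>2 - d" for s k
  proof -
    obtain m where m: "s\<^sup>2 - d = int p ^ Suc k * m" using s by blast
    have "\<not> int p dvd s"
    proof
      assume "int p dvd s"
      then have "int p dvd s\<^sup>2" by (simp add: power2_eq_square)
      moreover have "int p dvd s\<^sup>2 - d" unfolding m by simp
      ultimately have "int p dvd s\<^sup>2 - (s\<^sup>2 - d)" by (rule dvd_diff)
      then show False using d(1) by simp
    qed
    moreover have "\<not> int p dvd 2" using p(2) zdvd_imp_le[of "int p" 2] by auto
    ultimately have "coprime (int p) (2 * s)"
      using p(1) by (intro prime_imp_coprime) (auto simp: prime_dvd_mult_iff)
    then obtain u v where uv: "u * int p + v * (2 * s) = 1" using comaximal_int_iff unfolding comaximal_def by blast
    \<comment> \<open>A Newton step: \<open>v\<close> inverts \<open>2 * s\<close> modulo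
      \<open>p\<close>, so the correction cancels the error up to the next power of
      \<open>p\<close>.\<close>
    define t where "t = s - int p ^ Suc k * (v * m)"
    have "t\<^sup>2 - d = (s\<^sup>2 - d) - int p ^ Suc k * (m * (v * (2 * s))) + int p ^ Suc k * int p ^ Suc k * (v * m)\<^sup>2"
      by (simp add: t_def power2_eq_square algebra_simps)
    also have "v * (2 * s) = 1 - u * int p" using uv by simp
    also have "(s\<^sup>2 - d) - int p ^ Suc k * (m * (1 - u * int p)) + int p ^ Suc k * int p ^ Suc k * (v * m)\<^sup>2
        = int p ^ Suc (Suc k) * (m * u + int p ^ k * (v * m)\<^sup>2)"
      unfolding m by (simp add: algebra_simps)
    finally have "int p ^ Suc (Suc k) dvd t\<^sup>2 - d" by simp
    moreover have "int p ^ Suc k dvd t - s" by (simp add: t_def)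
    ultimately show ?thesis by blast
  qed
  have "\<exists>f. \<forall>k. int p ^ Suc k dvd (f k)\<^sup>2 - d \<and> int p ^ Suc k dvd f (Suc k) - f k"
  proof (rule dependent_nat_choice)
    show "\<exists>x. int p ^ Suc 0 dvd x\<^sup>2 - d" using s0 by auto
  qed (use step in blast)
  then obtain f where f: "\<And>k. int p ^ Suc k dvd (f k)\<^sup>2 - d" "\<And>k. int p ^ Suc k dvd f (Suc k) - f k" by blast
  have diff: "int p ^ Suc k dvd f (k + j) - f k" for k j
  proof (induction j)
    case (Suc j)
    have "int p ^ Suc k dvd f (Suc (k + j)) - f (k + j)"
      using f(2)[of "k + j"] by (metis dvd_trans le_add1 le_imp_power_dvd Suc_le_mono)
    from dvd_add[OF this Suc] show ?case by simp
  qed simp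
  define s where "s = (\<lambda>k. of_int (f k) :: rat)"
  have p1: "1 < real p" using p by simp
  have small: "\<exists>N. 1 / real p ^ Suc N < e" if "e > 0" for e :: real
  proof -
    obtain N where "(1 / real p) ^ N < e" using real_arch_pow_inv[of e "1 / real p"] p1 \<open>e > 0\<close> by auto
    moreover have "(1 / real p) ^ Suc N \<le> (1 / real p) ^ N"
      using p1 by (intro power_decreasing) auto
    ultimately have "(1 / real p) ^ Suc N < e" by linarith
    then show ?thesis by (auto simp: power_one_over)
  qed
  have "s \<in> padic_Cauchy p" unfolding padic_Cauchy_def
  proof safe
    fix e :: real assume "e > 0"
    then obtain N where N: "1 / real p ^ Suc N < e" using small by blast
    have "padic_abs p (s m - s n) < e" if "m \<ge> N" "n \<ge> N" for m n
    proof -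
      have "int p ^ Suc N dvd (f (N + (m - N)) - f N) - (f (N + (n - N)) - f N)"
        by (intro dvd_diff diff)
      then have "int p ^ Suc N dvd f m - f n" using that by simp
      then have "padic_abs p (of_int (f m - f n)) \<le> 1 / real p ^ Suc N"
        using padic_abs_int_le_iff[OF p(1)] by blast
      then show ?thesis using N by (simp add: s_def)
    qed
    then show "\<exists>N. \<forall>m\<ge>N. \<forall>n\<ge>N. padic_abs p (s m - s n) < e" by blast
  qed
  moreover have "s * s - (\<lambda>_. of_int d) \<in> padic_null p" unfolding padic_null_iff[OF p(1)]
  proof safe
    fix e :: real assume "e > 0"
    then obtain N where N: "1 / real p ^ Suc N < e" using small by blast
    have "padic_abs p ((s * s - (\<lambda>_. of_int d)) n) < e" if "n \<ge> N" for n
    proof -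
      have "int p ^ Suc N dvd (f n)\<^sup>2 - d"
        using f(1)[of n] that by (metis dvd_trans le_imp_power_dvd Suc_le_mono)
      then have "padic_abs p (of_int ((f n)\<^sup>2 - d)) \<le> 1 / real p ^ Suc N"
        using padic_abs_int_le_iff[OF p(1)] by blast
      then show ?thesis using N by (simp add: s_def power2_eq_square)
    qed
    then show "\<exists>N. \<forall>n\<ge>N. padic_abs p ((s * s - (\<lambda>_. of_int d)) n) < e" by blast
  qed
  ultimately show ?thesis by (rule that)
qed

section \<open>From p-adic zeros of the norm form to congruence conditions\<close>

lemma padic_isotropic_scale:
  assumes p: "Factorial_Ring.prime p" and iso: "padic_isotropic p (a * s\<^sup>2) (b * t\<^sup>2)"
    and s: "s \<noteq> 0" and t: "t \<noteq> 0"
  shows "padic_isotropic p a b"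
proof -
  obtain c where c: "c > 0" "\<And>e. e > 0 \<Longrightarrow> \<exists>x0 x1 x2 x3.
      padic_abs p (quat_nrd (a * s\<^sup>2) (b * t\<^sup>2) (x0, x1, x2, x3)) < e \<and>
      (c \<le> padic_abs p x0 \<or> c \<le> padic_abs p x1 \<or> c \<le> padic_abs p x2 \<or> c \<le> padic_abs p x3)"
    using iso unfolding padic_isotropic_def[OF p] by blast
  define k where "k = Min {1, padic_abs p s, padic_abs p t, padic_abs p (s * t)}"
  have k: "k > 0" "k \<le> 1" "k \<le> padic_abs p s" "k \<le> padic_abs p t" "k \<le> padic_abs p (s * t)"
    using s t padic_abs_pos[OF p] by (auto simp: k_def)
  have scale: "c * k \<le> padic_abs p (u * x)" if "c \<le> padic_abs p x" "k \<le> padic_abs p u" for u x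
    using mult_mono[OF that(1,2)] c(1) k(1) by (simp add: padic_abs_mult[OF p] mult.commute padic_abs_nonneg[OF p])
  show ?thesis unfolding padic_isotropic_def[OF p]
  proof (intro exI[of _ "c * k"] conjI allI impI)
    show "0 < c * k" using c k by simp
    fix e :: real assume "e > 0"
    then obtain x0 x1 x2 x3 where x: "padic_abs p (quat_nrd (a * s\<^sup>2) (b * t\<^sup>2) (x0, x1, x2, x3)) < e"
      "c \<le> padic_abs p x0 \<or> c \<le> padic_abs p x1 \<or> c \<le> padic_abs p x2 \<or> c \<le> padic_abs p x3"
      using c(2) by blast
    have "quat_nrd (a * s\<^sup>2) (b * t\<^sup>2) (x0, x1, x2, x3) = quat_nrd a b (1 * x0, s * x1, t * x2, (s * t) * x3)"
      by (simp add: power_mult_distrib)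
    moreover have "k \<le> padic_abs p 1" using k(2) by (simp add: padic_abs_1[OF p])
    ultimately show "\<exists>x0 x1 x2 x3. padic_abs p (quat_nrd a b (x0, x1, x2, x3)) < e \<and>
        (c * k \<le> padic_abs p x0 \<or> c * k \<le> padic_abs p x1 \<or> c * k \<le> padic_abs p x2 \<or> c * k \<le> padic_abs p x3)"
      using x scale k by metis
  qed
qed

text \<open>Fractions are brought to a common denominator and freed of their common divisor. The
  scaling factor \<open>q\<close> has absolute value at least \<open>c\<close>, as integers have
  absolute value at most 1, and the form scales by \<open>q^2\<close>; hence the tolerance
  \<open>c^2 / p^k\<close>.\<close>

lemma padic_isotropic_primitive:
  fixes a b :: int
  assumes p: "Factorial_Ring.prime p" and iso: "padic_isotropic p (of_int a) (of_int b)"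
  obtains x0 x1 x2 x3 :: int where
    "int p ^ k dvd x0\<^sup>2 - a * x1\<^sup>2 - b * x2\<^sup>2 + a * b * x3\<^sup>2"
    "\<not> (int p dvd x0 \<and> int p dvd x1 \<and> int p dvd x2 \<and> int p dvd x3)"
proof -
  obtain c where c: "c > 0" "\<And>e. e > 0 \<Longrightarrow> \<exists>x0 x1 x2 x3.
      padic_abs p (quat_nrd (of_int a) (of_int b) (x0, x1, x2, x3)) < e \<and>
      (c \<le> padic_abs p x0 \<or> c \<le> padic_abs p x1 \<or> c \<le> padic_abs p x2 \<or> c \<le> padic_abs p x3)"
    using iso unfolding padic_isotropic_def[OF p] by blast
  have p0: "real p > 0" using p prime_gt_0_nat by simp
  then have "c\<^sup>2 / real p ^ k > 0" using c(1) by simp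
  from c(2)[OF this] obtain x0 x1 x2 x3 where
    x: "padic_abs p (quat_nrd (of_int a) (of_int b) (x0, x1, x2, x3)) < c\<^sup>2 / real p ^ k"
    and cx: "c \<le> padic_abs p x0 \<or> c \<le> padic_abs p x1 \<or> c \<le> padic_abs p x2 \<or> c \<le> padic_abs p x3" by blast
  obtain n0 m0 where 0: "x0 = of_int n0 / of_int m0" "m0 \<noteq> 0" by (rule rat_as_fraction)
  obtain n1 m1 where 1: "x1 = of_int n1 / of_int m1" "m1 \<noteq> 0" by (rule rat_as_fraction)
  obtain n2 m2 where 2: "x2 = of_int n2 / of_int m2" "m2 \<noteq> 0" by (rule rat_as_fraction)
  obtain n3 m3 where 3: "x3 = of_int n3 / of_int m3" "m3 \<noteq> 0" by (rule rat_as_fraction)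
  define D where "D = m0 * m1 * m2 * m3"
  define y0 y1 y2 y3 where "y0 = n0 * m1 * m2 * m3" and "y1 = n1 * m0 * m2 * m3"
    and "y2 = n2 * m0 * m1 * m3" and "y3 = n3 * m0 * m1 * m2"
  have D: "D \<noteq> 0" using 0 1 2 3 by (simp add: D_def)
  have xy: "x0 = of_int y0 / of_int D" "x1 = of_int y1 / of_int D"
    "x2 = of_int y2 / of_int D" "x3 = of_int y3 / of_int D"
    using 0 1 2 3 by (simp_all add: D_def y0_def y1_def y2_def y3_def field_simps)
  define g where "g = gcd (gcd y0 y1) (gcd y2 y3)"
  have "g \<noteq> 0"
  proof
    assume "g = 0"
    then have "y0 = 0" "y1 = 0" "y2 = 0" "y3 = 0" by (auto simp: g_def)
    then show False using cx c(1) by (simp add: xy padic_abs_0[OF p])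
  qed
  obtain z0 z1 z2 z3 where z: "y0 = g * z0" "y1 = g * z1" "y2 = g * z2" "y3 = g * z3"
    unfolding g_def by (meson dvdE dvd_trans gcd_dvd1 gcd_dvd2)
  define q :: rat where "q = of_int g / of_int D"
  have xz: "x0 = of_int z0 * q" "x1 = of_int z1 * q" "x2 = of_int z2 * q" "x3 = of_int z3 * q"
    by (simp_all add: xy z q_def)
  have "padic_abs p (of_int z * q) \<le> padic_abs p q" for z
    using padic_abs_int_le_1[OF p, of z] padic_abs_nonneg[OF p, of q]
    by (simp add: padic_abs_mult[OF p] mult_left_le_one_le padic_abs_nonneg[OF p])
  then have cq: "c \<le> padic_abs p q" using cx unfolding xz by (meson order_trans)
  define f where "f = z0\<^sup>2 - a * z1\<^sup>2 - b * z2\<^sup>2 + a * b * z3\<^sup>2"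
  have "quat_nrd (of_int a) (of_int b) (x0, x1, x2, x3) = q\<^sup>2 * of_int f"
    by (simp add: xz f_def power2_eq_square algebra_simps)
  then have "(padic_abs p q)\<^sup>2 * padic_abs p (of_int f) < c\<^sup>2 / real p ^ k"
    using x by (simp add: padic_abs_mult[OF p] power2_eq_square)
  moreover have "c\<^sup>2 * padic_abs p (of_int f) \<le> (padic_abs p q)\<^sup>2 * padic_abs p (of_int f)"
    using cq c(1) by (intro mult_right_mono power_mono padic_abs_nonneg[OF p]) auto
  ultimately have "c\<^sup>2 * padic_abs p (of_int f) < c\<^sup>2 * (1 / real p ^ k)" by simp
  moreover have "c\<^sup>2 > 0" using c(1) by simp
  ultimately have "padic_abs p (of_int f) \<le> 1 / real p ^ k"
    using mult_less_cancel_left_pos by (metis less_le)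
  then have "int p ^ k dvd f" using padic_abs_int_le_iff[OF p] by blast
  moreover have "\<not> (int p dvd z0 \<and> int p dvd z1 \<and> int p dvd z2 \<and> int p dvd z3)"
  proof
    assume "int p dvd z0 \<and> int p dvd z1 \<and> int p dvd z2 \<and> int p dvd z3"
    then have "g * int p dvd g" unfolding z by (subst (2) g_def) (simp add: z)
    then have "int p dvd 1" using \<open>g \<noteq> 0\<close> by simp
    then show False using p by (metis not_prime_unit prime_nat_int_transfer)
  qed
  ultimately show ?thesis using that unfolding f_def by blast
qed

text \<open>Modulo \<open>p\<close> the form is \<open>x0^2 - a * x1^2\<close>, which suffices if
  \<open>p\<close> does not divide \<open>x1\<close>. Otherwise \<open>p\<close> divides
  \<open>x0\<close> and \<open>x1\<close>; dividing by \<open>p\<close> leaves a unit times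
  \<open>x2^2 - a * x3^2\<close>, and primitivity keeps \<open>p\<close> from dividing
  \<open>x3\<close>.\<close>

lemma tame_at_one_sided:
  fixes a b p :: int
  assumes p: "Factorial_Ring.prime p" and b: "p dvd b" "\<not> p\<^sup>2 dvd b" and a: "\<not> p dvd a"
    and f: "p ^ 3 dvd x0\<^sup>2 - a * x1\<^sup>2 - b * x2\<^sup>2 + a * b * x3\<^sup>2"
    and prim: "\<not> (p dvd x0 \<and> p dvd x1 \<and> p dvd x2 \<and> p dvd x3)"
  shows "square_mod a p"
proof -
  obtain b' where b': "b = p * b'" using b by blast
  have pb': "\<not> p dvd b'" using b(2) unfolding b' by (auto simp: power2_eq_square)
  obtain m where m: "x0\<^sup>2 - a * x1\<^sup>2 - b * x2\<^sup>2 + a * b * x3\<^sup>2 = p ^ 3 * m" using f by blast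
  have cancel: "square_mod a p" if "p dvd x\<^sup>2 - a * y\<^sup>2" "\<not> p dvd y" for x y
  proof (rule square_mod_cancel)
    show "comaximal p y" using that(2) p comaximal_int_iff prime_imp_coprime by blast
    show "square_mod (a * y\<^sup>2) p" using that(1) unfolding square_mod_def by blast
  qed
  have e1: "x0\<^sup>2 - a * x1\<^sup>2 = p * (p\<^sup>2 * m + b' * x2\<^sup>2 - a * b' * x3\<^sup>2)"
    using m unfolding b' by (simp add: algebra_simps power2_eq_square power3_eq_cube)
  show ?thesis
  proof (cases "p dvd x1")
    case False
    then show ?thesis using cancel[of x0 x1] e1 by simp
  next
    case True
    have "p dvd (x0\<^sup>2 - a * x1\<^sup>2) + a * x1\<^sup>2"
      using e1 True by (intro dvd_add) (auto simp: power2_eq_square)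
    then have "p dvd x0" using p by (simp add: prime_dvd_power_iff)
    with True obtain y0 y1 where y: "x0 = p * y0" "x1 = p * y1" by blast
    have "p * (p * (y0\<^sup>2 - a * y1\<^sup>2)) = p * (p\<^sup>2 * m + b' * x2\<^sup>2 - a * b' * x3\<^sup>2)"
      using e1 unfolding y by (simp add: algebra_simps power2_eq_square)
    then have "p * (y0\<^sup>2 - a * y1\<^sup>2) = p\<^sup>2 * m + b' * x2\<^sup>2 - a * b' * x3\<^sup>2" using p by auto
    then have "b' * (x2\<^sup>2 - a * x3\<^sup>2) = p * (y0\<^sup>2 - a * y1\<^sup>2 - p * m)"
      by (simp add: algebra_simps power2_eq_square)
    then have "p dvd b' * (x2\<^sup>2 - a * x3\<^sup>2)" by simp
    then have d: "p dvd x2\<^sup>2 - a * x3\<^sup>2" using p pb' by (simp add: prime_dvd_mult_iff)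
    have "\<not> p dvd x3"
    proof
      assume "p dvd x3"
      then have "p dvd (x2\<^sup>2 - a * x3\<^sup>2) + a * x3\<^sup>2"
        using d by (intro dvd_add) (auto simp: power2_eq_square)
      then have "p dvd x2" using p by (simp add: prime_dvd_power_iff)
      then show False using prim \<open>p dvd x0\<close> True \<open>p dvd x3\<close> by blast
    qed
    then show ?thesis using cancel d by blast
  qed
qed

text \<open>If \<open>p\<close> divides both coefficients, it divides \<open>x0\<close>, and after
  one division the form is \<open>- a' * x1^2 - b' * x2^2\<close> modulo \<open>p\<close>. If
  \<open>p\<close> divides \<open>x1\<close> and \<open>x2\<close> as well, another division leaves
  \<open>y^2 + a' * b' * x3^2\<close>. The zero is taken modulo \<open>p^3\<close> to survive both
  divisions.\<close>

lemma padic_isotropic_imp_tame_at: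
  fixes a b :: int
  assumes p: "Factorial_Ring.prime p" and iso: "padic_isotropic p (of_int a) (of_int b)"
    and sf: "squarefree a" "squarefree b"
  shows "tame_at a b (int p)"
proof -
  obtain x0 x1 x2 x3 where f: "int p ^ 3 dvd x0\<^sup>2 - a * x1\<^sup>2 - b * x2\<^sup>2 + a * b * x3\<^sup>2"
    and prim: "\<not> (int p dvd x0 \<and> int p dvd x1 \<and> int p dvd x2 \<and> int p dvd x3)"
    by (rule padic_isotropic_primitive[OF p iso])
  have pp: "Factorial_Ring.prime (int p)" using p by simp
  have sq: "\<not> (int p)\<^sup>2 dvd a" "\<not> (int p)\<^sup>2 dvd b"
    using sf pp unfolding squarefree_def by (metis not_prime_unit)+
  have "square_mod a (int p)" if "int p dvd b" "\<not> int p dvd a"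
    by (rule tame_at_one_sided[OF pp that(1) sq(2) that(2) f prim])
  moreover have "square_mod b (int p)" if ab: "int p dvd a" "\<not> int p dvd b"
  proof (rule tame_at_one_sided[OF pp ab(1) sq(1) ab(2)])
    show "int p ^ 3 dvd x0\<^sup>2 - b * x2\<^sup>2 - a * x1\<^sup>2 + b * a * x3\<^sup>2" using f by (simp add: algebra_simps)
    show "\<not> (int p dvd x0 \<and> int p dvd x2 \<and> int p dvd x1 \<and> int p dvd x3)" using prim by blast
  qed
  moreover have "square_mod (- (a div int p) * (b div int p)) (int p)" if ab: "int p dvd a" "int p dvd b"
  proof -
    obtain a' b' where a': "a = int p * a'" and b': "b = int p * b'" using ab by blast
    have p0: "int p \<noteq> 0" using pp by auto
    have div: "a div int p = a'" "b div int p = b'" using p0 by (simp_all add: a' b')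
    have pa': "\<not> int p dvd a'" "\<not> int p dvd b'" using sq unfolding a' b' by (auto simp: power2_eq_square)
    have cancel: "square_mod (- a' * b') (int p)" if "int p dvd x\<^sup>2 - (- a' * b') * y\<^sup>2" "\<not> int p dvd y" for x y
    proof (rule square_mod_cancel)
      show "comaximal (int p) y" using that(2) pp comaximal_int_iff prime_imp_coprime by blast
      show "square_mod (- a' * b' * y\<^sup>2) (int p)" using that(1) unfolding square_mod_def by blast
    qed
    obtain m where m: "x0\<^sup>2 - a * x1\<^sup>2 - b * x2\<^sup>2 + a * b * x3\<^sup>2 = int p ^ 3 * m" using f by blast
    then have "x0\<^sup>2 = int p * (int p ^ 2 * m + a' * x1\<^sup>2 + b' * x2\<^sup>2 - int p * a' * b' * x3\<^sup>2)"
      unfolding a' b' by (simp add: algebra_simps power2_eq_square power3_eq_cube)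
    then have "int p dvd x0\<^sup>2" by simp
    then have "int p dvd x0" using pp by (simp add: prime_dvd_power_iff)
    then obtain y where y: "x0 = int p * y" by blast
    have "int p * (int p * y\<^sup>2 - a' * x1\<^sup>2 - b' * x2\<^sup>2 + int p * (a' * b' * x3\<^sup>2)) = int p * (int p ^ 2 * m)"
      using m unfolding a' b' y by (simp add: algebra_simps power2_eq_square power3_eq_cube)
    then have e: "int p * y\<^sup>2 - a' * x1\<^sup>2 - b' * x2\<^sup>2 + int p * (a' * b' * x3\<^sup>2) = int p ^ 2 * m"
      using p0 by simp
    have "square_mod (- a' * b') (int p)"
    proof (cases "int p dvd x1")
      case False
      have "(b' * x2)\<^sup>2 - (- a' * b') * x1\<^sup>2 = b' * (a' * x1\<^sup>2 + b' * x2\<^sup>2)"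
        by (simp add: algebra_simps power2_eq_square)
      also have "a' * x1\<^sup>2 + b' * x2\<^sup>2 = int p * (y\<^sup>2 + a' * b' * x3\<^sup>2 - int p * m)"
        using e by (simp add: algebra_simps power2_eq_square)
      finally have "int p dvd (b' * x2)\<^sup>2 - (- a' * b') * x1\<^sup>2" by simp
      then show ?thesis using cancel False by blast
    next
      case True
      then obtain u where u: "x1 = int p * u" by blast
      have "b' * x2\<^sup>2 = int p * (y\<^sup>2 - a' * (int p * u\<^sup>2) + a' * b' * x3\<^sup>2 - int p * m)"
        using e unfolding u by (simp add: algebra_simps power2_eq_square)
      then have "int p dvd b' * x2\<^sup>2" by simp
      then have "int p dvd x2" using pp pa' by (simp add: prime_dvd_mult_iff prime_dvd_power_iff)
      then obtain v where v: "x2 = int p * v" by blast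
      have "int p * (y\<^sup>2 - (- a' * b') * x3\<^sup>2) = int p * (int p * (m + a' * u\<^sup>2 + b' * v\<^sup>2))"
        using e unfolding u v by (simp add: algebra_simps power2_eq_square)
      then have "y\<^sup>2 - (- a' * b') * x3\<^sup>2 = int p * (m + a' * u\<^sup>2 + b' * v\<^sup>2)" using p0 by simp
      then have "int p dvd y\<^sup>2 - (- a' * b') * x3\<^sup>2" by simp
      moreover have "\<not> int p dvd x3" using prim \<open>int p dvd x0\<close> True \<open>int p dvd x2\<close> by blast
      ultimately show ?thesis using cancel by blast
    qed
    then show ?thesis by (simp add: div)
  qed
  ultimately show ?thesis unfolding tame_at_def by blast
qed

section \<open>Definiteness and the return from the quadratic field to rational quaternions\<close>

lemma quat_nrd_pos:
  assumes "a < 0" "b < 0" "(x0, x1, x2, x3) \<noteq> (0, 0, 0, 0)"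
  shows "quat_nrd a b (x0, x1, x2, x3) > 0"
proof -
  have ge: "x0\<^sup>2 \<ge> 0" "a * x1\<^sup>2 \<le> 0" "b * x2\<^sup>2 \<le> 0" "a * b * x3\<^sup>2 \<ge> 0"
    using assms by (simp_all add: mult_nonpos_nonneg mult_nonpos_nonpos)
  consider "x0 \<noteq> 0" | "x1 \<noteq> 0" | "x2 \<noteq> 0" | "x3 \<noteq> 0" using assms(3) by auto
  then show ?thesis
  proof cases
    case 1
    then have "x0\<^sup>2 > 0" by simp
    with ge show ?thesis unfolding quat_nrd.simps by linarith
  next
    case 2
    then have "a * x1\<^sup>2 < 0" using assms by (simp add: mult_neg_pos)
    with ge show ?thesis unfolding quat_nrd.simps by linarith
  next
    case 3
    then have "b * x2\<^sup>2 < 0" using assms by (simp add: mult_neg_pos)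
    with ge show ?thesis unfolding quat_nrd.simps by linarith
  next
    case 4
    then have "a * b * x3\<^sup>2 > 0" using assms by (simp add: mult_neg_neg)
    with ge show ?thesis unfolding quat_nrd.simps by linarith
  qed
qed

text \<open>An isotropic vector over \<open>K = \<rat>(\<surd>-E)\<close> is \<open>u + v \<surd>-E\<close> for quaternions \<open>u, v\<close> with
  \<open>nrd u = E nrd v\<close> and \<open>u v\<^sup>*\<close> of trace 0, so that \<open>u v\<^sup>-\<^sup>1\<close> is pure of norm \<open>E\<close>.\<close>

lemma conic_isotropic_imp_pure_quaternion:
  fixes a b :: int
  assumes iso: "conic_isotropic (of_int a) (of_int b :: 'd::quad_param quad_int)" and neg: "a < 0" "b < 0"
  shows "\<exists>x1 x2 x3. quat_nrd (of_int a) (of_int b) (0, x1, x2, x3)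
    = of_int (4 * qnm TYPE('d) - qtr TYPE('d))"
proof -
  let ?t = "qtr TYPE('d)" and ?n = "qnm TYPE('d)"
  define E where "E = 4 * ?n - ?t"
  obtain x y z :: "'d quad_int" where xyz: "(x, y, z) \<noteq> (0, 0, 0)"
    and eq: "z\<^sup>2 = of_int a * x\<^sup>2 + of_int b * y\<^sup>2"
    using iso unfolding conic_isotropic_def by blast
  \<comment> \<open>\<open>R u\<close> is the trace of \<open>u\<close>, so that
    \<open>2 * u = R u + qim u * sqrt (- E)\<close>.\<close>
  define R where "R u = 2 * qre u + ?t * qim u" for u :: "'d quad_int"
  have sq: "2 * R (u\<^sup>2) = (R u)\<^sup>2 - E * (qim u)\<^sup>2" "qim (u\<^sup>2) = R u * qim u" for u
    using quad_param_cases[where 'a = 'd] unfolding R_def E_def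
    by (auto simp: power2_eq_square qre_mult qim_mult algebra_simps)
  have lin: "R (of_int m * u + of_int k * v) = m * R u + k * R v"
    "qim (of_int m * u + of_int k * v) = m * qim u + k * qim v" for m k u v
    by (simp_all add: R_def qre_mult qim_mult algebra_simps)
  have "2 * R (z\<^sup>2) = a * (2 * R (x\<^sup>2)) + b * (2 * R (y\<^sup>2))" unfolding eq lin by (simp add: algebra_simps)
  then have "(R z)\<^sup>2 - E * (qim z)\<^sup>2 = a * ((R x)\<^sup>2 - E * (qim x)\<^sup>2) + b * ((R y)\<^sup>2 - E * (qim y)\<^sup>2)"
    unfolding sq .
  then have "(R z)\<^sup>2 - a * (R x)\<^sup>2 - b * (R y)\<^sup>2 = E * ((qim z)\<^sup>2 - a * (qim x)\<^sup>2 - b * (qim y)\<^sup>2)"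
    by (simp add: algebra_simps)
  moreover have "qim (z\<^sup>2) = a * qim (x\<^sup>2) + b * qim (y\<^sup>2)" unfolding eq lin ..
  then have "R z * qim z = a * (R x * qim x) + b * (R y * qim y)" unfolding sq .
  moreover define v where "v = (qim z)\<^sup>2 - a * (qim x)\<^sup>2 - b * (qim y)\<^sup>2"
  \<comment> \<open>Up to sign the pure coordinates of the product of
    \<open>(R z, R x, R y, 0)\<close> with the conjugate of \<open>(qim z, qim x, qim y, 0)\<close>;
    \<open>v\<close> is the norm of the latter quaternion.\<close>
  moreover define p1 p2 p3 where "p1 = R x * qim z - R z * qim x" and "p2 = R y * qim z - R z * qim y"
    and "p3 = R x * qim y - R y * qim x"
  moreover have "(R z * qim z - a * (R x * qim x) - b * (R y * qim y))\<^sup>2 - a * p1\<^sup>2 - b * p2\<^sup>2 + a * b * p3\<^sup>2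
      = ((R z)\<^sup>2 - a * (R x)\<^sup>2 - b * (R y)\<^sup>2) * v"
    unfolding p1_def p2_def p3_def v_def by (simp add: algebra_simps power2_eq_square)
  ultimately have pv: "- a * p1\<^sup>2 - b * p2\<^sup>2 + a * b * p3\<^sup>2 = E * v\<^sup>2" and uv: "(R z)\<^sup>2 - a * (R x)\<^sup>2 - b * (R y)\<^sup>2 = E * v"
    by (simp_all add: power2_eq_square)
  have aniso: "s = 0 \<and> t = 0 \<and> u = 0" if "u\<^sup>2 - a * s\<^sup>2 - b * t\<^sup>2 = 0" for s t u
  proof -
    have "- a * s\<^sup>2 \<ge> 0" "- b * t\<^sup>2 \<ge> 0" "u\<^sup>2 \<ge> 0" using neg by (simp_all add: mult_nonpos_nonneg)
    then have "u\<^sup>2 = 0" "a * s\<^sup>2 = 0" "b * t\<^sup>2 = 0" using that by linarith+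
    then show ?thesis using neg by simp
  qed
  have "v \<noteq> 0"
  proof
    assume v: "v = 0"
    then have "R x = 0 \<and> R y = 0 \<and> R z = 0" using uv aniso by simp
    moreover have "qim x = 0 \<and> qim y = 0 \<and> qim z = 0" using v aniso unfolding v_def by blast
    ultimately show False using xyz by (auto simp: R_def quad_int_eq_iff)
  qed
  have "quat_nrd (of_int a) (of_int b) (0, of_int p1 / of_int v, of_int p2 / of_int v, of_int p3 / of_int v)
      = of_int (- a * p1\<^sup>2 - b * p2\<^sup>2 + a * b * p3\<^sup>2) / (of_int v)\<^sup>2"
    by (simp add: power_divide diff_divide_distrib add_divide_distrib)
  also have "\<dots> = of_int E" unfolding pv using \<open>v \<noteq> 0\<close> by simp
  finally show ?thesis unfolding E_def by blast
qed

lemma rat_squarefree_part: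
  fixes a :: rat
  assumes "a \<noteq> 0"
  obtains a0 :: int and s :: rat where "a = of_int a0 * s\<^sup>2" "squarefree a0" "s \<noteq> 0"
proof -
  interpret norm_euclidean "\<lambda>x :: int. nat \<bar>x\<bar>"
  proof
    fix x y :: int assume "y \<noteq> 0"
    then show "\<exists>q. nat \<bar>x - y * q\<bar> < nat \<bar>y\<bar>"
      using abs_mod_less[of y x] by (intro exI[of _ "x div y"]) (simp add: minus_mult_div_eq_mod)
  qed (auto simp: abs_mult nat_mult_distrib)
  obtain n d where q: "quotient_of a = (n, d)" by (metis surj_pair)
  have d: "d > 0" by (rule quotient_of_denom_pos[OF q])
  have a: "a = of_int n / of_int d" by (rule quotient_of_div[OF q])
  then have "n * d \<noteq> 0" using assms d by auto
  then obtain y c where yc: "n * d = y * c\<^sup>2" "squarefree y" using squarefree_decomposition by blast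
  then have c: "c \<noteq> 0" using \<open>n * d \<noteq> 0\<close> by auto
  have "a = of_int (n * d) / (of_int d)\<^sup>2" using d by (simp add: a power2_eq_square)
  also have "\<dots> = of_int y * (of_int c / of_int d)\<^sup>2" unfolding yc(1) by (simp add: power_divide)
  finally show ?thesis using yc c d by (intro that) auto
qed

text \<open>A nonnegative \<open>a\<close> would have a real square root, and adding i to it and to
  its negative gives zero divisors; likewise for \<open>b\<close> and j.\<close>

lemma ramified_at_infinity_imp_neg:
  assumes ram: "ramified_at_infinity a b" and nz: "a \<noteq> 0" "b \<noteq> 0"
  shows "a < 0" "b < 0"
proof -
  let ?D = "quat_alg (ring_of_type_algebra :: real ring) (of_rat a) (of_rat b)"
  interpret R: cring "ring_of_type_algebra :: real ring" by (rule cring_from_type_algebra)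
  have D: "ring ?D" "Units ?D = carrier ?D - {\<zero>\<^bsub>?D\<^esub>}"
    using ram unfolding ramified_at_infinity_def is_division_ring_def by auto
  interpret D: ring ?D by (rule D)
  have minus: "x \<ominus>\<^bsub>ring_of_type_algebra\<^esub> y = x - (y :: real)" for x y
  proof -
    have "\<ominus>\<^bsub>ring_of_type_algebra\<^esub> y = - y"
      by (rule R.minus_equality) (simp_all add: ring_of_type_algebra_def)
    then show ?thesis by (simp add: a_minus_def ring_of_type_algebra_def)
  qed
  have nozd: False if "x \<noteq> (0, 0, 0, 0)" "y \<noteq> (0, 0, 0, 0)" "x \<otimes>\<^bsub>?D\<^esub> y = (0, 0, 0, 0)" for x y
  proof -
    have z: "\<zero>\<^bsub>?D\<^esub> = (0, 0, 0, 0)" by (simp add: quat_alg_def ring_of_type_algebra_def)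
    have c: "u \<in> carrier ?D" for u by (cases u) (simp add: quat_alg_def ring_of_type_algebra_def)
    have "x \<in> Units ?D" using D(2) c z that(1) by auto
    moreover have "x \<otimes>\<^bsub>?D\<^esub> y = x \<otimes>\<^bsub>?D\<^esub> \<zero>\<^bsub>?D\<^esub>"
      unfolding D.r_null[OF c] unfolding that(3) z ..
    ultimately have "y = \<zero>\<^bsub>?D\<^esub>" using D.Units_l_cancel[OF _ c c] by blast
    then show False using that(2) z by simp
  qed
  show "a < 0"
  proof (rule ccontr)
    assume "\<not> a < 0"
    then have "(of_rat a :: real) \<ge> 0" by simp
    then have "sqrt (of_rat a) * sqrt (of_rat a) = (of_rat a :: real)" by simp
    then show False
      by (intro nozd[of "(sqrt (of_rat a), 1, 0, 0)" "(- sqrt (of_rat a), 1, 0, 0)"])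
        (simp_all add: quat_alg_def minus, simp_all add: ring_of_type_algebra_def)
  qed
  show "b < 0"
  proof (rule ccontr)
    assume "\<not> b < 0"
    then have "(of_rat b :: real) \<ge> 0" by simp
    then have "sqrt (of_rat b) * sqrt (of_rat b) = (of_rat b :: real)" by simp
    then show False
      by (intro nozd[of "(sqrt (of_rat b), 0, 1, 0)" "(- sqrt (of_rat b), 0, 1, 0)"])
        (simp_all add: quat_alg_def minus, simp_all add: ring_of_type_algebra_def)
  qed
qed

lemma pure_quaternion_exists:
  fixes \<delta> :: "'d::quad_param quad_int"
  assumes dom: "legendre_domain (quad_nrm :: 'd quad_int \<Rightarrow> nat)"
    and P: "Factorial_Ring.prime P" and \<delta>: "\<delta>\<^sup>2 = of_int (- P)"
    and PE: "\<And>p. Factorial_Ring.prime p \<Longrightarrow> p dvd 4 * qnm TYPE('d) - qtr TYPE('d) \<Longrightarrow> p = P"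
    and ram: "ramified_exactly_at_and_infinity a b r"
    and r: "Factorial_Ring.prime r" "r > 2" "Legendre (- P) (int r) \<noteq> 1"
  shows "\<exists>x1 x2 x3. quat_nrd a b (0, x1, x2, x3) = of_int (4 * qnm TYPE('d) - qtr TYPE('d))"
proof -
  have ab: "a \<noteq> 0" "b \<noteq> 0" using ram unfolding ramified_exactly_at_and_infinity_def by auto
  have neg: "a < 0" "b < 0"
    using ramified_at_infinity_imp_neg[of a b] ram unfolding ramified_exactly_at_and_infinity_def by auto
  obtain a0 s where a0: "a = of_int a0 * s\<^sup>2" "squarefree a0" "s \<noteq> 0" by (rule rat_squarefree_part[OF ab(1)])
  obtain b0 t where b0: "b = of_int b0 * t\<^sup>2" "squarefree b0" "t \<noteq> 0" by (rule rat_squarefree_part[OF ab(2)])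
  have neg0: "a0 < 0" "b0 < 0"
    using neg a0 b0 zero_less_power2[of s] zero_less_power2[of t] by (auto simp: mult_less_0_iff)
  have "tame_at a0 b0 q" if q: "Factorial_Ring.prime q" "q \<noteq> int r" for q
  proof -
    obtain p where p: "q = int p" "Factorial_Ring.prime p"
      using q(1) by (metis prime_ge_0_int prime_nat_iff_prime zero_le_imp_eq_int nat_int)
    then have "p \<noteq> r" using q by auto
    then have "\<not> ramified_at_prime a b p"
      using ram p(2) unfolding ramified_exactly_at_and_infinity_def by blast
    then have "padic_isotropic p a b"
      using quat_alg_padic_division[OF p(2)] unfolding ramified_at_prime_def by blast
    then have "padic_isotropic p (of_int a0) (of_int b0)"
      using padic_isotropic_scale[OF p(2)] a0 b0 by blast
    then show ?thesis unfolding p(1) by (rule padic_isotropic_imp_tame_at[OF p(2)]) (use a0 b0 in auto)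
  qed
  \<comment> \<open>A vanishing symbol means that \<open>r\<close> is the ramified prime itself, as
    happens for \<open>r = 11\<close>.\<close>
  moreover have "int r = P \<or> \<not> QuadRes (int r) (- P)"
  proof (rule ccontr)
    assume *: "\<not> ?thesis"
    then have "\<not> int r dvd - P" using r(1) P primes_dvd_imp_eq[of "int r" P] by auto
    then show False using * r(3) by (auto simp: Legendre_def cong_0_iff)
  qed
  ultimately have "conic_isotropic (of_int a0) (of_int b0 :: 'd quad_int)"
    using legendre_over_quadratic_field[OF dom a0(2) b0(2) P \<delta> PE r(1,2)] by blast
  from conic_isotropic_imp_pure_quaternion[OF this neg0] obtain x1 x2 x3
    where "quat_nrd (of_int a0) (of_int b0) (0, x1, x2, x3) = of_int (4 * qnm TYPE('d) - qtr TYPE('d))" by blast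
  moreover have "quat_nrd a b (0, x1 / s, x2 / t, x3 / (s * t)) = quat_nrd (of_int a0) (of_int b0) (0, x1, x2, x3)"
    using a0 b0 by (simp add: power_divide power_mult_distrib)
  ultimately show ?thesis by metis
qed

lemma no_pure_quaternion:
  assumes ram: "ramified_exactly_at_and_infinity a b r"
    and r: "Factorial_Ring.prime r" "r > 2" "Legendre (- d) (int r) = 1"
  shows "quat_nrd a b (0, x1, x2, x3) \<noteq> of_int d"
proof
  assume E: "quat_nrd a b (0, x1, x2, x3) = of_int d"
  have d: "\<not> int r dvd - d" "QuadRes (int r) (- d)"
    using r(3) by (auto simp: Legendre_def cong_0_iff split: if_splits)
  then obtain s where s: "s \<in> padic_Cauchy r" "s * s - (\<lambda>_. of_int (- d)) \<in> padic_null r"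
    using hensel_square_root[OF r(1,2)] by blast
  have "s * s - (\<lambda>_. of_int (- d)) = s * s + (\<lambda>_. of_int d)" by (simp add: fun_eq_iff)
  with s(2) have "s * s + (\<lambda>_. of_int d) \<in> padic_null r" by (simp only:)
  moreover have "of_int d \<noteq> (0 :: rat)" using d(1) by auto
  moreover have "ramified_at_prime a b r"
    using ram r(1) unfolding ramified_exactly_at_and_infinity_def by blast
  ultimately show False
    using quat_alg_padic_zero_divisor[OF r(1) _ s(1) _ E] unfolding ramified_at_prime_def by blast
qed

section \<open>Quaternion integers of norm 3\<close>

lemma quat_alg_rat_abelian_monoid: "abelian_monoid (quat_alg_rat a b)"
  by (rule abelian_monoidI) (auto simp: quat_alg_def rat_structure_simps)

lemma quat_eval_degree_0:
  assumes "Polynomial.degree f = 0"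
  shows "quat_eval a b f x = (Polynomial.coeff f 0, 0, 0, 0)"
proof -
  interpret abelian_monoid "quat_alg_rat a b" by (rule quat_alg_rat_abelian_monoid)
  have c: "u \<in> carrier (quat_alg_rat a b)" for u
    by (cases u) (simp add: quat_alg_def rat_structure_simps)
  show ?thesis
    by (cases x) (simp add: quat_eval_def assms c nat_pow_def, simp add: quat_alg_def rat_structure_simps)
qed

lemma quat_eval_degree_1:
  assumes "Polynomial.degree f = 1"
  shows "quat_eval a b f (x0, x1, x2, x3) = (Polynomial.coeff f 0 + Polynomial.coeff f 1 * x0,
    Polynomial.coeff f 1 * x1, Polynomial.coeff f 1 * x2, Polynomial.coeff f 1 * x3)"
proof -
  interpret abelian_monoid "quat_alg_rat a b" by (rule quat_alg_rat_abelian_monoid)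
  have c: "u \<in> carrier (quat_alg_rat a b)" for u
    by (cases u) (simp add: quat_alg_def rat_structure_simps)
  show ?thesis
    by (simp add: quat_eval_def assms c nat_pow_def, simp add: quat_alg_def rat_structure_simps)
qed

lemma quat_eval_degree_2:
  assumes "Polynomial.degree f = 2"
  shows "quat_eval a b f (x0, x1, x2, x3) =
   (Polynomial.coeff f 0 + Polynomial.coeff f 1 * x0
      + Polynomial.coeff f 2 * (x0 * x0 + a * x1 * x1 + b * x2 * x2 - a * b * x3 * x3),
    (Polynomial.coeff f 1 + Polynomial.coeff f 2 * (2 * x0)) * x1,
    (Polynomial.coeff f 1 + Polynomial.coeff f 2 * (2 * x0)) * x2,
    (Polynomial.coeff f 1 + Polynomial.coeff f 2 * (2 * x0)) * x3)"
proof -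
  interpret abelian_monoid "quat_alg_rat a b" by (rule quat_alg_rat_abelian_monoid)
  have c: "u \<in> carrier (quat_alg_rat a b)" for u
    by (cases u) (simp add: quat_alg_def rat_structure_simps)
  show ?thesis
    by (simp add: quat_eval_def assms c nat_pow_def numeral_2_eq_2,
        simp add: quat_alg_def rat_structure_simps algebra_simps)
qed

text \<open>A quaternion outside the centre satisfies no polynomial of degree below 2, so its
  minimal polynomial is the reduced characteristic polynomial \<open>m\<close>, whose coefficients
  are given by trace and norm.\<close>

lemma is_quat_integer_iff:
  assumes nz: "x1 \<noteq> 0 \<or> x2 \<noteq> 0 \<or> x3 \<noteq> 0"
  shows "is_quat_integer a b (x0, x1, x2, x3) \<longleftrightarrow>
    2 * x0 \<in> \<int> \<and> quat_nrd a b (x0, x1, x2, x3) \<in> \<int>"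
proof -
  define x where "x = (x0, x1, x2, x3)"
  define n where "n = quat_nrd a b x"
  define m where "m = [:n, - (2 * x0), 1:]"
  have zero: "\<zero>\<^bsub>quat_alg_rat a b\<^esub> = (0, 0, 0, 0)" by (simp add: quat_alg_def rat_structure_simps)
  have dm: "Polynomial.degree m = 2" by (simp add: m_def)
  have cm: "Polynomial.coeff m 0 = n" "Polynomial.coeff m 1 = - (2 * x0)" "Polynomial.coeff m 2 = 1"
    by (simp_all add: m_def numeral_2_eq_2)
  have em: "quat_eval a b m x = \<zero>\<^bsub>quat_alg_rat a b\<^esub>"
    unfolding x_def quat_eval_degree_2[OF dm] cm zero by (simp add: n_def x_def power2_eq_square)
  have deg: "Polynomial.degree g \<ge> 2" if "g \<noteq> 0" "quat_eval a b g x = \<zero>\<^bsub>quat_alg_rat a b\<^esub>" for g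
  proof (rule ccontr)
    assume "\<not> ?thesis"
    then consider "Polynomial.degree g = 0" | "Polynomial.degree g = 1" by linarith
    then show False
    proof cases
      case 1
      then show False using that quat_eval_degree_0[OF 1, of a b x] leading_coeff_0_iff[of g]
        by (simp add: zero)
    next
      case 2
      then show False using that quat_eval_degree_1[OF 2, of a b x0 x1 x2 x3] leading_coeff_0_iff[of g] nz
        by (auto simp: zero x_def)
    qed
  qed
  show ?thesis
  proof
    assume "is_quat_integer a b (x0, x1, x2, x3)"
    then obtain f where lf: "Polynomial.lead_coeff f = 1" and ef: "quat_eval a b f x = \<zero>\<^bsub>quat_alg_rat a b\<^esub>"
      and min: "\<forall>g. g \<noteq> 0 \<longrightarrow> quat_eval a b g x = \<zero>\<^bsub>quat_alg_rat a b\<^esub> \<longrightarrow>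
        Polynomial.degree f \<le> Polynomial.degree g"
      and int: "\<forall>n. Polynomial.coeff f n \<in> \<int>"
      unfolding is_quat_integer_def is_quat_min_poly_def x_def by blast
    have "m \<noteq> 0" by (simp add: m_def)
    then have "Polynomial.degree f \<le> 2" using min em dm by metis
    moreover have "f \<noteq> 0" using lf by auto
    ultimately have df: "Polynomial.degree f = 2" using deg ef by (meson le_antisym)
    then have c2: "Polynomial.coeff f 2 = 1" using lf by simp
    have e: "Polynomial.coeff f 1 + 2 * x0 = 0"
      "Polynomial.coeff f 0 + Polynomial.coeff f 1 * x0
        + (x0 * x0 + a * x1 * x1 + b * x2 * x2 - a * b * x3 * x3) = 0"
      using ef nz unfolding x_def quat_eval_degree_2[OF df] zero c2 by auto
    have "2 * x0 = - Polynomial.coeff f 1" using e(1) by simp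
    moreover have c1: "Polynomial.coeff f 1 = - (2 * x0)" using e(1) by (simp add: eq_neg_iff_add_eq_0)
    have "n = Polynomial.coeff f 0"
      using e(2) unfolding c1 by (simp add: n_def x_def power2_eq_square algebra_simps)
    ultimately show "2 * x0 \<in> \<int> \<and> quat_nrd a b (x0, x1, x2, x3) \<in> \<int>"
      using int by (simp add: n_def x_def)
  next
    assume *: "2 * x0 \<in> \<int> \<and> quat_nrd a b (x0, x1, x2, x3) \<in> \<int>"
    have "is_quat_min_poly a b m x"
      unfolding is_quat_min_poly_def using em deg dm by (simp add: cm)
    moreover have "Polynomial.coeff m i \<in> \<int>" for i
      using * by (simp add: m_def coeff_pCons n_def x_def split: nat.split)
    ultimately show "is_quat_integer a b (x0, x1, x2, x3)"
      unfolding is_quat_integer_def x_def by blast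
  qed
qed

text \<open>Excludes central elements of reduced norm 3, which have linear minimal
  polynomials.\<close>

lemma rat_square_neq_3: "(q :: rat)\<^sup>2 \<noteq> 3"
proof
  assume q: "q\<^sup>2 = 3"
  obtain n d where nd: "quotient_of q = (n, d)" by (metis surj_pair)
  have d: "d > 0" by (rule quotient_of_denom_pos[OF nd])
  have "q = of_int n / of_int d" by (rule quotient_of_div[OF nd])
  then have n: "of_int n = q * of_int d" using d by simp
  have "(of_int (n\<^sup>2) :: rat) = q\<^sup>2 * of_int (d\<^sup>2)"
    unfolding of_int_power n by (simp add: power_mult_distrib)
  then have "(of_int (n\<^sup>2) :: rat) = of_int (3 * d\<^sup>2)" using q by simp
  then have e: "n\<^sup>2 = 3 * d\<^sup>2" by (simp only: of_int_eq_iff)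
  have p3: "Factorial_Ring.prime (3 :: int)" by simp
  have "3 dvd n\<^sup>2" unfolding e by simp
  then have "3 dvd n" using p3 prime_dvd_power by blast
  then obtain k where k: "n = 3 * k" by blast
  then have "3 * k\<^sup>2 = d\<^sup>2" using e by (simp add: power2_eq_square)
  then have "3 dvd d\<^sup>2" by (metis dvd_triv_left)
  then have "3 dvd d" using p3 prime_dvd_power by blast
  with \<open>3 dvd n\<close> have "is_unit (3 :: int)"
    using quotient_of_coprime[OF nd] coprime_common_divisor by blast
  then show False by simp
qed

lemma not_outlier_3_iff:
  assumes neg: "a < 0" "b < 0"
  shows "\<not> is_outlier a b 3 \<longleftrightarrow>
    (\<exists>d \<in> {3, 8, 11}. \<exists>x1 x2 x3. quat_nrd a b (0, x1, x2, x3) = of_int d)"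
proof
  assume "\<not> is_outlier a b 3"
  then obtain x0 x1 x2 x3 where int: "is_quat_integer a b (x0, x1, x2, x3)"
    and nrd: "quat_nrd a b (x0, x1, x2, x3) = 3"
    unfolding is_outlier_def by (auto simp del: quat_nrd.simps)
  have nz: "x1 \<noteq> 0 \<or> x2 \<noteq> 0 \<or> x3 \<noteq> 0" using nrd rat_square_neq_3[of x0] by auto
  then have "2 * x0 \<in> \<int>" using int is_quat_integer_iff by blast
  then obtain t :: int where t: "2 * x0 = of_int t" by (auto elim: Ints_cases)
  have scale: "quat_nrd a b (0, c * x1, c * x2, c * x3) = c\<^sup>2 * (3 - x0\<^sup>2)" for c
  proof -
    have "quat_nrd a b (0, c * x1, c * x2, c * x3) = c\<^sup>2 * quat_nrd a b (0, x1, x2, x3)"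
      by (simp add: power_mult_distrib algebra_simps)
    also have "quat_nrd a b (0, x1, x2, x3) = 3 - x0\<^sup>2" using nrd by (simp add: algebra_simps)
    finally show ?thesis .
  qed
  have x0: "x0 = of_int t / 2" using t by simp
  have "quat_nrd a b (0, 1 * x1, 1 * x2, 1 * x3) > 0" using nz by (intro quat_nrd_pos neg) auto
  then have "(of_int (t\<^sup>2) :: rat) < of_int 12" unfolding scale x0 by (simp add: power_divide)
  then have t2: "t\<^sup>2 < 12" by (simp only: of_int_less_iff)
  have "t \<in> {-3, -2, -1, 0, 1, 2, 3}"
  proof -
    have "\<bar>t\<bar>\<^sup>2 < 4\<^sup>2" using t2 by simp
    then have "\<bar>t\<bar> < 4" by (rule power2_less_imp_less) simp
    then show ?thesis by auto
  qed
  then have "t\<^sup>2 \<in> {0, 1, 4, 9}" by auto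
  \<comment> \<open>Trace 0 would give 12 = 4 * 3; there the pure part is not doubled and has norm 3
    already.\<close>
  then have "(4 * (3 - x0\<^sup>2) \<in> {3, 8, 11}) \<or> 1 * (3 - x0\<^sup>2) = 3"
    unfolding x0 power_divide by (auto simp flip: of_int_power)
  then have "\<exists>c. c\<^sup>2 * (3 - x0\<^sup>2) \<in> {3, 8, 11}"
  proof
    assume "4 * (3 - x0\<^sup>2) \<in> {3, 8, 11}"
    then show ?thesis by (intro exI[of _ 2]) simp
  next
    assume "1 * (3 - x0\<^sup>2) = 3"
    then show ?thesis by (intro exI[of _ 1]) simp
  qed
  then have "\<exists>c. quat_nrd a b (0, c * x1, c * x2, c * x3) \<in> {3, 8, 11}" unfolding scale .
  then show "\<exists>d \<in> {3, 8, 11}. \<exists>x1 x2 x3. quat_nrd a b (0, x1, x2, x3) = of_int d"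
    by (auto simp del: quat_nrd.simps)
next
  assume "\<exists>d \<in> {3, 8, 11}. \<exists>x1 x2 x3. quat_nrd a b (0, x1, x2, x3) = of_int d"
  then obtain d x1 x2 x3 where d: "d \<in> {3, 8, 11 :: int}" "quat_nrd a b (0, x1, x2, x3) = of_int d" by blast
  have nz: "x1 \<noteq> 0 \<or> x2 \<noteq> 0 \<or> x3 \<noteq> 0" using d by auto
  have e: "quat_nrd a b (y0, x1 / 2, x2 / 2, x3 / 2) = y0\<^sup>2 + of_int d / 4" for y0
    unfolding d(2)[symmetric] by (simp add: power_divide)
  \<comment> \<open>Half the trace: (3/2)^2 + 3/4 = 1^2 + 8/4 = (1/2)^2 + 11/4 = 3.\<close>
  have "\<exists>y0. 2 * y0 \<in> \<int> \<and> y0\<^sup>2 + of_int d / 4 = (3 :: rat)"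
  proof -
    consider "d = 3" | "d = 8" | "d = 11" using d(1) by blast
    then show ?thesis
    proof cases
      case 1
      show ?thesis by (rule exI[of _ "3 / 2"]) (simp add: 1 power_divide)
    next
      case 2
      show ?thesis by (rule exI[of _ 1]) (simp add: 2)
    next
      case 3
      show ?thesis by (rule exI[of _ "1 / 2"]) (simp add: 3 power_divide)
    qed
  qed
  then obtain y0 where y0: "2 * y0 \<in> \<int>" "y0\<^sup>2 + of_int d / 4 = (3 :: rat)" by blast
  have "is_quat_integer a b (y0, x1 / 2, x2 / 2, x3 / 2)"
    using nz y0 by (subst is_quat_integer_iff) (simp_all only: e, simp_all)
  moreover have "quat_nrd a b (y0, x1 / 2, x2 / 2, x3 / 2) = of_nat 3" using e y0 by simp
  ultimately show "\<not> is_outlier a b 3"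
    unfolding is_outlier_def by (auto simp: quat_alg_def rat_structure_simps simp del: quat_nrd.simps)
qed

theorem outlier_3_iff:
  assumes ram: "ramified_exactly_at_and_infinity a b r" and r: "Factorial_Ring.prime r" "r > 3"
  shows "is_outlier a b 3 \<longleftrightarrow>
    Legendre (- 3) (int r) = 1 \<and> Legendre (- 11) (int r) = 1 \<and> Legendre (- 2) (int r) = 1"
proof -
  have r2: "r > 2" using r by simp
  have neg: "a < 0" "b < 0"
    using ramified_at_infinity_imp_neg[of a b] ram unfolding ramified_exactly_at_and_infinity_def by auto
  \<comment> \<open>\<open>Quad (- 1) 2\<close> is \<open>2 * \<omega> - 1\<close>, the square root
    of the discriminant.\<close>
  have "(\<exists>x1 x2 x3. quat_nrd a b (0, x1, x2, x3) = of_int 3) \<longleftrightarrow> Legendre (- 3) (int r) \<noteq> 1"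
    using pure_quaternion_exists[OF legendre_domain_disc3 _ _ _ ram r(1) r2, of 3 "Quad (- 1) 2"]
      no_pure_quaternion[OF ram r(1) r2, of 3]
    by (auto simp: qtr_qnm_defs quad_calc power2_eq_square primes_dvd_imp_eq simp del: quat_nrd.simps)
  moreover have "(\<exists>x1 x2 x3. quat_nrd a b (0, x1, x2, x3) = of_int 11) \<longleftrightarrow> Legendre (- 11) (int r) \<noteq> 1"
    using pure_quaternion_exists[OF legendre_domain_disc11 _ _ _ ram r(1) r2, of 11 "Quad (- 1) 2"]
      no_pure_quaternion[OF ram r(1) r2, of 11]
    by (auto simp: qtr_qnm_defs quad_calc power2_eq_square primes_dvd_imp_eq simp del: quat_nrd.simps)
  \<comment> \<open>The discriminant is -8, but the ramified prime is 2; halving a pure quaternion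
    passes from norm 8 to norm 2.\<close>
  moreover have "(\<exists>x1 x2 x3. quat_nrd a b (0, x1, x2, x3) = of_int 8) \<longleftrightarrow> Legendre (- 2) (int r) \<noteq> 1"
  proof
    assume "\<exists>x1 x2 x3. quat_nrd a b (0, x1, x2, x3) = of_int 8"
    then obtain x1 x2 x3 where x: "quat_nrd a b (0, x1, x2, x3) = 8" by auto
    have "quat_nrd a b (0, x1 / 2, x2 / 2, x3 / 2) = quat_nrd a b (0, x1, x2, x3) / 4"
      by (simp add: power_divide)
    also have "\<dots> = of_int 2" unfolding x by simp
    finally show "Legendre (- 2) (int r) \<noteq> 1" using no_pure_quaternion[OF ram r(1) r2, of 2] by blast
  next
    have "p = 2" if "Factorial_Ring.prime p" "p dvd 8" for p :: int
    proof -
      have "p dvd 2 ^ 3" using that(2) by simp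
      then have "p dvd 2" using that(1) prime_dvd_power by blast
      then show ?thesis using that(1) primes_dvd_imp_eq[of p 2] by simp
    qed
    moreover assume "Legendre (- 2) (int r) \<noteq> 1"
    ultimately show "\<exists>x1 x2 x3. quat_nrd a b (0, x1, x2, x3) = of_int 8"
      using pure_quaternion_exists[OF legendre_domain_disc8 _ _ _ ram r(1) r2, of 2 "Quad 0 1"]
      by (auto simp: qtr_qnm_defs quad_calc power2_eq_square simp del: quat_nrd.simps)
  qed
  ultimately show ?thesis using not_outlier_3_iff[OF neg] by blast
qed

section \<open>Euler products\<close>

text \<open>Partial summation, needed for the tails of the L-series and for Monsky's
  weights.\<close>

lemma abel_summation_bound:
  fixes f b :: "nat \<Rightarrow> real"
  assumes S: "\<And>n. \<bar>\<Sum>k=m..<n. f k\<bar> \<le> C"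
    and dec: "\<And>k. k \<ge> m \<Longrightarrow> b (Suc k) \<le> b k" and nn: "\<And>k. k \<ge> m \<Longrightarrow> 0 \<le> b k"
  shows "\<bar>\<Sum>k=m..<n. f k * b k\<bar> \<le> C * b m"
proof (cases "m \<le> n")
  case True
  define T where "T n = (\<Sum>k=m..<n. f k)" for n
  have C: "C \<ge> 0" using S[of m] by simp
  have id: "(\<Sum>k=m..<n. f k * b k) = T n * b n + (\<Sum>k=m..<n. T (Suc k) * (b k - b (Suc k)))"
    using True
  proof (induction n rule: dec_induct)
    case (step n)
    then show ?case by (simp add: T_def algebra_simps)
  qed (simp add: T_def)
  have "\<bar>\<Sum>k=m..<n. T (Suc k) * (b k - b (Suc k))\<bar> \<le> (\<Sum>k=m..<n. \<bar>T (Suc k) * (b k - b (Suc k))\<bar>)"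
    by (rule sum_abs)
  also have "\<dots> \<le> (\<Sum>k=m..<n. C * (b k - b (Suc k)))"
  proof (rule sum_mono)
    fix k assume "k \<in> {m..<n}"
    then show "\<bar>T (Suc k) * (b k - b (Suc k))\<bar> \<le> C * (b k - b (Suc k))"
      using S[of "Suc k"] dec[of k] by (simp add: abs_mult T_def mult_right_mono)
  qed
  also have "\<dots> = C * (b m - b n)"
    using True by (induction n rule: dec_induct) (simp_all add: sum_distrib_left[symmetric] algebra_simps)
  finally have 1: "\<bar>\<Sum>k=m..<n. T (Suc k) * (b k - b (Suc k))\<bar> \<le> C * (b m - b n)" .
  have "\<bar>T n * b n\<bar> \<le> C * b n"
    using S[of n] nn[of n] True by (simp add: abs_mult T_def mult_right_mono)
  with 1 show ?thesis unfolding id by (simp add: algebra_simps)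
next
  case False
  then show ?thesis using S[of m] nn[of m] by simp
qed

text \<open>Index 0 contributes nothing, because \<open>0 powr x = 0\<close>.\<close>

definition dirichlet_series :: "(nat \<Rightarrow> real) \<Rightarrow> real \<Rightarrow> real" where
  "dirichlet_series f s = (\<Sum>n. f n * real n powr (- s))"

lemma dirichlet_series_abs_summable:
  assumes f: "\<And>n. \<bar>f n\<bar> \<le> 1" and s: "s > 1"
  shows "summable (\<lambda>n. \<bar>f n * real n powr (- s)\<bar>)"
proof (rule summable_comparison_test')
  show "summable (\<lambda>n. real n powr (- s))" using s by (simp add: summable_real_powr_iff)
  fix n :: nat
  show "norm \<bar>f n * real n powr (- s)\<bar> \<le> real n powr (- s)"
    using f[of n] by (simp add: abs_mult mult_left_le_one_le)
qed

lemma abs_summable_imp_infsum: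
  fixes g :: "nat \<Rightarrow> real"
  assumes "summable (\<lambda>n. \<bar>g n\<bar>)"
  shows "g summable_on A" "infsum g UNIV = suminf g"
proof -
  have u: "(\<lambda>n. norm (g n)) summable_on UNIV"
    using assms by (intro norm_summable_imp_summable_on) simp
  then have gs: "g summable_on UNIV" by (rule abs_summable_summable)
  then show "g summable_on A" using summable_on_subset_banach by blast
  from gs have "(g has_sum infsum g UNIV) UNIV" by simp
  then have "g sums infsum g UNIV" by (rule has_sum_imp_sums)
  then show "infsum g UNIV = suminf g" by (simp add: sums_iff)
qed

locale completely_multiplicative =
  fixes f :: "nat \<Rightarrow> real"
  assumes f_1: "f 1 = 1" and f_mult: "f (m * n) = f m * f n" and f_le_1: "\<bar>f n\<bar> \<le> 1"
begin

abbreviation g :: "real \<Rightarrow> nat \<Rightarrow> real" where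
  "g s n \<equiv> f n * real n powr (- s)"

lemma g_mult: "g s (m * n) = g s m * g s n"
  by (simp add: f_mult powr_mult)

lemma g_summable: "s > 1 \<Longrightarrow> g s summable_on A"
  using abs_summable_imp_infsum(1)[OF dirichlet_series_abs_summable[of f s]] f_le_1 by blast

text \<open>The survivors divisible by a new prime \<open>q\<close> are exactly \<open>q\<close>
  times the survivors, so by complete multiplicativity each prime contributes a factor
  \<open>1 - g s q\<close>.\<close>

lemma sieve:
  assumes s: "s > 1" and P: "finite P" "\<And>p. p \<in> P \<Longrightarrow> Factorial_Ring.prime p"
  shows "infsum (g s) {n. n > 0 \<and> (\<forall>p\<in>P. \<not> p dvd n)} = (\<Prod>p\<in>P. 1 - g s p) * infsum (g s) {0<..}"
  using P
proof (induction rule: finite_induct)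
  case empty
  then show ?case by (simp add: greaterThan_def)
next
  case (insert q P)
  let ?A = "{n. n > 0 \<and> (\<forall>p\<in>P. \<not> p dvd n)}"
  have q: "Factorial_Ring.prime q" using insert by blast
  have q0: "q > 0" using q prime_gt_0_nat by blast
  have im: "{n. n > 0 \<and> (\<forall>p\<in>insert q P. \<not> p dvd n)} = ?A - (\<lambda>m. q * m) ` ?A"
  proof (intro Set.set_eqI iffI)
    fix n assume n: "n \<in> ?A - (\<lambda>m. q * m) ` ?A"
    have "\<not> q dvd n"
    proof
      assume "q dvd n"
      then obtain m where m: "n = q * m" by blast
      then have "m \<in> ?A" using n by auto
      then show False using n m by blast
    qed
    then show "n \<in> {n. n > 0 \<and> (\<forall>p\<in>insert q P. \<not> p dvd n)}" using n by auto
  qed auto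
  have sub: "(\<lambda>m. q * m) ` ?A \<subseteq> ?A"
  proof safe
    fix m p assume m: "m > 0" "\<forall>p\<in>P. \<not> p dvd m" and p: "p \<in> P" "p dvd q * m"
    have "Factorial_Ring.prime p" using insert p by blast
    then have "p dvd q" using m p by (auto simp: prime_dvd_mult_iff)
    then have "p = q" using \<open>Factorial_Ring.prime p\<close> q primes_dvd_imp_eq by blast
    then show False using p insert by blast
  qed (use q0 in auto)
  have "infsum (g s) ((\<lambda>m. q * m) ` ?A) = infsum (g s \<circ> (\<lambda>m. q * m)) ?A"
    using q0 by (intro infsum_reindex) (auto simp: inj_on_def)
  also have "\<dots> = g s q * infsum (g s) ?A"
    unfolding o_def g_mult by (rule infsum_cmult_right') 
  finally have "infsum (g s) (?A - (\<lambda>m. q * m) ` ?A) = infsum (g s) ?A - g s q * infsum (g s) ?A"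
    using infsum_Diff[OF g_summable[OF s] g_summable[OF s] sub] by simp
  also have "\<dots> = (1 - g s q) * infsum (g s) ?A" by (simp add: algebra_simps)
  also have "infsum (g s) ?A = (\<Prod>p\<in>P. 1 - g s p) * infsum (g s) {0<..}"
    using insert by blast
  finally show ?case unfolding im using insert by (simp add: mult.assoc)
qed

lemma infsum_pos_eq_series:
  assumes s: "s > 1"
  shows "infsum (g s) {0<..} = dirichlet_series f s"
proof -
  have "infsum (g s) {0<..} = infsum (g s) UNIV" by (rule infsum_cong_neutral) auto
  also have "\<dots> = dirichlet_series f s" unfolding dirichlet_series_def
    using abs_summable_imp_infsum(2)[OF dirichlet_series_abs_summable[of f s]] f_le_1 s by blast
  finally show ?thesis .
qed

text \<open>After sieving by the primes below \<open>N\<close>, only 1 and integers from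
  \<open>N\<close> on remain, so the deviation from 1 is bounded by a tail of the series of
  \<open>n powr (- s)\<close>.\<close>

lemma euler_product:
  assumes s: "s > 1"
  shows "(\<lambda>N. (\<Prod>p | Factorial_Ring.prime p \<and> p < N. 1 - g s p) * dirichlet_series f s) \<longlonglongrightarrow> 1"
proof (rule LIM_zero_cancel, rule Lim_null_comparison)
  let ?h = "\<lambda>n. real n powr (- s)"
  have hs: "summable ?h" using s by (simp add: summable_real_powr_iff)
  have "(\<lambda>N. suminf ?h - (\<Sum>n<N. ?h n)) \<longlonglongrightarrow> suminf ?h - suminf ?h"
    using summable_LIMSEQ[OF hs] by (intro tendsto_intros)
  then show "(\<lambda>N. suminf ?h - (\<Sum>n<N. ?h n)) \<longlonglongrightarrow> 0" by simp
  have habs: "summable (\<lambda>n. \<bar>?h n\<bar>)" using hs by simp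
  have "\<bar>(\<Prod>p | Factorial_Ring.prime p \<and> p < N. 1 - g s p) * dirichlet_series f s - 1\<bar>
      \<le> suminf ?h - (\<Sum>n<N. ?h n)" if N: "N \<ge> 2" for N
  proof -
    let ?P = "{p. Factorial_Ring.prime p \<and> p < N}"
    let ?A = "{n. n > 0 \<and> (\<forall>p\<in>?P. \<not> p dvd n)}"
    have A: "?A \<subseteq> insert 1 {N..}"
    proof
      fix n assume n: "n \<in> ?A"
      show "n \<in> insert 1 {N..}"
      proof (cases "n = 1")
        case False
        then obtain p where p: "Factorial_Ring.prime p" "p dvd n" using prime_factor_nat by blast
        then have "\<not> p < N" "p \<le> n" using n by (auto dest: dvd_imp_le)
        then show ?thesis by simp
      qed simp
    qed
    have 1: "1 \<in> ?A" by (auto simp: prime_gt_1_nat)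
    have "infsum (g s) ?A = infsum (g s) (?A - {1}) + g s 1"
      using infsum_Diff[OF g_summable[OF s, of ?A] g_summable[OF s, of "{1}"]] 1 by simp
    then have "\<bar>infsum (g s) ?A - 1\<bar> = \<bar>infsum (g s) (?A - {1})\<bar>" using f_1 by simp
    also have "\<dots> \<le> infsum (\<lambda>n. \<bar>g s n\<bar>) (?A - {1})"
      using norm_infsum_bound[of "g s" "?A - {1}"] abs_summable_imp_infsum(1)[of "\<lambda>n. \<bar>g s n\<bar>"]
        dirichlet_series_abs_summable[of f s] f_le_1 s by simp
    also have "\<dots> \<le> infsum ?h {N..}"
    proof (rule infsum_mono_neutral)
      show "(\<lambda>n. \<bar>g s n\<bar>) summable_on ?A - {1}"
        using abs_summable_imp_infsum(1)[of "\<lambda>n. \<bar>g s n\<bar>"] dirichlet_series_abs_summable[of f s] f_le_1 s by simp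
      show "?h summable_on {N..}" by (rule abs_summable_imp_infsum(1)[OF habs])
    qed (use A f_le_1 in \<open>auto simp: abs_mult mult_left_le_one_le\<close>)
    also have "infsum ?h {N..} = infsum ?h UNIV - infsum ?h {..<N}"
      using infsum_Diff[OF abs_summable_imp_infsum(1)[OF habs] abs_summable_imp_infsum(1)[OF habs],
          of "{..<N}" UNIV] by (simp add: Compl_eq_Diff_UNIV[symmetric] not_less atLeast_def lessThan_def Collect_neg_eq[symmetric])
    also have "\<dots> = suminf ?h - (\<Sum>n<N. ?h n)" using abs_summable_imp_infsum(2)[OF habs] by simp
    finally have "\<bar>infsum (g s) ?A - 1\<bar> \<le> suminf ?h - (\<Sum>n<N. ?h n)" .
    moreover have "infsum (g s) ?A = (\<Prod>p\<in>?P. 1 - g s p) * dirichlet_series f s"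
      unfolding infsum_pos_eq_series[OF s, symmetric] by (rule sieve[OF s]) auto
    ultimately show ?thesis by (simp only:)
  qed
  then show "\<forall>\<^sub>F N in sequentially. norm ((\<Prod>p | Factorial_Ring.prime p \<and> p < N. 1 - g s p)
      * dirichlet_series f s - 1) \<le> suminf ?h - (\<Sum>n<N. ?h n)"
    unfolding real_norm_def by (intro eventually_sequentiallyI[of 2]) blast
qed

lemma g_prime_le:
  assumes s: "s > 1" and p: "Factorial_Ring.prime p"
  shows "\<bar>g s p\<bar> \<le> 1 / real p" "\<bar>g s p\<bar> \<le> 1 / 2"
proof -
  have p2: "real p \<ge> 2" using prime_ge_2_nat[OF p] by simp
  have "\<bar>g s p\<bar> \<le> real p powr (- s)" using f_le_1[of p] by (simp add: abs_mult mult_left_le_one_le)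
  also have "\<dots> \<le> real p powr (- 1)" using s p2 by (intro powr_mono) auto
  also have "\<dots> = 1 / real p" using p2 by (simp add: powr_minus_divide)
  finally show 1: "\<bar>g s p\<bar> \<le> 1 / real p" .
  also have "\<dots> \<le> 1 / 2" using p2 by (simp add: field_simps)
  finally show "\<bar>g s p\<bar> \<le> 1 / 2" .
qed

lemma dirichlet_series_pos:
  assumes s: "s > 1"
  shows "dirichlet_series f s > 0"
proof -
  have "\<forall>\<^sub>F N in sequentially. (\<Prod>p | Factorial_Ring.prime p \<and> p < N. 1 - g s p) * dirichlet_series f s > 0"
    using euler_product[OF s] by (rule order_tendstoD) simp
  then obtain N where "(\<Prod>p | Factorial_Ring.prime p \<and> p < N. 1 - g s p) * dirichlet_series f s > 0"
    by (auto simp: eventually_sequentially)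
  moreover have "(\<Prod>p | Factorial_Ring.prime p \<and> p < N. 1 - g s p) > 0"
  proof (rule prod_pos)
    fix p assume "p \<in> {p. Factorial_Ring.prime p \<and> p < N}"
    then show "0 < 1 - g s p" using g_prime_le(2)[OF s, of p] by auto
  qed
  ultimately show ?thesis by (simp add: zero_less_mult_iff)
qed

definition prime_sum :: "real \<Rightarrow> real" where
  "prime_sum s = (\<Sum>\<^sub>\<infinity>p | Factorial_Ring.prime p. g s p)"

lemma prime_sum_limit:
  assumes s: "s > 1"
  shows "(\<lambda>N. \<Sum>p | Factorial_Ring.prime p \<and> p < N. g s p) \<longlonglongrightarrow> prime_sum s"
proof -
  let ?h = "\<lambda>n. if Factorial_Ring.prime n then g s n else 0"
  have abs: "summable (\<lambda>n. \<bar>?h n\<bar>)"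
    using dirichlet_series_abs_summable[of f s] f_le_1 s
    by (rule_tac summable_comparison_test'[of "\<lambda>n. \<bar>g s n\<bar>" 0]) auto
  have "prime_sum s = infsum ?h UNIV" unfolding prime_sum_def by (rule infsum_cong_neutral) auto
  also have "\<dots> = suminf ?h" by (rule abs_summable_imp_infsum(2)[OF abs])
  finally have "prime_sum s = suminf ?h" .
  moreover have "summable ?h" by (rule summable_rabs_cancel[OF abs])
  then have "(\<lambda>N. \<Sum>n<N. ?h n) \<longlonglongrightarrow> suminf ?h" by (rule summable_LIMSEQ)
  moreover have "(\<Sum>n<N. ?h n) = (\<Sum>p | Factorial_Ring.prime p \<and> p < N. g s p)" for N
    by (rule sum.mono_neutral_cong_right) auto
  ultimately show ?thesis by simp
qed

text \<open>The error is the contribution of the higher prime powers to the Euler product.\<close>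

lemma prime_sum_ln_series:
  assumes s: "s > 1"
  shows "\<bar>prime_sum s - ln (dirichlet_series f s)\<bar> \<le> 2 * (\<Sum>n. 1 / (real n)\<^sup>2)"
proof -
  let ?P = "\<lambda>N. {p. Factorial_Ring.prime p \<and> p < N}"
  let ?L = "dirichlet_series f s"
  have sq: "summable (\<lambda>n. 1 / (real n)\<^sup>2)"
    using inverse_power_summable[of 2, where 'a = real] by (simp add: inverse_eq_divide)
  have pos: "0 < 1 - g s p" if "Factorial_Ring.prime p" for p using g_prime_le(2)[OF s that] by auto
  have "(\<lambda>N. ln ((\<Prod>p\<in>?P N. 1 - g s p) * ?L)) \<longlonglongrightarrow> ln 1"
    by (intro tendsto_ln euler_product s) simp
  moreover have "ln ((\<Prod>p\<in>?P N. 1 - g s p) * ?L) = ln (\<Prod>p\<in>?P N. 1 - g s p) + ln ?L" for N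
    using pos dirichlet_series_pos[OF s] by (intro ln_mult_pos prod_pos) auto
  ultimately have lim: "(\<lambda>N. ln (\<Prod>p\<in>?P N. 1 - g s p) + ln ?L) \<longlonglongrightarrow> 0" by simp
  \<comment> \<open>A logarithm tending to 0 is inserted, so that for finite \<open>N\<close> only
    the sum of \<open>ln (1 - g s p) + g s p\<close> remains to be bounded.\<close>
  have lim2: "(\<lambda>N. \<bar>(\<Sum>p\<in>?P N. g s p) + (ln (\<Prod>p\<in>?P N. 1 - g s p) + ln ?L) - ln ?L\<bar>)
      \<longlonglongrightarrow> \<bar>prime_sum s + 0 - ln ?L\<bar>"
    by (intro tendsto_intros lim prime_sum_limit s)
  have "\<bar>(\<Sum>p\<in>?P N. g s p) + (ln (\<Prod>p\<in>?P N. 1 - g s p) + ln ?L) - ln ?L\<bar>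
      \<le> 2 * (\<Sum>n. 1 / (real n)\<^sup>2)" for N
  proof -
    have "ln (\<Prod>p\<in>?P N. 1 - g s p) = (\<Sum>p\<in>?P N. ln (1 - g s p))"
    proof (rule ln_prod)
      fix p assume "p \<in> ?P N"
      then have "0 < 1 - g s p" by (intro pos) simp
      then show "1 - g s p \<noteq> 0" by simp
    qed simp
    then have "\<bar>(\<Sum>p\<in>?P N. g s p) + (ln (\<Prod>p\<in>?P N. 1 - g s p) + ln ?L) - ln ?L\<bar>
        = \<bar>\<Sum>p\<in>?P N. ln (1 - g s p) + g s p\<bar>" by (simp add: sum.distrib)
    also have "\<dots> \<le> (\<Sum>p\<in>?P N. \<bar>ln (1 - g s p) + g s p\<bar>)" by (rule sum_abs)
    also have "\<dots> \<le> (\<Sum>p\<in>?P N. 2 * (1 / (real p)\<^sup>2))"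
    proof (rule sum_mono)
      fix p assume "p \<in> ?P N"
      then have p: "Factorial_Ring.prime p" by simp
      have "\<bar>ln (1 + (- g s p)) - (- g s p)\<bar> \<le> 2 * (- g s p)\<^sup>2"
        using g_prime_le(2)[OF s p] by (intro abs_ln_one_plus_x_minus_x_bound) simp
      also have "(- g s p)\<^sup>2 = \<bar>g s p\<bar>\<^sup>2" by simp
      also have "\<bar>g s p\<bar>\<^sup>2 \<le> (1 / real p)\<^sup>2" by (intro power_mono g_prime_le(1) s p) simp
      finally show "\<bar>ln (1 - g s p) + g s p\<bar> \<le> 2 * (1 / (real p)\<^sup>2)" by (simp add: power_divide)
    qed
    also have "\<dots> = 2 * (\<Sum>p\<in>?P N. 1 / (real p)\<^sup>2)" by (simp add: sum_distrib_left)
    also have "(\<Sum>p\<in>?P N. 1 / (real p)\<^sup>2) \<le> (\<Sum>n. 1 / (real n)\<^sup>2)"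
      by (rule sum_le_suminf[OF sq]) auto
    finally show ?thesis by simp
  qed
  with lim2 have "\<bar>prime_sum s + 0 - ln ?L\<bar> \<le> 2 * (\<Sum>n. 1 / (real n)\<^sup>2)"
    by (intro tendsto_upperbound[OF lim2]) auto
  then show ?thesis by simp
qed

end

section \<open>Real characters\<close>

lemma prime_power_split:
  assumes "m > (1 :: nat)"
  obtains p a m' where "Factorial_Ring.prime p" "m = p ^ a * m'" "\<not> p dvd m'" "m' < m" "m' > 0"
proof -
  obtain p where p: "Factorial_Ring.prime p" "p dvd m" using assms prime_factor_nat by (metis less_irrefl)
  obtain m' where m': "m = p ^ multiplicity p m * m'" "\<not> p dvd m'"
    by (rule multiplicity_decompose'[of m p]) (use p assms in auto)
  have a: "multiplicity p m > 0" using p assms by (simp add: prime_multiplicity_gt_zero_iff)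
  have "m' > 0" using m' by (cases m') auto
  have "1 < p ^ multiplicity p m" using a p prime_gt_1_nat one_less_power by blast
  then have "1 * m' < p ^ multiplicity p m * m'" using \<open>m' > 0\<close> by (rule mult_strict_right_mono)
  then have "m' < m" using m'(1) by simp
  then show ?thesis using that p m' \<open>m' > 0\<close> by blast
qed

text \<open>The vanishing sum over a period expresses that the character is not principal; it keeps
  all partial sums bounded.\<close>

locale real_character = completely_multiplicative f for f :: "nat \<Rightarrow> real" +
  fixes q :: nat
  assumes q_pos: "q > 0" and periodic: "f (n + q) = f n" and sum_period: "(\<Sum>k<q. f k) = 0"
    and f_values: "f n \<in> {-1, 0, 1}"
begin

lemma partial_sum_bound: "\<bar>\<Sum>k<n. f k\<bar> \<le> real q"
proof (induction n rule: less_induct)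
  case (less n)
  show ?case
  proof (cases "n < q")
    case True
    have "\<bar>\<Sum>k<n. f k\<bar> \<le> (\<Sum>k<n. \<bar>f k\<bar>)" by (rule sum_abs)
    also have "\<dots> \<le> (\<Sum>k<n. 1)" by (intro sum_mono f_le_1)
    finally show ?thesis using True by simp
  next
    case False
    then obtain m where m: "n = m + q" by (metis le_add_diff_inverse2 not_less)
    have shift: "(\<Sum>k=m..<m + q. f k) = 0" for m
    proof (induction m)
      case 0
      then show ?case using sum_period by (simp add: lessThan_atLeast0)
    next
      case (Suc m)
      have "(\<Sum>k=m..<Suc (m + q). f k) = f m + (\<Sum>k=Suc m..<Suc (m + q). f k)"
        using q_pos by (simp add: sum.atLeast_Suc_lessThan)
      moreover have "(\<Sum>k=m..<Suc (m + q). f k) = (\<Sum>k=m..<m + q. f k) + f (m + q)" by simp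
      ultimately show ?case using Suc periodic[of m] by simp
    qed
    have "(\<Sum>k<n. f k) = (\<Sum>k<m. f k) + (\<Sum>k=m..<m + q. f k)"
      unfolding m lessThan_atLeast0 by (simp add: sum.atLeastLessThan_concat)
    also have "\<dots> = (\<Sum>k<m. f k)" by (simp add: shift)
    finally show ?thesis using less[of m] m q_pos by simp
  qed
qed

lemma interval_sum_bound: "\<bar>\<Sum>k=m..<n. f k\<bar> \<le> 2 * real q"
proof (cases "m \<le> n")
  case True
  then have "(\<Sum>k<n. f k) = (\<Sum>k<m. f k) + (\<Sum>k=m..<n. f k)"
    unfolding lessThan_atLeast0 by (simp add: sum.atLeastLessThan_concat)
  then show ?thesis using partial_sum_bound[of m] partial_sum_bound[of n] by linarith
qed simp

lemma series_interval_bound: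
  assumes s: "s \<ge> 1" and m: "m > 0"
  shows "\<bar>\<Sum>k=m..<n. g s k\<bar> \<le> 2 * real q / real m"
proof -
  have "\<bar>\<Sum>k=m..<n. f k * real k powr (- s)\<bar> \<le> 2 * real q * real m powr (- s)"
    by (rule abel_summation_bound[OF interval_sum_bound]) (use m s in \<open>auto intro!: powr_mono2'\<close>)
  also have "real m powr (- s) \<le> real m powr (- 1)" using m s by (intro powr_mono) auto
  also have "real m powr (- 1) = 1 / real m" using m by (simp add: powr_minus_divide)
  finally show ?thesis using q_pos by (simp add: mult_left_mono)
qed

lemma series_summable:
  assumes s: "s \<ge> 1"
  shows "summable (g s)"
  unfolding summable_Cauchy
proof safe
  fix e :: real assume e: "e > 0"
  obtain N where N: "real N > 2 * real q / e" using reals_Archimedean2 by blast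
  have "\<bar>\<Sum>k=m..<n. g s k\<bar> < e" if "m \<ge> Suc N" for m n
  proof -
    have m: "real m > 2 * real q / e" using N that by simp
    then have "2 * real q / real m < e" using e that by (simp add: field_simps)
    then show ?thesis using series_interval_bound[OF s, of m n] that by simp
  qed
  then show "\<exists>N. \<forall>m\<ge>N. \<forall>n. norm (sum (g s) {m..<n}) < e" by (auto simp: real_norm_def)
qed

lemma series_tail_bound:
  assumes s: "s \<ge> 1" and m: "m > 0"
  shows "\<bar>dirichlet_series f s - (\<Sum>k<m. g s k)\<bar> \<le> 2 * real q / real m"
proof -
  have "(\<lambda>n. \<bar>(\<Sum>k<n. g s k) - (\<Sum>k<m. g s k)\<bar>) \<longlonglongrightarrow> \<bar>dirichlet_series f s - (\<Sum>k<m. g s k)\<bar>"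
    unfolding dirichlet_series_def
    by (intro tendsto_intros summable_LIMSEQ series_summable s)
  moreover have "\<bar>(\<Sum>k<n. g s k) - (\<Sum>k<m. g s k)\<bar> \<le> 2 * real q / real m" if "n \<ge> m" for n
  proof -
    have "(\<Sum>k<n. g s k) - (\<Sum>k<m. g s k) = (\<Sum>k=m..<n. g s k)"
      using that unfolding lessThan_atLeast0 by (simp add: sum_diff_nat_ivl)
    then show ?thesis using series_interval_bound[OF s m, of n] by simp
  qed
  ultimately show ?thesis
    by (intro tendsto_upperbound[where F = sequentially]) (auto intro!: eventually_sequentiallyI[of m])
qed

text \<open>The tail bound \<open>2 * q / m\<close> is uniform in \<open>s\<close>, so continuity
  reaches the point 1, where convergence is only conditional.\<close>

lemma series_continuous: "continuous_on {1..} (dirichlet_series f)"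
proof (rule uniform_limit_theorem)
  have "continuous_on {1..} (\<lambda>s. g s k)" for k
    by (cases "k = 0") (auto intro!: continuous_intros)
  then show "\<forall>\<^sub>F m in sequentially. continuous_on {1..} (\<lambda>s. \<Sum>k<m. g s k)"
    by (intro always_eventually allI continuous_on_sum)
  show "uniform_limit {1..} (\<lambda>m s. \<Sum>k<m. g s k) (dirichlet_series f) sequentially"
    unfolding uniform_limit_sequentially_iff
  proof safe
    fix e :: real assume e: "e > 0"
    obtain N where N: "real N > 2 * real q / e" using reals_Archimedean2 by blast
    have "dist (\<Sum>k<m. g s k) (dirichlet_series f s) < e" if "m \<ge> Suc N" "s \<in> {1..}" for m s
    proof -
      have "real m > 2 * real q / e" using N that by simp
      then have "2 * real q / real m < e" using e that by (simp add: field_simps)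
      then show ?thesis using series_tail_bound[of s m] that by (simp add: dist_real_def abs_minus_commute)
    qed
    then show "\<exists>N. \<forall>n\<ge>N. \<forall>x\<in>{1..}. dist (\<Sum>k<n. g x k) (dirichlet_series f x) < e" by blast
  qed
qed simp

section \<open>Divisor sums and the Lambert series\<close>

definition divisor_sum :: "nat \<Rightarrow> real" where
  "divisor_sum m = (\<Sum>d | d dvd m. f d)"

lemma f_power: "f (p ^ i) = f p ^ i"
  by (induction i) (simp_all add: f_1[simplified] f_mult)

lemma divisor_sum_prime_power_mult:
  assumes p: "Factorial_Ring.prime p" and m: "\<not> p dvd m"
  shows "divisor_sum (p ^ a * m) = (\<Sum>i\<le>a. f p ^ i) * divisor_sum m"
proof -
  have m0: "m > 0" using m by (cases m) auto
  have cop: "coprime p m" using p m prime_imp_coprime by blast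
  have bij: "bij_betw (\<lambda>(i, d). p ^ i * d) ({..a} \<times> {d. d dvd m}) {d. d dvd p ^ a * m}"
    unfolding bij_betw_def
  proof
    show "inj_on (\<lambda>(i, d). p ^ i * d) ({..a} \<times> {d. d dvd m})"
    proof (rule inj_onI, clarsimp)
      fix i d j e assume *: "d dvd m" "e dvd m" "p ^ i * d = p ^ j * e"
      have nd: "\<not> p dvd d" "\<not> p dvd e" using m * dvd_trans by blast+
      have pu: "\<not> is_unit p" "p \<noteq> 0" using p by auto
      have "multiplicity p (p ^ i * d) = i" "multiplicity p (p ^ j * e) = j"
        using nd pu by (auto intro!: multiplicity_eqI simp: mult.commute)
      then show "i = j \<and> d = e" using * pu by simp
    qed
    show "(\<lambda>(i, d). p ^ i * d) ` ({..a} \<times> {d. d dvd m}) = {d. d dvd p ^ a * m}"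
    proof (intro equalityI subsetI)
      fix x assume "x \<in> (\<lambda>(i, d). p ^ i * d) ` ({..a} \<times> {d. d dvd m})"
      then obtain i d where "x = p ^ i * d" "i \<le> a" "d dvd m" by auto
      then show "x \<in> {d. d dvd p ^ a * m}" by (auto intro!: mult_dvd_mono le_imp_power_dvd)
    next
      fix d assume "d \<in> {d. d dvd p ^ a * m}"
      then obtain u v where uv: "d = u * v" "u dvd p ^ a" "v dvd m" by (metis mem_Collect_eq division_decomp)
      then obtain i where "i \<le> a" "u = p ^ i" using divides_primepow_nat[OF p] by blast
      then show "d \<in> (\<lambda>(i, d). p ^ i * d) ` ({..a} \<times> {d. d dvd m})" using uv by force
    qed
  qed
  have "divisor_sum (p ^ a * m) = (\<Sum>(i, d)\<in>{..a} \<times> {d. d dvd m}. f (p ^ i * d))"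
    unfolding divisor_sum_def sum.reindex_bij_betw[OF bij, symmetric] by (simp add: case_prod_unfold)
  also have "\<dots> = (\<Sum>i\<le>a. \<Sum>d | d dvd m. f p ^ i * f d)"
    by (simp add: sum.cartesian_product f_mult f_power)
  also have "\<dots> = (\<Sum>i\<le>a. f p ^ i) * divisor_sum m"
    unfolding divisor_sum_def by (simp add: sum_product)
  finally show ?thesis .
qed

text \<open>For the value -1 these sums alternate between 1 and 0, for the value 0 they are
  1.\<close>

lemma geometric_sum_nonneg: "(\<Sum>i\<le>a. f p ^ i) \<ge> 0" "even a \<Longrightarrow> (\<Sum>i\<le>a. f p ^ i) \<ge> 1"
proof -
  have alt: "(\<Sum>i\<le>a. (- 1 :: real) ^ i) = (if even a then 1 else 0)" for a :: nat
    by (induction a) auto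
  have zero: "(\<Sum>i\<le>a. (0 :: real) ^ i) = 1" for a :: nat by (induction a) auto
  show "(\<Sum>i\<le>a. f p ^ i) \<ge> 0" "even a \<Longrightarrow> (\<Sum>i\<le>a. f p ^ i) \<ge> 1"
    using f_values[of p] by (auto simp: alt zero)
qed

lemma divisor_sum_1: "divisor_sum 1 = 1"
  using f_1 by (simp add: divisor_sum_def)

lemma divisor_sum_nonneg: "m > 0 \<Longrightarrow> divisor_sum m \<ge> 0"
proof (induction m rule: less_induct)
  case (less m)
  show ?case
  proof (cases "m = 1")
    case False
    then obtain p a m' where "Factorial_Ring.prime p" "m = p ^ a * m'" "\<not> p dvd m'" "m' < m" "m' > 0"
      using prime_power_split[of m] less by (metis less_one linorder_neqE_nat less_irrefl)
    then show ?thesis using less.IH geometric_sum_nonneg(1)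
      by (simp add: divisor_sum_prime_power_mult)
  qed (simp add: divisor_sum_1[simplified])
qed

text \<open>All prime exponents of a square are even, so every local factor is at least 1.\<close>

lemma divisor_sum_square_ge_1: "k > 0 \<Longrightarrow> divisor_sum (k\<^sup>2) \<ge> 1"
proof (induction k rule: less_induct)
  case (less k)
  show ?case
  proof (cases "k = 1")
    case False
    then obtain p a k' where k: "Factorial_Ring.prime p" "k = p ^ a * k'" "\<not> p dvd k'" "k' < k" "k' > 0"
      using prime_power_split[of k] less by (metis less_one linorder_neqE_nat less_irrefl)
    have "k\<^sup>2 = p ^ (2 * a) * k'\<^sup>2" unfolding k(2) by (simp add: power_mult_distrib power_mult[symmetric] mult.commute)
    moreover have "\<not> p dvd k'\<^sup>2" using k by (simp add: prime_dvd_power_iff)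
    ultimately have "divisor_sum (k\<^sup>2) = (\<Sum>i\<le>2 * a. f p ^ i) * divisor_sum (k'\<^sup>2)"
      using k(1) divisor_sum_prime_power_mult by simp
    moreover have "1 * 1 \<le> (\<Sum>i\<le>2 * a. f p ^ i) * divisor_sum (k'\<^sup>2)"
      using less.IH[OF k(4,5)] geometric_sum_nonneg(2)[of "2 * a" p] by (intro mult_mono) auto
    ultimately show ?thesis by simp
  qed (simp add: divisor_sum_1[simplified])
qed

text \<open>The Lambert series \<open>\<Sum> f(n) t\<^sup>n / (1 - t\<^sup>n)\<close> equals \<open>\<Sum> c(m) t\<^sup>m\<close> with the divisor sums \<open>c\<close> of \<open>f\<close>;
  it is unbounded as \<open>t\<close> tends to 1.\<close>

lemma lambert_series_ge:
  fixes t :: real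
  assumes t: "0 < t" "t < 1"
  shows "summable (\<lambda>n. f n * (t ^ n / (1 - t ^ n)))"
    and "(\<Sum>k\<in>{1..K}. t ^ (k\<^sup>2)) \<le> (\<Sum>n. f n * (t ^ n / (1 - t ^ n)))"
proof -
  define h where "h = (\<lambda>(n, j). f n * t ^ (n * j))"
  have tn: "0 < t ^ n" "t ^ n < 1" if "n > 0" for n :: nat
    using t that by (simp_all add: power_less_one_iff)
  have geo: "((\<lambda>j. t ^ (n * j)) has_sum (t ^ n / (1 - t ^ n))) {0<..}" if n: "n > 0" for n
  proof -
    have "(\<lambda>j. (t ^ n) ^ j) sums (1 / (1 - t ^ n))" using tn[OF n] by (intro geometric_sums) simp
    then have "(\<lambda>j. (t ^ n) ^ j) sums (1 / (1 - t ^ n))" .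
    moreover have "summable (\<lambda>j. norm ((t ^ n) ^ j))" using tn[OF n] by (simp add: summable_geometric)
    ultimately have "((\<lambda>j. (t ^ n) ^ j) has_sum (1 / (1 - t ^ n))) UNIV"
      by (intro norm_summable_imp_has_sum)
    moreover have "((\<lambda>j. (t ^ n) ^ j) has_sum 1) {0}"
      using has_sum_finite[of "{0 :: nat}" "\<lambda>j. (t ^ n) ^ j"] by simp
    ultimately have "((\<lambda>j. (t ^ n) ^ j) has_sum (1 / (1 - t ^ n) - 1)) (UNIV - {0})"
      by (rule has_sum_Diff) simp
    moreover have "1 / (1 - t ^ n) - 1 = t ^ n / (1 - t ^ n)" using tn[OF n] by (simp add: field_simps)
    moreover have "UNIV - {0 :: nat} = {0<..}" by auto
    ultimately show ?thesis by (simp add: power_mult)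
  qed
  have bound: "\<bar>f n * (t ^ n / (1 - t ^ n))\<bar> \<le> t ^ n / (1 - t)" for n
  proof (cases "n = 0")
    case False
    have "t ^ n \<le> t ^ 1" using False t by (intro power_decreasing) auto
    then have "t ^ n / (1 - t ^ n) \<le> t ^ n / (1 - t)" using t tn[of n] False by (intro divide_left_mono) auto
    moreover have "\<bar>f n\<bar> * (t ^ n / (1 - t ^ n)) \<le> 1 * (t ^ n / (1 - t ^ n))"
      using tn[of n] False by (intro mult_right_mono f_le_1) auto
    ultimately show ?thesis using tn[of n] False by (simp add: abs_mult)
  qed (use t in simp)
  have sum_abs: "summable (\<lambda>n. \<bar>f n * (t ^ n / (1 - t ^ n))\<bar>)"
  proof (rule summable_comparison_test'[where N = 0])
    show "summable (\<lambda>n. t ^ n / (1 - t))" using t by (intro summable_divide summable_geometric) simp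
  qed (use bound in simp)
  then show "summable (\<lambda>n. f n * (t ^ n / (1 - t ^ n)))" by (rule summable_rabs_cancel)
  have inner: "infsum (\<lambda>j. h (n, j)) {0<..} = f n * (t ^ n / (1 - t ^ n))" if "n \<in> {0<..}" for n
    using has_sum_cmult_right[OF geo[of n], of "f n"] that unfolding h_def by (simp add: infsumI)
  have "(\<lambda>z. norm (h z)) summable_on {0<..} \<times> {0<..}"
    unfolding Infinite_Sum.abs_summable_on_Sigma_iff
  proof safe
    fix n :: nat assume n: "n > 0"
    have "(\<lambda>j. \<bar>f n\<bar> * t ^ (n * j)) summable_on {0<..}"
      using has_sum_cmult_right[OF geo[OF n], of "\<bar>f n\<bar>"] by (auto simp: summable_on_def)
    then show "(\<lambda>j. norm (h (n, j))) summable_on {0<..}" using t by (simp add: h_def abs_mult power_abs)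
  next
    have e: "infsum (\<lambda>j. norm (h (n, j))) {0<..} = \<bar>f n * (t ^ n / (1 - t ^ n))\<bar>" if "n \<in> {0<..}" for n
      using infsumI[OF has_sum_cmult_right[OF geo[of n], of "\<bar>f n\<bar>"]] that t tn[of n]
      by (simp add: h_def abs_mult power_abs)
    have "(\<lambda>n. \<bar>f n * (t ^ n / (1 - t ^ n))\<bar>) summable_on {0<..}"
      by (rule abs_summable_imp_infsum(1)) (use sum_abs in simp)
    then show "(\<lambda>n. norm (infsum (\<lambda>j. norm (h (n, j))) {0<..})) summable_on {0<..}"
      by (subst summable_on_cong[where g = "\<lambda>n. \<bar>f n * (t ^ n / (1 - t ^ n))\<bar>"])
        (simp_all only: e, simp)
  qed
  then have hs: "h summable_on {0<..} \<times> {0<..}" by (rule abs_summable_summable)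
  \<comment> \<open>The pairs \<open>(n, j)\<close> are regrouped by their product
    \<open>m = n * j\<close>, with \<open>n\<close> as the divisor \<open>d\<close>.\<close>
  define S where "S = Sigma {0<..} (\<lambda>m :: nat. {d. d dvd m})"
  have bij: "bij_betw (\<lambda>(m, d). (d, m div d)) S ({0<..} \<times> {0<..})"
    by (rule bij_betwI[where g = "\<lambda>(n, j). (n * j, n)"]) (auto simp: S_def elim!: dvdE)
  have hr: "(\<lambda>z. h ((\<lambda>(m, d). (d, m div d)) z)) = (\<lambda>(m, d). f d * t ^ (d * (m div d)))"
    by (auto simp: h_def)
  have S1: "(\<lambda>(m, d). f d * t ^ (d * (m div d))) summable_on S"
    using hs summable_on_reindex_bij_betw[OF bij, of h] unfolding hr by simp
  have S2: "infsum (\<lambda>(m, d). f d * t ^ (d * (m div d))) S = infsum h ({0<..} \<times> {0<..})"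
    using infsum_reindex_bij_betw[OF bij, of h] unfolding hr by simp
  have row: "infsum (\<lambda>d. f d * t ^ (d * (m div d))) {d. d dvd m} = divisor_sum m * t ^ m"
    if "m \<in> {0<..}" for m
  proof -
    have "infsum (\<lambda>d. f d * t ^ (d * (m div d))) {d. d dvd m} = (\<Sum>d | d dvd m. f d * t ^ (d * (m div d)))"
      using that by (intro infsum_finite) simp
    also have "\<dots> = (\<Sum>d | d dvd m. f d * t ^ m)" by (intro sum.cong) auto
    finally show ?thesis by (simp add: divisor_sum_def sum_distrib_right)
  qed
  have "infsum (\<lambda>m. divisor_sum m * t ^ m) {0<..}
      = infsum (\<lambda>m. infsum (\<lambda>d. f d * t ^ (d * (m div d))) {d. d dvd m}) {0<..}"
    by (rule infsum_cong) (rule row[symmetric])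
  also have "\<dots> = infsum (\<lambda>(m, d). f d * t ^ (d * (m div d))) S"
    unfolding S_def by (rule infsum_Sigma'_banach[OF S1[unfolded S_def]])
  finally have c1: "infsum (\<lambda>m. divisor_sum m * t ^ m) {0<..} = infsum h ({0<..} \<times> {0<..})"
    unfolding S2 .
  have "(\<lambda>m. infsum (\<lambda>d. f d * t ^ (d * (m div d))) {d. d dvd m}) summable_on {0<..}"
    by (rule summable_on_Sigma_banach[OF S1[unfolded S_def]])
  then have c2: "(\<lambda>m. divisor_sum m * t ^ m) summable_on {0<..}"
    by (rule summable_on_cong[THEN iffD1, rotated]) (rule row)
  have "infsum h ({0<..} \<times> {0<..}) = infsum (\<lambda>n. infsum (\<lambda>j. h (n, j)) {0<..}) {0<..}"
    by (rule infsum_Sigma_banach[OF hs, symmetric])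
  also have "\<dots> = infsum (\<lambda>n. f n * (t ^ n / (1 - t ^ n))) {0<..}"
    by (rule infsum_cong) (rule inner)
  \<comment> \<open>Index 0 may be added: \<open>1 - t ^ 0\<close> is 0 and division by 0 yields
    0.\<close>
  also have "\<dots> = infsum (\<lambda>n. f n * (t ^ n / (1 - t ^ n))) UNIV" by (rule infsum_cong_neutral) auto
  also have "\<dots> = (\<Sum>n. f n * (t ^ n / (1 - t ^ n)))" by (rule abs_summable_imp_infsum(2)[OF sum_abs])
  finally have eq: "infsum (\<lambda>m. divisor_sum m * t ^ m) {0<..} = (\<Sum>n. f n * (t ^ n / (1 - t ^ n)))"
    using c1 by simp
  have "(\<Sum>k\<in>{1..K}. t ^ (k\<^sup>2)) \<le> (\<Sum>k\<in>{1..K}. divisor_sum (k\<^sup>2) * t ^ (k\<^sup>2))"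
  proof (rule sum_mono)
    fix k assume "k \<in> {1..K}"
    then have "1 * t ^ (k\<^sup>2) \<le> divisor_sum (k\<^sup>2) * t ^ (k\<^sup>2)"
      using t by (intro mult_right_mono divisor_sum_square_ge_1) auto
    then show "t ^ (k\<^sup>2) \<le> divisor_sum (k\<^sup>2) * t ^ (k\<^sup>2)" by simp
  qed
  also have "\<dots> = (\<Sum>m\<in>(\<lambda>k. k\<^sup>2) ` {1..K}. divisor_sum m * t ^ m)"
    by (subst sum.reindex) (auto simp: inj_on_def)
  also have "\<dots> \<le> infsum (\<lambda>m. divisor_sum m * t ^ m) {0<..}"
    using t by (intro finite_sum_le_infsum c2) (auto intro!: mult_nonneg_nonneg divisor_sum_nonneg)
  finally show "(\<Sum>k\<in>{1..K}. t ^ (k\<^sup>2)) \<le> (\<Sum>n. f n * (t ^ n / (1 - t ^ n)))" unfolding eq .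
qed

end

text \<open>The weights in Monsky's proof of the nonvanishing of \<open>L(1, \<chi>)\<close>.\<close>

definition monsky_weight :: "real \<Rightarrow> nat \<Rightarrow> real" where
  "monsky_weight t n = 1 / (real n * (1 - t)) - t ^ n / (1 - t ^ n)"

text \<open>With \<open>1 - t^n = (1 - t) * S n\<close>, monotonicity amounts to
  \<open>n * (n + 1) * t^n \<le> S n * S (n + 1)\<close>. This follows from
  \<open>S m \<ge> m * t^((m - 1)/2)\<close>, where \<open>u = sqrt t\<close> makes the exponent
  integral.\<close>

lemma monsky_weight_props:
  fixes t :: real
  assumes t: "0 < t" "t < 1" and n: "n > 0"
  shows "monsky_weight t n \<ge> 0" "monsky_weight t (Suc n) \<le> monsky_weight t n"
proof -
  define S where "S n = (\<Sum>i<n. t ^ i)" for n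
  have gp: "1 - t ^ n = (1 - t) * S n" for n
    unfolding S_def by (rule one_diff_power_eq)
  have Spos: "S n > 0" if "n > 0" for n
    unfolding S_def using that t by (intro sum_pos) auto
  have "real n * t ^ n = (\<Sum>i<n. t ^ n)" by simp
  also have "\<dots> \<le> S n" unfolding S_def using t by (intro sum_mono power_decreasing) auto
  finally have "real n * t ^ n \<le> S n" .
  then have "t ^ n / S n \<le> 1 / real n" using Spos[OF n] n by (simp add: field_simps)
  then have "t ^ n / S n / (1 - t) \<le> 1 / real n / (1 - t)" using t by (intro divide_right_mono) auto
  then show "monsky_weight t n \<ge> 0" unfolding monsky_weight_def gp by (simp add: mult.commute)
  define u where "u = sqrt t"
  have u: "0 < u" "u < 1" "t = u\<^sup>2" using t by (simp_all add: u_def)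
  \<comment> \<open>The exponents \<open>i\<close> and \<open>m - 1 - i\<close> are paired, and the
    arithmetic mean of each pair is at least the geometric mean.\<close>
  have S_ge: "S m \<ge> real m * u ^ (m - 1)" for m
  proof -
    have "2 * (real m * u ^ (m - 1)) = (\<Sum>i<m. 2 * u ^ (m - 1))" by simp
    also have "\<dots> \<le> (\<Sum>i<m. t ^ i + t ^ (m - Suc i))"
    proof (rule sum_mono)
      fix i assume "i \<in> {..<m}"
      then have e: "u ^ (m - 1) = u ^ i * u ^ (m - Suc i)" by (simp add: power_add[symmetric])
      have "t ^ j = (u ^ j)\<^sup>2" for j unfolding u(3) by (simp only: power_mult[symmetric] mult.commute)
      then show "2 * u ^ (m - 1) \<le> t ^ i + t ^ (m - Suc i)"
        unfolding e using sum_squares_bound[of "u ^ i" "u ^ (m - Suc i)"] by (simp only: mult.assoc)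
    qed
    also have "\<dots> = S m + S m" unfolding S_def sum.distrib by (simp add: sum.nat_diff_reindex)
    finally show ?thesis by simp
  qed
  have "real n * real (Suc n) * t ^ n \<le> (real n * u ^ (n - 1)) * (real (Suc n) * u ^ n)"
  proof -
    have "u ^ n \<le> u ^ (n - 1)" using u by (intro power_decreasing) auto
    then have "u ^ n * u ^ n \<le> u ^ (n - 1) * u ^ n" using u by (intro mult_right_mono) auto
    moreover have "t ^ n = u ^ n * u ^ n" unfolding u(3) by (simp add: power_mult[symmetric] power_add[symmetric] mult_2)
    ultimately have "real n * real (Suc n) * t ^ n \<le> real n * real (Suc n) * (u ^ (n - 1) * u ^ n)"
      by (intro mult_left_mono) auto
    then show ?thesis by (simp only: mult_ac)
  qed
  also have "\<dots> \<le> S n * S (Suc n)"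
    using S_ge[of n] S_ge[of "Suc n"] u Spos[OF n] by (intro mult_mono) auto
  finally have prod: "real n * real (Suc n) * t ^ n \<le> S n * S (Suc n)" .
  have "t ^ n / S n - t ^ Suc n / S (Suc n) = t ^ n * (S (Suc n) - t * S n) / (S n * S (Suc n))"
    using Spos[OF n] Spos[of "Suc n"] by (simp add: field_simps)
  also have "S (Suc n) - t * S n = 1"
    unfolding S_def sum.lessThan_Suc_shift by (simp add: sum_distrib_left)
  also have "t ^ n * 1 / (S n * S (Suc n)) \<le> 1 / (real n * real (Suc n))"
  proof -
    have A: "real n * real (Suc n) > 0" and B: "S n * S (Suc n) > 0" using n Spos by simp_all
    have "t ^ n \<le> S n * S (Suc n) / (real n * real (Suc n))"
      using prod unfolding pos_le_divide_eq[OF A] by (simp only: mult_ac)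
    then have "t ^ n / (S n * S (Suc n))
        \<le> S n * S (Suc n) / (real n * real (Suc n)) / (S n * S (Suc n))"
      using B by (intro divide_right_mono) auto
    also have "\<dots> = 1 / (real n * real (Suc n))"
      using Spos[OF n] Spos[of "Suc n"] by simp
    finally show ?thesis by simp
  qed
  also have "1 / (real n * real (Suc n)) = 1 / real n - 1 / real (Suc n)" using n by (simp add: field_simps)
  finally have "1 / real (Suc n) - t ^ Suc n / S (Suc n) \<le> 1 / real n - t ^ n / S n" by simp
  then have "(1 / real (Suc n) - t ^ Suc n / S (Suc n)) / (1 - t) \<le> (1 / real n - t ^ n / S n) / (1 - t)"
    using t by (intro divide_right_mono) auto
  then show "monsky_weight t (Suc n) \<le> monsky_weight t n"
    unfolding monsky_weight_def gp by (simp add: diff_divide_distrib mult.commute del: of_nat_Suc power_Suc)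
qed

context real_character
begin

text \<open>If L(1) = 0, subtracting the Lambert series from L(1)/(1 - t) shows that it is minus the
  sum of \<open>f n * monsky_weight t n\<close>. The weights decrease from 1, so this is at most
  \<open>2 * q\<close> in modulus, whereas the squares alone contribute a sum tending to
  \<open>K = 2 * q + 1\<close> as \<open>t\<close> tends to 1.\<close>

lemma L_1_nonzero: "dirichlet_series f 1 \<noteq> 0"
proof
  assume L1: "dirichlet_series f 1 = 0"
  have bound: "\<bar>\<Sum>n. f n * (t ^ n / (1 - t ^ n))\<bar> \<le> 2 * real q" if t: "0 < t" "t < 1" for t :: real
  proof -
    let ?F = "\<lambda>n. f n * (t ^ n / (1 - t ^ n))"
    have "(\<lambda>N. (\<Sum>k<N. g 1 k) / (1 - t) - (\<Sum>k<N. ?F k)) \<longlonglongrightarrow> dirichlet_series f 1 / (1 - t) - suminf ?F"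
      unfolding dirichlet_series_def
      by (intro tendsto_intros summable_LIMSEQ series_summable lambert_series_ge(1) t) (use t in auto)
    then have "(\<lambda>N. \<bar>(\<Sum>k<N. g 1 k) / (1 - t) - (\<Sum>k<N. ?F k)\<bar>) \<longlonglongrightarrow> \<bar>0 / (1 - t) - suminf ?F\<bar>"
      unfolding L1 by (rule tendsto_rabs)
    moreover have "\<bar>(\<Sum>k<N. g 1 k) / (1 - t) - (\<Sum>k<N. ?F k)\<bar> \<le> 2 * real q" if N: "N \<ge> 1" for N
    proof -
      have "(\<Sum>k<N. g 1 k) / (1 - t) - (\<Sum>k<N. ?F k) = (\<Sum>k<N. g 1 k / (1 - t) - ?F k)"
        by (simp add: sum_subtractf sum_divide_distrib)
      also have "\<dots> = (\<Sum>k=1..<N. g 1 k / (1 - t) - ?F k)"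
        using N unfolding lessThan_atLeast0 by (simp add: sum.atLeast_Suc_lessThan)
      also have "\<dots> = (\<Sum>k=1..<N. f k * monsky_weight t k)"
        by (intro sum.cong) (simp_all add: monsky_weight_def powr_minus_divide right_diff_distrib)
      finally have "\<bar>(\<Sum>k<N. g 1 k) / (1 - t) - (\<Sum>k<N. ?F k)\<bar> = \<bar>\<Sum>k=1..<N. f k * monsky_weight t k\<bar>"
        by simp
      also have "\<dots> \<le> 2 * real q * monsky_weight t 1"
        by (rule abel_summation_bound[OF interval_sum_bound]) (use monsky_weight_props t in auto)
      also have "monsky_weight t 1 = 1" using t by (simp add: monsky_weight_def diff_divide_distrib[symmetric])
      finally show ?thesis by simp
    qed
    ultimately have "\<bar>0 / (1 - t) - suminf ?F\<bar> \<le> 2 * real q"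
      by (intro tendsto_upperbound[where F = sequentially]) (auto intro!: eventually_sequentiallyI[of 1])
    then show ?thesis by simp
  qed
  define K where "K = 2 * q + 1"
  have "((\<lambda>t. \<Sum>k\<in>{1..K}. t ^ (k\<^sup>2)) \<longlongrightarrow> (\<Sum>k\<in>{1..K}. 1 ^ (k\<^sup>2))) (at_left (1 :: real))"
    by (intro tendsto_intros)
  moreover have "\<forall>\<^sub>F t in at_left (1 :: real). (\<Sum>k\<in>{1..K}. t ^ (k\<^sup>2)) \<le> 2 * real q"
  proof -
    have "\<forall>\<^sub>F t in at_left (1 :: real). t \<in> {0<..<1}"
      by (rule eventually_at_left_real) simp
    then show ?thesis
    proof eventually_elim
      case (elim t)
      then show ?case using lambert_series_ge(2)[of t K] bound[of t] by fastforce
    qed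
  qed
  ultimately have "(\<Sum>k\<in>{1..K}. 1 ^ (k\<^sup>2)) \<le> 2 * real q"
    by (intro tendsto_upperbound[where F = "at_left (1 :: real)"]) auto
  then show False by (simp add: K_def)
qed

text \<open>L(1) is positive, being a nonzero limit of positive values, so the logarithm of the
  L-series stays bounded near 1.\<close>

lemma prime_sum_bounded: "\<exists>C. \<forall>\<^sub>F s in at_right 1. \<bar>prime_sum s\<bar> \<le> C"
proof -
  have cont: "(dirichlet_series f \<longlongrightarrow> dirichlet_series f 1) (at_right 1)"
  proof (rule tendsto_within_subset)
    show "(dirichlet_series f \<longlongrightarrow> dirichlet_series f 1) (at 1 within {1..})"
      using series_continuous unfolding continuous_on_def by simp
  qed auto
  have s1: "\<forall>\<^sub>F s in at_right (1 :: real). s > 1" by (rule eventually_at_right_less)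
  have "dirichlet_series f 1 \<ge> 0"
    by (rule tendsto_lowerbound[OF cont]) (use s1 dirichlet_series_pos in \<open>auto elim!: eventually_mono intro: less_imp_le\<close>)
  then have pos: "dirichlet_series f 1 > 0" using L_1_nonzero by simp
  then have "((\<lambda>s. ln (dirichlet_series f s)) \<longlongrightarrow> ln (dirichlet_series f 1)) (at_right 1)"
    by (intro tendsto_ln cont) simp
  then have "\<forall>\<^sub>F s in at_right 1. dist (ln (dirichlet_series f s)) (ln (dirichlet_series f 1)) < 1"
    by (rule tendstoD) simp
  with s1 have "\<forall>\<^sub>F s in at_right 1. \<bar>prime_sum s\<bar> \<le>
      2 * (\<Sum>n. 1 / (real n)\<^sup>2) + \<bar>ln (dirichlet_series f 1)\<bar> + 1"
  proof eventually_elim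
    case (elim s)
    then show ?case using prime_sum_ln_series[of s] by (simp add: dist_real_def)
  qed
  then show ?thesis by blast
qed

end

section \<open>The density\<close>

text \<open>The quadratic characters of \<open>\<rat>(\<surd>-3)\<close>, \<open>\<rat>(\<surd>-11)\<close> and \<open>\<rat>(\<surd>-2)\<close>; \<open>chi\<close> and \<open>exponents\<close> below enumerate
  their eight products.\<close>

definition chi3 :: "int \<Rightarrow> int" where
  "chi3 n = (let r = n mod 3 in if r = 1 then 1 else if r = 2 then -1 else 0)"

definition chi11 :: "int \<Rightarrow> int" where
  "chi11 n = (let r = n mod 11 in if r = 0 then 0 else if r \<in> {1, 3, 4, 5, 9} then 1 else -1)"

definition chi8 :: "int \<Rightarrow> int" where
  "chi8 n = (let r = n mod 8 in if r \<in> {1, 3} then 1 else if r \<in> {5, 7} then -1 else 0)"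

text \<open>Reduces multiplicativity to a finite table that evaluation decides.\<close>

lemma residue_mult:
  fixes c :: "int \<Rightarrow> int"
  assumes N: "N > 0" and mod: "\<And>n. c (n mod N) = c n"
    and tab: "\<forall>x\<in>set (upto 0 (N - 1)). \<forall>y\<in>set (upto 0 (N - 1)). c (x * y) = c x * c y"
  shows "c (m * n) = c m * c n"
proof -
  have "m mod N \<in> set (upto 0 (N - 1))" "n mod N \<in> set (upto 0 (N - 1))"
    using N pos_mod_bound[OF N, of m] pos_mod_bound[OF N, of n] by auto
  with tab have "c ((m mod N) * (n mod N)) = c (m mod N) * c (n mod N)" by blast
  moreover have "c ((m mod N) * (n mod N)) = c (m * n)"
    using mod[of "(m mod N) * (n mod N)"] mod[of "m * n"] by (simp add: mod_mult_eq)
  ultimately show ?thesis by (simp add: mod)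
qed

lemma chi_mult: "chi3 (m * n) = chi3 m * chi3 n" "chi11 (m * n) = chi11 m * chi11 n"
  "chi8 (m * n) = chi8 m * chi8 n"
proof -
  show "chi3 (m * n) = chi3 m * chi3 n"
    by (rule residue_mult[of 3]) (simp, simp add: chi3_def, code_simp)
  show "chi11 (m * n) = chi11 m * chi11 n"
    by (rule residue_mult[of 11]) (simp, simp add: chi11_def, code_simp)
  show "chi8 (m * n) = chi8 m * chi8 n"
    by (rule residue_mult[of 8]) (simp, simp add: chi8_def, code_simp)
qed

section \<open>Identification of the characters with Legendre symbols\<close>

lemma dvd_abs_less_imp_0: "p dvd x \<Longrightarrow> \<bar>x\<bar> < p \<Longrightarrow> x = 0" for p x :: int
  using dvd_imp_le_int[of x p] by linarith

text \<open>Euler's criterion yields a congruence; both sides lie between -1 and 1, so they differ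
  by at most 2, less than \<open>p\<close>.\<close>

lemma Legendre_mult:
  assumes p: "Factorial_Ring.prime p" "p > 2"
  shows "Legendre (a * b) (int p) = Legendre a (int p) * Legendre b (int p)"
proof -
  let ?e = "(p - 1) div 2"
  have "[Legendre (a * b) (int p) = a ^ ?e * b ^ ?e] (mod int p)"
    using euler_criterion[OF p, of "a * b"] by (simp add: power_mult_distrib)
  moreover have "[a ^ ?e * b ^ ?e = Legendre a (int p) * Legendre b (int p)] (mod int p)"
    by (rule cong_mult) (rule cong_sym[OF euler_criterion[OF p]])+
  ultimately have "[Legendre (a * b) (int p) = Legendre a (int p) * Legendre b (int p)] (mod int p)"
    by (rule cong_trans)
  then have d: "int p dvd Legendre (a * b) (int p) - Legendre a (int p) * Legendre b (int p)"
    by (simp add: cong_iff_dvd_diff)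
  have L: "Legendre x (int p) \<in> {-1, 0, 1}" for x by (simp add: Legendre_def)
  have "\<bar>Legendre (a * b) (int p) - Legendre a (int p) * Legendre b (int p)\<bar> \<le> 2"
    using L[of a] L[of b] L[of "a * b"] by auto
  then have "\<bar>Legendre (a * b) (int p) - Legendre a (int p) * Legendre b (int p)\<bar> < int p" using p by simp
  then have "Legendre (a * b) (int p) - Legendre a (int p) * Legendre b (int p) = 0"
    using d dvd_abs_less_imp_0 by blast
  then show ?thesis by simp
qed

lemma Legendre_minus_1:
  assumes p: "Factorial_Ring.prime p" "p > 2"
  shows "Legendre (- 1) (int p) = (- 1) ^ ((p - 1) div 2)"
proof -
  have d: "int p dvd Legendre (- 1) (int p) - (- 1) ^ ((p - 1) div 2)"
    using euler_criterion[OF p, of "- 1"] by (simp add: cong_iff_dvd_diff)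
  have L: "Legendre (- 1) (int p) \<in> {-1, 0, 1}" by (simp add: Legendre_def)
  have "(- 1 :: int) ^ ((p - 1) div 2) \<in> {-1, 1}" by (cases "even ((p - 1) div 2)") auto
  with L have "\<bar>Legendre (- 1) (int p) - (- 1) ^ ((p - 1) div 2)\<bar> < int p" using p(2) by auto
  then have "Legendre (- 1) (int p) - (- 1) ^ ((p - 1) div 2) = 0" using d dvd_abs_less_imp_0 by blast
  then show ?thesis by simp
qed

text \<open>For \<open>q\<close> congruent to 3 modulo 4 the sign in the reciprocity law is exactly
  the symbol of -1 modulo \<open>p\<close>.\<close>

lemma Legendre_minus_prime:
  assumes p: "Factorial_Ring.prime p" "p > 2" and q: "Factorial_Ring.prime q" "q mod 4 = 3" and pq: "p \<noteq> q"
  shows "Legendre (- int q) (int p) = Legendre (int p) (int q)"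
proof -
  have q2: "q > 2" using q(2) by (cases "q \<le> 2") (auto simp: le_Suc_eq numeral_2_eq_2)
  have odd: "odd ((q - 1) div 2)" using q(2) by presburger
  have nz: "\<not> int q dvd int p" using p q pq primes_dvd_imp_eq by (metis int_dvd_int_iff)
  have Lsq: "Legendre (int p) (int q) * Legendre (int p) (int q) = 1"
    using nz by (simp add: Legendre_def cong_0_iff)
  have "Legendre (int p) (int q) * Legendre (int q) (int p) = (- 1) ^ ((p - 1) div 2 * ((q - 1) div 2))"
    by (rule Quadratic_Reciprocity) (use p q q2 pq in auto)
  also have "\<dots> = (- 1 :: int) ^ ((p - 1) div 2)"
    using odd by (cases "even ((p - 1) div 2)") auto
  finally have QR: "Legendre (int p) (int q) * Legendre (int q) (int p) = (- 1) ^ ((p - 1) div 2)" .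
  have "Legendre (- int q) (int p) = (- 1) ^ ((p - 1) div 2) * Legendre (int q) (int p)"
    using Legendre_mult[OF p, of "- 1" "int q"] Legendre_minus_1[OF p] by simp
  also have "\<dots> = Legendre (int p) (int q) * (Legendre (int q) (int p) * Legendre (int q) (int p))"
    unfolding QR[symmetric] by simp
  also have "Legendre (int q) (int p) * Legendre (int q) (int p) = 1"
  proof -
    have "\<not> int p dvd int q" using p q pq primes_dvd_imp_eq by (metis int_dvd_int_iff)
    then show ?thesis by (simp add: Legendre_def cong_0_iff)
  qed
  finally show ?thesis by simp
qed

lemma QuadRes_mod_table:
  assumes "N > 0"
  shows "QuadRes N a \<longleftrightarrow> a mod N \<in> set (map (\<lambda>y. y * y mod N) (upto 0 (N - 1)))"
proof
  assume "QuadRes N a"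
  then obtain y where y: "[y\<^sup>2 = a] (mod N)" unfolding QuadRes_def by blast
  then have "a mod N = (y mod N) * (y mod N) mod N"
    by (simp add: unique_euclidean_semiring_class.cong_def power2_eq_square mod_mult_eq)
  moreover have "y mod N \<in> set (upto 0 (N - 1))" using assms pos_mod_bound[OF assms, of y] by auto
  ultimately show "a mod N \<in> set (map (\<lambda>y. y * y mod N) (upto 0 (N - 1)))" by auto
next
  assume "a mod N \<in> set (map (\<lambda>y. y * y mod N) (upto 0 (N - 1)))"
  then obtain y where "a mod N = y * y mod N" by auto
  then have "[y\<^sup>2 = a] (mod N)" by (simp add: unique_euclidean_semiring_class.cong_def power2_eq_square)
  then show "QuadRes N a" unfolding QuadRes_def by blast
qed

lemma chi3_eq_Legendre: "chi3 n = Legendre n 3"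
proof -
  have t: "map (\<lambda>y. y * y mod 3) (upto 0 (3 - 1)) = [0, 1, 1 :: int]" by code_simp
  have "n mod 3 \<in> {0, 1, 2}" by auto
  then show ?thesis unfolding Legendre_def QuadRes_mod_table[of 3, simplified t, simplified] chi3_def
    by (auto simp: unique_euclidean_semiring_class.cong_def)
qed

lemma chi11_eq_Legendre: "chi11 n = Legendre n 11"
proof -
  have t: "map (\<lambda>y. y * y mod 11) (upto 0 (11 - 1)) = [0, 1, 4, 9, 5, 3, 3, 5, 9, 4, 1 :: int]" by code_simp
  have "QuadRes 11 n \<longleftrightarrow> n mod 11 \<in> set [0, 1, 4, 9, 5, 3, 3, 5, 9, 4, 1]"
    using QuadRes_mod_table[of 11 n] unfolding t by simp
  then show ?thesis unfolding Legendre_def chi11_def by (auto simp: unique_euclidean_semiring_class.cong_def Let_def)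
qed

text \<open>Gauss's lemma for 2 counts the \<open>x \<le> m = (p - 1) / 2\<close> with
  \<open>2 * x > m\<close>; the symbol of -1 adds \<open>m\<close> to the exponent.\<close>

lemma chi8_eq_Legendre:
  assumes p: "Factorial_Ring.prime p" "p > 2"
  shows "Legendre (- 2) (int p) = chi8 (int p)"
proof -
  interpret G: GAUSS p 2
  proof
    have "\<not> int p dvd 2" using p(2) zdvd_imp_le[of "int p" 2] by auto
    then show "[2 \<noteq> 0] (mod int p)" unfolding cong_0_iff .
  qed (use p in auto)
  define m where "m = (int p - 1) div 2"
  have pm: "int p = 2 * m + 1" using G.p_eq2 by (simp add: m_def)
  have m0: "m > 0" using p(2) pm by simp
  have C: "G.C = (\<lambda>x. 2 * x) ` {0<..m}"
  proof -
    have "x * 2 mod int p = 2 * x" if "x \<in> {0<..m}" for x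
      using that pm by (simp add: mult.commute mod_pos_pos_trivial)
    then show ?thesis unfolding G.C_def G.B_def G.A_def image_image m_def[symmetric] by (intro image_cong) auto
  qed
  have E: "G.E = (\<lambda>x. 2 * x) ` {m div 2<..m}"
    unfolding G.E_def C m_def[symmetric]
  proof (intro equalityI subsetI)
    fix y assume "y \<in> (\<lambda>x. 2 * x) ` {0<..m} \<inter> {m<..}"
    then obtain x where x: "y = 2 * x" "0 < x" "x \<le> m" "m < 2 * x" by auto
    then have "m div 2 < x" by presburger
    with x show "y \<in> (\<lambda>x. 2 * x) ` {m div 2<..m}" by simp
  next
    fix y assume "y \<in> (\<lambda>x. 2 * x) ` {m div 2<..m}"
    then obtain x where x: "y = 2 * x" "m div 2 < x" "x \<le> m" by auto
    then have "m < 2 * x" "0 < x" using m0 by presburger+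
    with x show "y \<in> (\<lambda>x. 2 * x) ` {0<..m} \<inter> {m<..}" by simp
  qed
  have "card G.E = card {m div 2<..m}" unfolding E by (rule card_image) (auto simp: inj_on_def)
  then have "card G.E = nat (m - m div 2)" by simp
  then have L2: "Legendre 2 (int p) = (- 1) ^ nat (m - m div 2)" using G.gauss_lemma by simp
  have "Legendre (- 2) (int p) = (- 1) ^ ((p - 1) div 2) * (- 1) ^ nat (m - m div 2)"
    using Legendre_mult[OF p, of "- 1" 2] Legendre_minus_1[OF p] L2 by simp
  also have "(p - 1) div 2 = nat m" using pm by linarith
  also have "(- 1) ^ nat m * (- 1) ^ nat (m - m div 2) = (- 1 :: int) ^ nat (m + (m - m div 2))"
  proof -
    have "nat m + nat (m - m div 2) = nat (m + (m - m div 2))" using m0 by linarith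
    then show ?thesis by (simp only: power_add[symmetric])
  qed
  finally have L: "Legendre (- 2) (int p) = (- 1) ^ nat (m + (m - m div 2))" .
  \<comment> \<open>The exponent is \<open>2 * m - m div 2\<close>, so only the parity of
    \<open>m div 2\<close> matters, and \<open>p = 2 * m + 1\<close> modulo 8 determines it.\<close>
  have par: "even (nat (m + (m - m div 2))) \<longleftrightarrow> even (m div 2)" using m0 by (simp add: even_nat_iff)
  have "int p mod 8 \<in> {1, 3} \<and> even (m div 2) \<or> int p mod 8 \<in> {5, 7} \<and> odd (m div 2)"
    unfolding pm insert_iff empty_iff by presburger
  then show ?thesis unfolding L chi8_def Let_def using par by auto
qed

lemma Legendre_eq_chi:
  assumes p: "Factorial_Ring.prime p" "p > 3"
  shows "Legendre (- 3) (int p) = chi3 (int p)" "Legendre (- 11) (int p) = chi11 (int p)"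
    "Legendre (- 2) (int p) = chi8 (int p)"
proof -
  show "Legendre (- 3) (int p) = chi3 (int p)"
    using Legendre_minus_prime[of p 3] p by (simp add: chi3_eq_Legendre)
  show "Legendre (- 11) (int p) = chi11 (int p)"
  \<comment> \<open>Reciprocity needs distinct primes; at 11 both sides are 0.\<close>
  proof (cases "p = 11")
    case True
    then show ?thesis by (simp add: Legendre_def unique_euclidean_semiring_class.cong_def chi11_def)
  next
    case False
    have "Factorial_Ring.prime (11 :: nat)" by simp
    then show ?thesis using Legendre_minus_prime[of p 11] p False by (simp add: chi11_eq_Legendre)
  qed
  show "Legendre (- 2) (int p) = chi8 (int p)" using chi8_eq_Legendre p by simp
qed

section \<open>The eight products and their prime sums\<close>

definition chi :: "nat \<times> nat \<times> nat \<Rightarrow> int \<Rightarrow> int" where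
  "chi = (\<lambda>(i, j, k) n. chi3 n ^ i * chi11 n ^ j * chi8 n ^ k)"

definition chi_real :: "nat \<times> nat \<times> nat \<Rightarrow> nat \<Rightarrow> real" where
  "chi_real e n = of_int (chi e (int n))"

definition exponents :: "(nat \<times> nat \<times> nat) set" where
  "exponents = {0, 1} \<times> {0, 1} \<times> {0, 1}"

lemma chi_values: "chi3 n \<in> {-1, 0, 1}" "chi11 n \<in> {-1, 0, 1}" "chi8 n \<in> {-1, 0, 1}"
  by (auto simp: chi3_def chi11_def chi8_def Let_def)

lemma chi_real_values: "e \<in> exponents \<Longrightarrow> chi_real e n \<in> {-1, 0, 1}"
  using chi_values[of "int n"] by (auto simp: exponents_def chi_real_def chi_def)

lemma chi_real_completely_multiplicative:
  assumes "e \<in> exponents"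
  shows "completely_multiplicative (chi_real e)"
proof
  show "chi_real e 1 = 1" by (cases e) (simp add: chi_real_def chi_def chi3_def chi11_def chi8_def)
  show "chi_real e (m * n) = chi_real e m * chi_real e n" for m n
    by (cases e) (simp add: chi_real_def chi_def chi_mult power_mult_distrib mult_ac)
  show "\<bar>chi_real e n\<bar> \<le> 1" for n using chi_real_values[OF assms, of n] by auto
qed

lemma sum_nat_as_int_list: "(\<Sum>k<n. h (int k)) = sum_list (map h (upto 0 (int n - 1)))"
proof (induction n)
  case (Suc n)
  have "upto 0 (int (Suc n) - 1) = upto 0 (int n - 1) @ [int n]"
    using upto_rec2[of 0 "int n"] by simp
  then show ?case using Suc by simp
qed simp

text \<open>264 = 3 * 8 * 11 is a common period of all products; the triples are the nontrivial
  exponents.\<close>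

lemma chi_period_sums:
  "\<forall>e \<in> set [(0, 0, 1), (0, 1, 0), (0, 1, 1), (1, 0, 0), (1, 0, 1), (1, 1, 0), (1, 1, 1)].
     sum_list (map (chi e) (upto 0 263)) = 0"
  by code_simp

lemma chi_real_character:
  assumes e: "e \<in> exponents - {(0, 0, 0)}"
  shows "real_character (chi_real e) 264"
proof -
  interpret completely_multiplicative "chi_real e"
    using chi_real_completely_multiplicative e by blast
  show ?thesis
  proof
    have "(x + 264) mod 3 = x mod 3" "(x + 264) mod 11 = x mod 11" "(x + 264) mod 8 = x mod 8" for x :: int
      by presburger+
    then show "chi_real e (n + 264) = chi_real e n" for n
      by (cases e) (simp add: chi_real_def chi_def chi3_def chi11_def chi8_def)
    have "e \<in> set [(0, 0, 1), (0, 1, 0), (0, 1, 1), (1, 0, 0), (1, 0, 1), (1, 1, 0), (1, 1, 1)]"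
      using e by (auto simp: exponents_def)
    then have "(\<Sum>k<264. chi e (int k)) = 0"
      using chi_period_sums unfolding sum_nat_as_int_list by fastforce
    then show "(\<Sum>k<264. chi_real e k) = 0"
      unfolding chi_real_def of_int_sum[symmetric] by (simp only: of_int_0)
    show "chi_real e n \<in> {-1, 0, 1}" for n using chi_real_values e by blast
  qed simp
qed

text \<open>The zeta series dominates its partial sums, which near 1 approach those of the harmonic
  series; its logarithm differs from the prime sum by a bounded amount.\<close>

lemma prime_zeta_at_top:
  "filterlim (\<lambda>s. \<Sum>\<^sub>\<infinity>p | Factorial_Ring.prime p. real p powr (- s)) at_top (at_right 1)"
proof -
  interpret one: completely_multiplicative "\<lambda>_. 1" by standard auto
  have s1: "\<forall>\<^sub>F s in at_right (1 :: real). s > 1" by (rule eventually_at_right_less)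
  have zeta: "filterlim (dirichlet_series (\<lambda>_. 1)) at_top (at_right 1)"
    unfolding filterlim_at_top
  proof
    fix Z :: real
    obtain N where N: "(\<Sum>k<N. real k powr (- 1)) > Z"
    proof (rule ccontr)
      assume "\<not> thesis"
      then have "(\<Sum>k<N. real k powr (- 1)) \<le> Z" for N using that not_less by blast
      then have "summable (\<lambda>k. real k powr (- 1))" by (intro summableI_nonneg_bounded[of _ Z]) auto
      then show False unfolding summable_real_powr_iff by simp
    qed
    have "((\<lambda>s. \<Sum>k<N. real k powr (- s)) \<longlongrightarrow> (\<Sum>k<N. real k powr (- 1))) (at_right 1)"
    proof (rule tendsto_sum)
      fix k show "((\<lambda>s. real k powr (- s)) \<longlongrightarrow> real k powr (- 1)) (at_right 1)"
      proof (cases "k = 0")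
        case False
        then show ?thesis by (intro tendsto_powr tendsto_const tendsto_minus tendsto_ident_at) simp
      qed simp
    qed
    then have "\<forall>\<^sub>F s in at_right 1. (\<Sum>k<N. real k powr (- s)) > Z" using N by (rule order_tendstoD)
    with s1 show "\<forall>\<^sub>F s in at_right 1. Z \<le> dirichlet_series (\<lambda>_. 1) s"
    proof eventually_elim
      case (elim s)
      have "(\<Sum>k<N. real k powr (- s)) \<le> (\<Sum>k. real k powr (- s))"
        using elim by (intro sum_le_suminf) (auto simp: summable_real_powr_iff)
      then show ?case using elim by (simp add: dirichlet_series_def)
    qed
  qed
  have "filterlim (\<lambda>s. - (2 * (\<Sum>n. 1 / (real n)\<^sup>2)) + ln (dirichlet_series (\<lambda>_. 1) s)) at_top (at_right 1)"
    by (intro filterlim_tendsto_add_at_top[OF tendsto_const] filterlim_compose[OF ln_at_top zeta])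
  then show ?thesis
  proof (rule filterlim_at_top_mono)
    show "\<forall>\<^sub>F s in at_right 1. - (2 * (\<Sum>n. 1 / (real n)\<^sup>2)) + ln (dirichlet_series (\<lambda>_. 1) s)
        \<le> (\<Sum>\<^sub>\<infinity>p | Factorial_Ring.prime p. real p powr (- s))"
      using s1
    proof eventually_elim
      case (elim s)
      then show ?case using one.prime_sum_ln_series[of s] by (simp add: one.prime_sum_def)
    qed
  qed
qed

lemma has_sum_sum:
  fixes u :: "'i \<Rightarrow> 'a \<Rightarrow> real"
  assumes "finite I" "\<And>i. i \<in> I \<Longrightarrow> (u i has_sum l i) A"
  shows "((\<lambda>x. \<Sum>i\<in>I. u i x) has_sum (\<Sum>i\<in>I. l i)) A"
  using assms by (induction rule: finite_induct) (auto intro!: has_sum_add has_sum_0)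

text \<open>Of the eight prime sums only the one for \<open>(0, 0, 0)\<close> is unbounded, so
  \<open>8 * N s\<close> and \<open>D s\<close> differ by a bounded amount while \<open>D s\<close>
  diverges.\<close>

lemma density_one_eighth:
  assumes S: "\<And>p. Factorial_Ring.prime p \<Longrightarrow> p > 3 \<Longrightarrow> p \<in> S \<longleftrightarrow>
      chi3 (int p) = 1 \<and> chi11 (int p) = 1 \<and> chi8 (int p) = 1"
    and S3: "\<And>p. p \<in> S \<Longrightarrow> p > 3"
  shows "has_Dirichlet_density S (1 / 8)"
proof -
  define P where "P = {p :: nat. Factorial_Ring.prime p}"
  define D where "D s = (\<Sum>\<^sub>\<infinity>p\<in>P. real p powr (- s))" for s
  define N where "N s = (\<Sum>\<^sub>\<infinity>p | Factorial_Ring.prime p \<and> p \<in> S. real p powr (- s))" for s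
  define B where "B = exponents - {(0, 0, 0)}"
  define T where "T e s = (\<Sum>\<^sub>\<infinity>p\<in>P. chi_real e p * real p powr (- s))" for e s
  \<comment> \<open>The correction at 2 and 3, which lie outside \<open>S\<close> whatever their
    character values.\<close>
  define R where "R s = (\<Sum>p\<in>{2, 3}. (\<Sum>e\<in>exponents. chi_real e p) * real p powr (- s))" for s
  have fin: "finite exponents" by (simp add: exponents_def)
  have total: "(\<Sum>e\<in>exponents. chi_real e p)
      = of_int ((1 + chi3 (int p)) * (1 + chi11 (int p)) * (1 + chi8 (int p)))" for p
    by (simp add: exponents_def chi_real_def chi_def sum.cartesian_product[symmetric] algebra_simps)
  have ind: "(\<Sum>e\<in>exponents. chi_real e p) = (if p \<in> S then 8 else 0)" if p: "p \<in> P" "p > 3" for p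
  proof -
    have pp: "Factorial_Ring.prime p" using p by (simp add: P_def)
    have nd: "\<not> q dvd p" if "q > 1" "q \<noteq> p" for q
      using pp that prime_nat_iff by (metis less_irrefl)
    have c3: "chi3 (int p) \<in> {-1, 1}"
    proof -
      have "\<not> 3 dvd int p" using nd[of 3] p by presburger
      then show ?thesis using chi_values(1)[of "int p"] by (auto simp: chi3_def Let_def dvd_eq_mod_eq_0)
    qed
    have c8: "chi8 (int p) \<in> {-1, 1}"
    proof -
      have "odd (int p)" using nd[of 2] p by simp
      then have "int p mod 8 \<in> {1, 3, 5, 7}" unfolding insert_iff empty_iff by presburger
      then show ?thesis by (auto simp: chi8_def Let_def)
    qed
    \<comment> \<open>At 11 the factor with \<open>chi11\<close> is 1, but
      \<open>chi3 11 = -1\<close> makes the product vanish, in accordance with 11 not being in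
      \<open>S\<close>.\<close>
    have c11: "chi11 (int p) \<in> {-1, 1} \<or> chi3 (int p) = -1"
    proof (cases "p = 11")
      case False
      then have "\<not> 11 dvd int p" using nd[of 11] by presburger
      then show ?thesis by (auto simp: chi11_def Let_def dvd_eq_mod_eq_0)
    qed (simp add: chi3_def)
    show ?thesis using S[OF pp p(2)] c3 c8 c11 unfolding total by auto
  qed
  have w_sum: "((\<lambda>p. chi_real e p * real p powr (- s)) has_sum T e s) P" if "e \<in> exponents" "s > 1" for e s
    using completely_multiplicative.g_summable[OF chi_real_completely_multiplicative[OF that(1)] that(2), of P]
    unfolding T_def by simp
  \<comment> \<open>\<open>x ^ 0 = 1\<close> also for \<open>x = 0\<close>: the trivial exponent
    gives the constant 1 rather than the principal character modulo 264, and its prime sum is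
    exactly the denominator of the density.\<close>
  have T0: "T (0, 0, 0) s = D s" for s by (simp add: T_def D_def chi_real_def chi_def)
  have eq: "8 * N s = D s + (\<Sum>e\<in>B. T e s) - R s" if s: "s > 1" for s
  proof -
    have "((\<lambda>p. \<Sum>e\<in>exponents. chi_real e p * real p powr (- s)) has_sum (\<Sum>e\<in>exponents. T e s)) P"
      by (intro has_sum_sum fin w_sum s)
    then have 1: "((\<lambda>p. (\<Sum>e\<in>exponents. chi_real e p) * real p powr (- s)) has_sum (\<Sum>e\<in>exponents. T e s)) P"
      by (simp only: sum_distrib_right)
    have "(\<lambda>p. real p powr (- s)) summable_on P \<inter> S"
      by (rule abs_summable_imp_infsum(1)) (use s in \<open>simp add: summable_real_powr_iff\<close>)
    then have "((\<lambda>p. real p powr (- s)) has_sum N s) (P \<inter> S)"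
      unfolding N_def P_def Collect_conj_eq by simp
    then have "((\<lambda>p. if p \<in> S then real p powr (- s) else 0) has_sum N s) P"
      by (rule has_sum_cong_neutral[THEN iffD1, rotated -1]) auto
    then have "((\<lambda>p. 8 * (if p \<in> S then real p powr (- s) else 0)) has_sum 8 * N s) P"
      by (rule has_sum_cmult_right)
    moreover have "((\<lambda>p. if p \<in> {2, 3} then (\<Sum>e\<in>exponents. chi_real e p) * real p powr (- s) else 0)
        has_sum R s) P"
    proof -
      have "((\<lambda>p. (\<Sum>e\<in>exponents. chi_real e p) * real p powr (- s)) has_sum R s) {2, 3}"
        unfolding R_def by (rule has_sum_finite) simp
      then show ?thesis
        by (rule has_sum_cong_neutral[THEN iffD1, rotated -1]) (auto simp: P_def)
    qed
    ultimately have 2: "((\<lambda>p. 8 * (if p \<in> S then real p powr (- s) else 0)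
        + (if p \<in> {2, 3} then (\<Sum>e\<in>exponents. chi_real e p) * real p powr (- s) else 0))
        has_sum (8 * N s + R s)) P"
      by (rule has_sum_add)
    have "8 * (if p \<in> S then real p powr (- s) else 0)
        + (if p \<in> {2, 3} then (\<Sum>e\<in>exponents. chi_real e p) * real p powr (- s) else 0)
        = (\<Sum>e\<in>exponents. chi_real e p) * real p powr (- s)" if "p \<in> P" for p
    proof (cases "p > 3")
      case True
      then show ?thesis using ind[OF that True] by simp
    next
      case False
      then have "p \<in> {2, 3}" using that prime_ge_2_nat[of p] by (auto simp: P_def)
      moreover have "p \<notin> S" using False S3 by blast
      ultimately show ?thesis by simp
    qed
    with 2 have "((\<lambda>p. (\<Sum>e\<in>exponents. chi_real e p) * real p powr (- s)) has_sum (8 * N s + R s)) P"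
      by (simp cong: has_sum_cong)
    with 1 have "8 * N s + R s = (\<Sum>e\<in>exponents. T e s)" using has_sum_unique by blast
    also have "\<dots> = T (0, 0, 0) s + (\<Sum>e\<in>B. T e s)"
      unfolding B_def by (rule sum.remove[OF fin]) (simp add: exponents_def)
    finally show ?thesis by (simp add: T0)
  qed
  have s1: "\<forall>\<^sub>F s in at_right (1 :: real). s > 1" by (rule eventually_at_right_less)
  have "\<forall>e\<in>B. \<exists>C. \<forall>\<^sub>F s in at_right 1. \<bar>T e s\<bar> \<le> C"
  proof
    fix e assume "e \<in> B"
    then interpret real_character "chi_real e" 264 unfolding B_def by (rule chi_real_character)
    show "\<exists>C. \<forall>\<^sub>F s in at_right 1. \<bar>T e s\<bar> \<le> C"
      using prime_sum_bounded unfolding prime_sum_def T_def P_def .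
  qed
  then obtain C where C: "\<And>e. e \<in> B \<Longrightarrow> \<forall>\<^sub>F s in at_right 1. \<bar>T e s\<bar> \<le> C e" by metis
  define K where "K = (\<Sum>e\<in>B. C e) + (\<Sum>p\<in>{2, 3 :: nat}. \<bar>\<Sum>e\<in>exponents. chi_real e p\<bar>)"
  have finB: "finite B" unfolding B_def using fin by simp
  then have "\<forall>\<^sub>F s in at_right 1. \<forall>e\<in>B. \<bar>T e s\<bar> \<le> C e"
    using C by (simp add: eventually_ball_finite_distrib)
  with s1 have bounded: "\<forall>\<^sub>F s in at_right 1. \<bar>(\<Sum>e\<in>B. T e s) - R s\<bar> \<le> K"
  proof eventually_elim
    case (elim s)
    have "\<bar>\<Sum>e\<in>B. T e s\<bar> \<le> (\<Sum>e\<in>B. C e)"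
      using elim(2) by (intro order_trans[OF sum_abs] sum_mono) auto
    moreover have "\<bar>R s\<bar> \<le> (\<Sum>p\<in>{2, 3 :: nat}. \<bar>\<Sum>e\<in>exponents. chi_real e p\<bar>)"
      unfolding R_def
    proof (intro order_trans[OF sum_abs] sum_mono)
      fix p :: nat assume p: "p \<in> {2, 3}"
      have "real p powr (- s) \<le> real p powr 0" using p elim(1) by (intro powr_mono) auto
      then have "real p powr (- s) \<le> 1" using p by auto
      then show "\<bar>(\<Sum>e\<in>exponents. chi_real e p) * real p powr (- s)\<bar> \<le> \<bar>\<Sum>e\<in>exponents. chi_real e p\<bar>"
        unfolding abs_mult by (intro mult_right_le_one_le) auto
    qed
    ultimately show ?case unfolding K_def by linarith
  qed
  have Dtop: "filterlim D at_top (at_right 1)" using prime_zeta_at_top unfolding D_def P_def .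
  have "((\<lambda>s. K / D s) \<longlongrightarrow> 0) (at_right 1)"
    by (rule real_tendsto_divide_at_top[OF tendsto_const Dtop])
  moreover have Dpos: "\<forall>\<^sub>F s in at_right 1. D s > 0" using Dtop by (simp add: filterlim_at_top_dense)
  from Dpos bounded have "\<forall>\<^sub>F s in at_right 1. norm (((\<Sum>e\<in>B. T e s) - R s) / D s) \<le> K / D s"
    by eventually_elim (simp add: divide_right_mono)
  ultimately have "((\<lambda>s. ((\<Sum>e\<in>B. T e s) - R s) / D s) \<longlongrightarrow> 0) (at_right 1)"
    by (rule Lim_null_comparison[rotated])
  then have "((\<lambda>s. (1 + ((\<Sum>e\<in>B. T e s) - R s) / D s) / 8) \<longlongrightarrow> (1 + 0) / 8) (at_right 1)"
    by (intro tendsto_intros) auto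
  moreover from Dpos s1 have "\<forall>\<^sub>F s in at_right 1. (1 + ((\<Sum>e\<in>B. T e s) - R s) / D s) / 8 = N s / D s"
  proof eventually_elim
    case (elim s)
    have "N s = (D s + ((\<Sum>e\<in>B. T e s) - R s)) / 8" using eq[OF elim(2)] by simp
    then show ?case using elim(1) by (simp add: add_divide_distrib diff_divide_distrib)
  qed
  ultimately have "((\<lambda>s. N s / D s) \<longlongrightarrow> (1 + 0) / 8) (at_right 1)"
    by (rule Lim_transform_eventually)
  then have "((\<lambda>s. N s / D s) \<longlongrightarrow> 1 / 8) (at_right 1)" by simp
  then show ?thesis unfolding has_Dirichlet_density_def N_def D_def P_def .
qed

text \<open>For a finite set the numerator stays bounded, whereas the denominator diverges.\<close>

lemma positive_density_imp_infinite:
  assumes "has_Dirichlet_density S d" "d \<noteq> 0"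
  shows "infinite S"
proof
  assume fin: "finite S"
  let ?N = "\<lambda>s. \<Sum>\<^sub>\<infinity>p | Factorial_Ring.prime p \<and> p \<in> S. real p powr (- s)"
  let ?D = "\<lambda>s. \<Sum>\<^sub>\<infinity>p | Factorial_Ring.prime p. real p powr (- s)"
  have finS: "finite {p. Factorial_Ring.prime p \<and> p \<in> S}" using fin by simp
  have "((\<lambda>s. \<Sum>p | Factorial_Ring.prime p \<and> p \<in> S. real p powr (- s)) \<longlongrightarrow>
      (\<Sum>p | Factorial_Ring.prime p \<and> p \<in> S. real p powr (- 1))) (at_right 1)"
    by (intro tendsto_intros) (auto dest: prime_gt_0_nat)
  then have "((\<lambda>s. ?N s / ?D s) \<longlongrightarrow> 0) (at_right 1)"
    unfolding infsum_finite[OF finS] by (rule real_tendsto_divide_at_top[OF _ prime_zeta_at_top])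
  moreover have "((\<lambda>s. ?N s / ?D s) \<longlongrightarrow> d) (at_right 1)"
    using assms(1) unfolding has_Dirichlet_density_def .
  ultimately show False using assms(2) tendsto_unique[of "at_right (1 :: real)"] by force
qed

text \<open>The functions \<open>a\<close> and \<open>b\<close> choose an arbitrary presentation of
  the algebra for each prime.\<close>

theorem theorem5p3:
  fixes a b :: "nat \<Rightarrow> rat"
  assumes A: "\<And>r. Factorial_Ring.prime r \<Longrightarrow> r > 3 \<Longrightarrow> ramified_exactly_at_and_infinity (a r) (b r) r"
  shows "(\<forall>r. Factorial_Ring.prime r \<and> r > 3 \<longrightarrow>
            (is_outlier (a r) (b r) 3 \<longleftrightarrow>
               Legendre (- 3) (int r) = 1 \<and> Legendre (- 11) (int r) = 1 \<and> Legendre (- 2) (int r) = 1))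
         \<and> infinite {r. Factorial_Ring.prime r \<and> r > 3 \<and> is_outlier (a r) (b r) 3}
         \<and> has_Dirichlet_density
             {r. Factorial_Ring.prime r \<and> r > 3 \<and> is_outlier (a r) (b r) 3} (1 / 8)"
proof (intro conjI)
  have iff: "is_outlier (a r) (b r) 3 \<longleftrightarrow>
      Legendre (- 3) (int r) = 1 \<and> Legendre (- 11) (int r) = 1 \<and> Legendre (- 2) (int r) = 1"
    if "Factorial_Ring.prime r" "r > 3" for r
    using outlier_3_iff[OF A[OF that] that] .
  then show "\<forall>r. Factorial_Ring.prime r \<and> r > 3 \<longrightarrow>
      (is_outlier (a r) (b r) 3 \<longleftrightarrow>
         Legendre (- 3) (int r) = 1 \<and> Legendre (- 11) (int r) = 1 \<and> Legendre (- 2) (int r) = 1)"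
    by blast
  show density: "has_Dirichlet_density
      {r. Factorial_Ring.prime r \<and> r > 3 \<and> is_outlier (a r) (b r) 3} (1 / 8)"
    by (rule density_one_eighth) (auto simp: iff Legendre_eq_chi)
  then show "infinite {r. Factorial_Ring.prime r \<and> r > 3 \<and> is_outlier (a r) (b r) 3}"
    by (rule positive_density_imp_infinite) simp
qed

end
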